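(* Let $(X,T)$ be a topologically free Deaconu-Renault system such that $\ker\sigma_X$ is topologically transitive. Assume that there exists a compact open set $U\subsetneq X$ such that $T(U)=X$ and $T|_U$ is injective (and hence $X$ is compact and $T$ is proper). Then $$\mathrm{Aut}(G(X,T);\ker\sigma_X)=\{\Phi\in\mathrm{Aut}(G(X,T))\mid\sigma_X\circ\Phi=\sigma_X\}$$ holds. In particular, the groups $\mathfrak{RW}_{G(X,T),\ker\sigma_X}$, $\mathrm{Aut}(G(X,T);\ker\sigma_X)$ and $\mathfrak{A}_{(X,T)}$ are isomorphic to each other.
   Context: $\mathbb{N}=\{0,1,2,\dots\}$. A Deaconu-Renault system $(X,T)$ consists of a locally compact Hausdorff space $X$ and a local homeomorphism $T\colon X\to X$. Its groupoid is $$G(X,T)=\{(y,n-m,x)\in X\times\mathbb{Z}\times X: n,m\in\mathbb{N},\ T^ny=T^mx\},$$ with unit space $\{(x,0,x)\}$ identified with $X$, $d(y,n,x)=x$, $r(y,n,x)=y$, $(z,n,y)(y,m,x)=(z,n+m,x)$, $(y,m,x)^{-1}=(x,-m,y)$, and the topology generated by the sets $Z(U,n,m,V)=\{(y,n-m,x)\in G(X,T): y\in U, x\in V, T^ny=T^mx\}$ for $U,V\subset X$ open and $n,m\in\mathbb{N}$; it is a locally compact Hausdorff étale groupoid. The canonical continuous cocycle is $\sigma_X\colon G(X,T)\to\mathbb{Z}$, $\sigma_X(y,n,x)=n$, and $\ker\sigma_X=\sigma_X^{-1}(\{0\})$, an open subgroupoid containing $X$. $(X,T)$ is topologically free if $G(X,T)$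 is topologically principal, i.e. the set of $x\in X$ with $\{\alpha: d(\alpha)=r(\alpha)=x\}=\{x\}$ is dense in $X$ (for such groupoids this is equivalent to effectiveness). An étale groupoid $H$ is topologically transitive if $r(d^{-1}(U))$ is dense in $H^{(0)}$ for every nonempty open $U\subset H^{(0)}$. For an étale groupoid $G$ and an open subgroupoid $G^{(0)}\subset H\subset G$: $\mathrm{Aut}(G)$ is the group of groupoid automorphisms that are homeomorphisms, $\mathrm{Aut}(G;H)=\{\Phi\in\mathrm{Aut}(G):\Phi(H)=H\}$, and, for $G$ effective, $$\mathfrak{RW}_{G,H}=\mathrm{Aut}(C^*_r(G);C^*_r(H),C_0(G^{(0)}))/\mathrm{Aut}_{C_0(G^{(0)})}(C^*_r(G)),$$ where $C^*_r$ is the reduced groupoid C*-algebra, $C^*_r(H)$ is the closure of $C_c(H)$ in $C^*_r(G)$, $\mathrm{Aut}(A;B_1,B_2)$ is the group of *-automorphisms $\varphi$ of $A$ with $\varphi(B_i)=B_i$ for $i=1,2$, and $\mathrm{Aut}_B(A)$ is the group of *-automorphisms of $A$ fixing $B$ pointwise. For $X$ compact, a homeomorphism $h\colon X\to X$ has property (P) if there is $m\in\mathbb{N}$ with $T^{m+1}\circ h=T^m\circ h\circ T$; $\mathfrak{A}_{(X,T)}$ is the group (under composition) of homeomorphisms $h$ of $X$ such that both $h$ and $h^{-1}$ have property (P). *)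

theory Defs
  imports "HOL-Analysis.Analysis" "HOL-Algebra.Coset" "HOL-Algebra.Bij"
begin

section \<open>The Hilbert space of square summable families\<close>

typedef 'i ell2 = "{f :: 'i \<Rightarrow> complex. (\<lambda>i. (cmod (f i))\<^sup>2) summable_on UNIV}"
  morphisms ell2_coord Abs_ell2
  by (rule exI[of _ "\<lambda>_. 0"]) simp

setup_lifting type_definition_ell2

lemma ell2_summable: "(\<lambda>i. (cmod (ell2_coord x i))\<^sup>2) summable_on UNIV"
  using ell2_coord by auto

lemma square_summable_add:
  fixes f g :: "'i \<Rightarrow> complex"
  assumes "(\<lambda>i. (cmod (f i))\<^sup>2) summable_on A" and "(\<lambda>i. (cmod (g i))\<^sup>2) summable_on A"
  shows "(\<lambda>i. (cmod (f i + g i))\<^sup>2) summable_on A"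
proof (rule summable_on_comparison_test)
  show "(\<lambda>i. 2 * (cmod (f i))\<^sup>2 + 2 * (cmod (g i))\<^sup>2) summable_on A"
    by (intro summable_on_add summable_on_cmult_right assms)
next
  fix i
  have "(cmod (f i + g i))\<^sup>2 \<le> (cmod (f i) + cmod (g i))\<^sup>2"
    by (intro power_mono norm_triangle_ineq) auto
  also have "\<dots> \<le> 2 * (cmod (f i))\<^sup>2 + 2 * (cmod (g i))\<^sup>2"
    using sum_squares_ge_zero[of "cmod (f i) - cmod (g i)" 0]
    by (simp add: power2_eq_square algebra_simps)
  finally show "(cmod (f i + g i))\<^sup>2 \<le> 2 * (cmod (f i))\<^sup>2 + 2 * (cmod (g i))\<^sup>2" .
qed auto

lemma square_summable_cmult:
  fixes f :: "'i \<Rightarrow> complex"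
  assumes "(\<lambda>i. (cmod (f i))\<^sup>2) summable_on A"
  shows "(\<lambda>i. (cmod (c * f i))\<^sup>2) summable_on A"
  using summable_on_cmult_right[OF assms, of "(cmod c)\<^sup>2"]
  by (simp add: norm_mult power_mult_distrib)

lemma square_summable_mult_cnj:
  fixes f g :: "'i \<Rightarrow> complex"
  assumes "(\<lambda>i. (cmod (f i))\<^sup>2) summable_on A" and "(\<lambda>i. (cmod (g i))\<^sup>2) summable_on A"
  shows "(\<lambda>i. f i * cnj (g i)) summable_on A"
proof -
  have "(\<lambda>i. norm (f i * cnj (g i))) summable_on A"
  proof (rule summable_on_comparison_test)
    show "(\<lambda>i. (cmod (f i))\<^sup>2 + (cmod (g i))\<^sup>2) summable_on A"
      by (intro summable_on_add assms)
  next
    fix i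
    have "2 * (cmod (f i) * cmod (g i)) \<le> (cmod (f i))\<^sup>2 + (cmod (g i))\<^sup>2"
      using sum_squares_ge_zero[of "cmod (f i) - cmod (g i)" 0]
      by (simp add: power2_eq_square algebra_simps)
    moreover have "0 \<le> cmod (f i) * cmod (g i)" by simp
    ultimately have "cmod (f i) * cmod (g i) \<le> (cmod (f i))\<^sup>2 + (cmod (g i))\<^sup>2" by linarith
    then show "norm (f i * cnj (g i)) \<le> (cmod (f i))\<^sup>2 + (cmod (g i))\<^sup>2"
      by (simp add: norm_mult)
  qed auto
  then show ?thesis by (rule abs_summable_summable)
qed

definition ell2_cinner :: "'i ell2 \<Rightarrow> 'i ell2 \<Rightarrow> complex"
  where "ell2_cinner x y = (\<Sum>\<^sub>\<infinity>i. ell2_coord x i * cnj (ell2_coord y i))"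

lift_definition ell2_scaleC :: "complex \<Rightarrow> 'i ell2 \<Rightarrow> 'i ell2" is "\<lambda>c f i. c * f i"
  using square_summable_cmult by blast

instantiation ell2 :: (type) real_inner
begin

lift_definition zero_ell2 :: "'a ell2" is "\<lambda>_. 0" by simp

lift_definition plus_ell2 :: "'a ell2 \<Rightarrow> 'a ell2 \<Rightarrow> 'a ell2" is "\<lambda>f g i. f i + g i"
  using square_summable_add by blast

lift_definition uminus_ell2 :: "'a ell2 \<Rightarrow> 'a ell2" is "\<lambda>f i. - f i" by simp

definition minus_ell2 :: "'a ell2 \<Rightarrow> 'a ell2 \<Rightarrow> 'a ell2" where "minus_ell2 x y = x + (- y)"

definition scaleR_ell2 :: "real \<Rightarrow> 'a ell2 \<Rightarrow> 'a ell2"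
  where "scaleR_ell2 c x = ell2_scaleC (complex_of_real c) x"

definition inner_ell2 :: "'a ell2 \<Rightarrow> 'a ell2 \<Rightarrow> real" where "inner_ell2 x y = Re (ell2_cinner x y)"

definition norm_ell2 :: "'a ell2 \<Rightarrow> real"
  where "norm_ell2 x = sqrt (\<Sum>\<^sub>\<infinity>i. (cmod (ell2_coord x i))\<^sup>2)"

definition sgn_ell2 :: "'a ell2 \<Rightarrow> 'a ell2" where "sgn_ell2 x = scaleR (inverse (norm x)) x"

definition dist_ell2 :: "'a ell2 \<Rightarrow> 'a ell2 \<Rightarrow> real" where "dist_ell2 x y = norm (x - y)"

definition uniformity_ell2 :: "('a ell2 \<times> 'a ell2) filter"
  where "uniformity_ell2 = (INF e\<in>{0<..}. principal {(x, y). dist x y < e})"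

definition open_ell2 :: "'a ell2 set \<Rightarrow> bool"
  where "open_ell2 U \<longleftrightarrow> (\<forall>x\<in>U. \<forall>\<^sub>F (x', y) in uniformity. x' = x \<longrightarrow> y \<in> U)"

lemma ell2_cinner_summable:
  "(\<lambda>i. ell2_coord x i * cnj (ell2_coord y i)) summable_on UNIV"
  by (intro square_summable_mult_cnj ell2_summable)

lemma ell2_cinner_add: "ell2_cinner (x + y) z = ell2_cinner x z + ell2_cinner y z"
  unfolding ell2_cinner_def plus_ell2.rep_eq
  by (simp add: distrib_right infsum_add ell2_cinner_summable)

lemma ell2_cinner_scaleC: "ell2_cinner (ell2_scaleC c x) z = c * ell2_cinner x z"
  unfolding ell2_cinner_def ell2_scaleC.rep_eq
  by (simp add: mult.assoc infsum_cmult_right')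

lemma ell2_cinner_self:
  "ell2_cinner x x = complex_of_real (\<Sum>\<^sub>\<infinity>i. (cmod (ell2_coord x i))\<^sup>2)"
proof -
  have "ell2_cinner x x = (\<Sum>\<^sub>\<infinity>i. complex_of_real ((cmod (ell2_coord x i))\<^sup>2))"
    unfolding ell2_cinner_def by (simp only: complex_norm_square)
  also have "\<dots> = complex_of_real (\<Sum>\<^sub>\<infinity>i. (cmod (ell2_coord x i))\<^sup>2)"
    by (intro infsumI has_sum_of_real_iff[THEN iffD2] has_sum_infsum ell2_summable)
  finally show ?thesis .
qed

lemma ell2_cinner_cnj: "ell2_cinner y x = cnj (ell2_cinner x y)"
  unfolding ell2_cinner_def by (simp flip: infsum_cnj add: mult.commute)

instance
proof
  fix x y z :: "'a ell2" and a b :: real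
  show "x + y + z = x + (y + z)" by transfer (simp add: add.assoc)
  show "x + y = y + x" by transfer (simp add: add.commute)
  show "0 + x = x" by transfer simp
  show "- x + x = 0" by transfer simp
  show "x - y = x + - y" by (rule minus_ell2_def)
  show "a *\<^sub>R (x + y) = a *\<^sub>R x + a *\<^sub>R y"
    unfolding scaleR_ell2_def by transfer (simp add: distrib_left)
  show "(a + b) *\<^sub>R x = a *\<^sub>R x + b *\<^sub>R x"
    unfolding scaleR_ell2_def by transfer (simp add: distrib_right)
  show "a *\<^sub>R b *\<^sub>R x = (a * b) *\<^sub>R x"
    unfolding scaleR_ell2_def by transfer (simp add: mult.assoc)
  show "1 *\<^sub>R x = x" unfolding scaleR_ell2_def by transfer simp
  show "dist x y = norm (x - y)" by (rule dist_ell2_def)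
  show "sgn x = scaleR (inverse (norm x)) x" by (rule sgn_ell2_def)
  show "uniformity = (INF e\<in>{0<..}. principal {(x, y). dist x (y :: 'a ell2) < e})"
    by (rule uniformity_ell2_def)
  show "open U \<longleftrightarrow> (\<forall>x\<in>U. \<forall>\<^sub>F (x', y) in uniformity. x' = x \<longrightarrow> y \<in> U)" for U :: "'a ell2 set"
    by (rule open_ell2_def)
  show "inner x y = inner y x"
    unfolding inner_ell2_def by (subst ell2_cinner_cnj) simp
  show "inner (x + y) z = inner x z + inner y z"
    unfolding inner_ell2_def by (simp add: ell2_cinner_add)
  show "inner (a *\<^sub>R x) y = a * inner x y"
    unfolding inner_ell2_def scaleR_ell2_def by (simp add: ell2_cinner_scaleC)
  show "0 \<le> inner x x"
    unfolding inner_ell2_def by (simp add: ell2_cinner_self infsum_nonneg)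
  show "norm x = sqrt (inner x x)"
    unfolding inner_ell2_def norm_ell2_def by (simp add: ell2_cinner_self)
  show "inner x x = 0 \<longleftrightarrow> x = 0"
  proof
    assume "inner x x = 0"
    then have *: "(\<Sum>\<^sub>\<infinity>i. (cmod (ell2_coord x i))\<^sup>2) = 0"
      unfolding inner_ell2_def by (simp add: ell2_cinner_self)
    have "(cmod (ell2_coord x i))\<^sup>2 = 0" for i
      using nonneg_infsum_le_0D[of "\<lambda>i. (cmod (ell2_coord x i))\<^sup>2" UNIV i] * ell2_summable
      by auto
    then show "x = 0"
      by (intro ell2_coord_inject[THEN iffD1]) (auto simp: zero_ell2.rep_eq fun_eq_iff)
  next
    assume "x = 0"
    then show "inner x x = 0"
      by (simp add: inner_ell2_def ell2_cinner_def zero_ell2.rep_eq)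
  qed
qed

end

lemma ell2_norm_scaleC: "norm (ell2_scaleC c x) = cmod c * norm x"
  by (simp add: norm_ell2_def ell2_scaleC.rep_eq norm_mult power_mult_distrib infsum_cmult_right'
      real_sqrt_mult)

lemma bounded_linear_ell2_scaleC: "bounded_linear (ell2_scaleC c)"
proof (rule bounded_linear_intro)
  show "ell2_scaleC c (x + y) = ell2_scaleC c x + ell2_scaleC c y" for x y
    by transfer (simp add: distrib_left)
  show "ell2_scaleC c (r *\<^sub>R x) = r *\<^sub>R ell2_scaleC c x" for r x
    unfolding scaleR_ell2_def by transfer (simp add: mult.left_commute)
  show "norm (ell2_scaleC c x) \<le> norm x * cmod c" for x
    by (simp add: ell2_norm_scaleC mult.commute)
qed

section \<open>Bounded operators and *-automorphisms of operator algebras\<close>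

text \<open>
  The type \<open>'i ell2 \<Rightarrow>\<^sub>L 'i ell2\<close> contains all bounded real-linear operators.
  The operator algebras defined below consist of complex-linear ones only.
\<close>

type_synonym 'i ell2_op = "'i ell2 \<Rightarrow>\<^sub>L 'i ell2"

definition op_scaleC :: "complex \<Rightarrow> 'i ell2_op \<Rightarrow> 'i ell2_op"
  where "op_scaleC c a = Blinfun (\<lambda>x. ell2_scaleC c (blinfun_apply a x))"

lemma op_scaleC_apply: "blinfun_apply (op_scaleC c a) x = ell2_scaleC c (blinfun_apply a x)"
  unfolding op_scaleC_def
  by (simp add: bounded_linear_Blinfun_apply bounded_linear_compose[OF bounded_linear_ell2_scaleC]
      blinfun.bounded_linear_right)

definition op_star :: "'i ell2_op \<Rightarrow> 'i ell2_op"
  where "op_star a = (THE b. \<forall>x y. ell2_cinner (blinfun_apply a x) y = ell2_cinner x (blinfun_apply b y))"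

text \<open>
  As in \<^theory>\<open>HOL-Algebra.Bij\<close>, the elements of a group of bijections of a set \<open>S\<close> are functions that
  are \<^const>\<open>undefined\<close> outside \<open>S\<close>, and the group operation is \<^term>\<open>compose S\<close>.
\<close>

definition star_automorphisms :: "'i ell2_op set \<Rightarrow> ('i ell2_op \<Rightarrow> 'i ell2_op) set"
  where "star_automorphisms A = {\<phi> \<in> Bij A.
    (\<forall>a\<in>A. \<forall>b\<in>A. \<phi> (a + b) = \<phi> a + \<phi> b) \<and>
    (\<forall>c. \<forall>a\<in>A. \<phi> (op_scaleC c a) = op_scaleC c (\<phi> a)) \<and>
    (\<forall>a\<in>A. \<forall>b\<in>A. \<phi> (a o\<^sub>L b) = \<phi> a o\<^sub>L \<phi> b) \<and>
    (\<forall>a\<in>A. \<phi> (op_star a) = op_star (\<phi> a))}"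

definition Aut_preserving ::
    "'i ell2_op set \<Rightarrow> 'i ell2_op set \<Rightarrow> 'i ell2_op set \<Rightarrow> ('i ell2_op \<Rightarrow> 'i ell2_op) monoid"
  where "Aut_preserving A B C =
    BijGroup A \<lparr>carrier := {\<phi> \<in> star_automorphisms A. \<phi> ` B = B \<and> \<phi> ` C = C}\<rparr>"

definition Aut_fixing :: "'i ell2_op set \<Rightarrow> 'i ell2_op set \<Rightarrow> ('i ell2_op \<Rightarrow> 'i ell2_op) set"
  where "Aut_fixing A B = {\<phi> \<in> star_automorphisms A. \<forall>b\<in>B. \<phi> b = b}"

section \<open>Topological groupoids\<close>

text \<open>
  The arrows of a groupoid are the points of its topology. Units are regarded as arrows, so
  \<open>gdom\<close> and \<open>grng\<close> are arrow-valued. The product \<open>gmul \<alpha> \<beta>\<close> is meaningful if \<open>gdom \<alpha> = grng \<beta>\<close>.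
\<close>

record 'g top_groupoid =
  gtop :: "'g topology"
  gdom :: "'g \<Rightarrow> 'g"
  grng :: "'g \<Rightarrow> 'g"
  gmul :: "'g \<Rightarrow> 'g \<Rightarrow> 'g"
  ginv :: "'g \<Rightarrow> 'g"

definition arrows :: "'g top_groupoid \<Rightarrow> 'g set"
  where "arrows G = topspace (gtop G)"

definition unit_space :: "'g top_groupoid \<Rightarrow> 'g set"
  where "unit_space G = gdom G ` arrows G"

definition unit_top :: "'g top_groupoid \<Rightarrow> 'g topology"
  where "unit_top G = subtopology (gtop G) (unit_space G)"

definition subgroupoid_of :: "'g top_groupoid \<Rightarrow> 'g set \<Rightarrow> 'g top_groupoid"
  where "subgroupoid_of G H = G\<lparr>gtop := subtopology (gtop G) H\<rparr>"

definition topologically_principal :: "'g top_groupoid \<Rightarrow> bool"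
  where "topologically_principal G \<longleftrightarrow>
    unit_top G closure_of {x \<in> unit_space G. {\<alpha> \<in> arrows G. gdom G \<alpha> = x \<and> grng G \<alpha> = x} = {x}}
      = unit_space G"

definition topologically_transitive :: "'g top_groupoid \<Rightarrow> bool"
  where "topologically_transitive G \<longleftrightarrow>
    (\<forall>U. openin (unit_top G) U \<and> U \<noteq> {} \<longrightarrow>
      unit_top G closure_of (grng G ` {\<alpha> \<in> arrows G. gdom G \<alpha> \<in> U}) = unit_space G)"

definition groupoid_automorphisms :: "'g top_groupoid \<Rightarrow> ('g \<Rightarrow> 'g) set"
  where "groupoid_automorphisms G = {\<Phi> \<in> Bij (arrows G).
    homeomorphic_map (gtop G) (gtop G) \<Phi> \<and>
    (\<forall>\<alpha>\<in>arrows G. gdom G (\<Phi> \<alpha>) = \<Phi> (gdom G \<alpha>) \<and> grng G (\<Phi> \<alpha>) = \<Phi> (grng G \<alpha>)) \<and>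
    (\<forall>\<alpha>\<in>arrows G. \<forall>\<beta>\<in>arrows G. gdom G \<alpha> = grng G \<beta> \<longrightarrow> \<Phi> (gmul G \<alpha> \<beta>) = gmul G (\<Phi> \<alpha>) (\<Phi> \<beta>))}"

definition Aut_groupoid :: "'g top_groupoid \<Rightarrow> ('g \<Rightarrow> 'g) monoid"
  where "Aut_groupoid G = BijGroup (arrows G) \<lparr>carrier := groupoid_automorphisms G\<rparr>"

definition Aut_groupoid_rel :: "'g top_groupoid \<Rightarrow> 'g set \<Rightarrow> ('g \<Rightarrow> 'g) monoid"
  where "Aut_groupoid_rel G H =
    BijGroup (arrows G) \<lparr>carrier := {\<Phi> \<in> groupoid_automorphisms G. \<Phi> ` H = H}\<rparr>"

section \<open>Reduced groupoid C*-algebras\<close>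

text \<open>
  Functions on a space are extended by \<open>0\<close> to the whole type.
\<close>

definition Cc :: "'g topology \<Rightarrow> ('g \<Rightarrow> complex) set"
  where "Cc Y = {f. continuous_map Y euclidean f \<and> (\<forall>x. x \<notin> topspace Y \<longrightarrow> f x = 0) \<and>
    compactin Y (Y closure_of {x \<in> topspace Y. f x \<noteq> 0})}"

definition C0 :: "'g topology \<Rightarrow> ('g \<Rightarrow> complex) set"
  where "C0 Y = {f. continuous_map Y euclidean f \<and> (\<forall>x. x \<notin> topspace Y \<longrightarrow> f x = 0) \<and>
    (\<forall>\<epsilon>>0. compactin Y {x \<in> topspace Y. \<epsilon> \<le> cmod (f x)})}"

text \<open>
  The regular representations \<open>\<lambda>\<^sub>x\<close> on \<open>\<ell>\<^sup>2(d\<^sup>-\<^sup>1(x))\<close>, for \<open>x\<close> in the unit space, add up to the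
  convolution action of \<open>C\<^sub>c(G)\<close> on \<open>\<ell>\<^sup>2(G)\<close>, and the reduced norm of \<open>f\<close> is the operator norm of
  that action. Here \<open>\<ell>\<^sup>2(G)\<close> is the subspace of all \<open>\<xi> :: 'g ell2\<close> that vanish outside
  \<^term>\<open>arrows G\<close>, and the operators are extended by \<open>0\<close> to its orthogonal complement.
  The fibres of \<open>r\<close> are discrete, so the sum is finite for \<open>f\<close> in \<open>C\<^sub>c(G)\<close>.
\<close>

definition convolution :: "'g top_groupoid \<Rightarrow> ('g \<Rightarrow> complex) \<Rightarrow> ('g \<Rightarrow> complex) \<Rightarrow> 'g \<Rightarrow> complex"
  where "convolution G f \<xi> \<alpha> = (if \<alpha> \<in> arrows G
    then \<Sum>\<^sub>\<infinity>\<beta>\<in>{\<beta> \<in> arrows G. grng G \<beta> = grng G \<alpha>}. f \<beta> * \<xi> (gmul G (ginv G \<beta>) \<alpha>) else 0)"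

definition regular_operators :: "'g top_groupoid \<Rightarrow> ('g \<Rightarrow> complex) set \<Rightarrow> 'g ell2_op set"
  where "regular_operators G F =
    {a. \<exists>f\<in>F. \<forall>\<xi>. ell2_coord (blinfun_apply a \<xi>) = convolution G f (ell2_coord \<xi>)}"

text \<open>\<open>C\<^sup>*\<^sub>r(G)\<close>, the open subgroupoid algebra \<open>C\<^sup>*\<^sub>r(H)\<close> inside it, and the diagonal \<open>C\<^sub>0(G\<^sup>(\<^sup>0\<^sup>))\<close>.\<close>

definition reduced_algebra :: "'g top_groupoid \<Rightarrow> 'g ell2_op set"
  where "reduced_algebra G = closure (regular_operators G (Cc (gtop G)))"

definition reduced_subalgebra :: "'g top_groupoid \<Rightarrow> 'g set \<Rightarrow> 'g ell2_op set"
  where "reduced_subalgebra G H = closure (regular_operators G (Cc (subtopology (gtop G) H)))"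

definition diagonal_algebra :: "'g top_groupoid \<Rightarrow> 'g ell2_op set"
  where "diagonal_algebra G = regular_operators G (C0 (unit_top G))"

definition RW_ambient :: "'g top_groupoid \<Rightarrow> 'g set \<Rightarrow> ('g ell2_op \<Rightarrow> 'g ell2_op) monoid"
  where "RW_ambient G H =
    Aut_preserving (reduced_algebra G) (reduced_subalgebra G H) (diagonal_algebra G)"

definition RW_kernel :: "'g top_groupoid \<Rightarrow> ('g ell2_op \<Rightarrow> 'g ell2_op) set"
  where "RW_kernel G = Aut_fixing (reduced_algebra G) (diagonal_algebra G)"

definition RW :: "'g top_groupoid \<Rightarrow> 'g set \<Rightarrow> ('g ell2_op \<Rightarrow> 'g ell2_op) set monoid"
  where "RW G H = RW_ambient G H Mod RW_kernel G"

section \<open>Deaconu-Renault systems\<close>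

definition local_homeomorphism :: "'a topology \<Rightarrow> 'b topology \<Rightarrow> ('a \<Rightarrow> 'b) \<Rightarrow> bool"
  where "local_homeomorphism X Y T \<longleftrightarrow> T \<in> topspace X \<rightarrow> topspace Y \<and>
    (\<forall>x\<in>topspace X. \<exists>U. openin X U \<and> x \<in> U \<and> openin Y (T ` U) \<and>
      homeomorphic_map (subtopology X U) (subtopology Y (T ` U)) T)"

definition Deaconu_Renault_system :: "'a topology \<Rightarrow> ('a \<Rightarrow> 'a) \<Rightarrow> bool"
  where "Deaconu_Renault_system X T \<longleftrightarrow>
    locally_compact_space X \<and> Hausdorff_space X \<and> local_homeomorphism X X T"

definition DR_basic :: "('a \<Rightarrow> 'a) \<Rightarrow> 'a set \<Rightarrow> nat \<Rightarrow> nat \<Rightarrow> 'a set \<Rightarrow> ('a \<times> int \<times> 'a) set"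
  where "DR_basic T U n m V = {(y, int n - int m, x) | y x. y \<in> U \<and> x \<in> V \<and> (T ^^ n) y = (T ^^ m) x}"

definition DR_groupoid :: "'a topology \<Rightarrow> ('a \<Rightarrow> 'a) \<Rightarrow> ('a \<times> int \<times> 'a) top_groupoid"
  where "DR_groupoid X T = \<lparr>
    gtop = topology_generated_by {DR_basic T U n m V | U n m V. openin X U \<and> openin X V},
    gdom = (\<lambda>(y, n, x). (x, 0, x)),
    grng = (\<lambda>(y, n, x). (y, 0, y)),
    gmul = (\<lambda>(z, n, y) (y', m, x). (z, n + m, x)),
    ginv = (\<lambda>(y, n, x). (x, - n, y))\<rparr>"

lemma arrows_DR_groupoid:
  "arrows (DR_groupoid X T) =
    {(y, int n - int m, x) | y n m x. y \<in> topspace X \<and> x \<in> topspace X \<and> (T ^^ n) y = (T ^^ m) x}"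
proof (rule Set.set_eqI)
  fix \<alpha>
  have "\<alpha> \<in> arrows (DR_groupoid X T) \<longleftrightarrow>
      (\<exists>U n m V. openin X U \<and> openin X V \<and> \<alpha> \<in> DR_basic T U n m V)"
    by (simp add: arrows_def DR_groupoid_def Bex_def) metis
  also have "\<dots> \<longleftrightarrow> (\<exists>n m. \<alpha> \<in> DR_basic T (topspace X) n m (topspace X))"
  proof
    assume "\<exists>U n m V. openin X U \<and> openin X V \<and> \<alpha> \<in> DR_basic T U n m V"
    then obtain U n m V where *: "openin X U" "openin X V" "\<alpha> \<in> DR_basic T U n m V"
      by (elim exE conjE)
    have "U \<subseteq> topspace X" "V \<subseteq> topspace X" using *(1,2) by (simp_all add: openin_subset)
    then have "\<alpha> \<in> DR_basic T (topspace X) n m (topspace X)"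
      using *(3) unfolding DR_basic_def by fast
    then show "\<exists>n m. \<alpha> \<in> DR_basic T (topspace X) n m (topspace X)" by (intro exI)
  next
    assume "\<exists>n m. \<alpha> \<in> DR_basic T (topspace X) n m (topspace X)"
    then show "\<exists>U n m V. openin X U \<and> openin X V \<and> \<alpha> \<in> DR_basic T U n m V"
      using openin_topspace[of X] by (elim exE) (intro exI conjI)
  qed
  also have "\<dots> \<longleftrightarrow> \<alpha> \<in> {(y, int n - int m, x) | y n m x.
      y \<in> topspace X \<and> x \<in> topspace X \<and> (T ^^ n) y = (T ^^ m) x}"
    unfolding DR_basic_def mem_Collect_eq by iprover
  finally show "\<alpha> \<in> arrows (DR_groupoid X T) \<longleftrightarrow> \<dots>" .
qed

definition DR_cocycle :: "'a \<times> int \<times> 'a \<Rightarrow> int"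
  where "DR_cocycle = (\<lambda>(y, n, x). n)"

definition DR_kernel :: "'a topology \<Rightarrow> ('a \<Rightarrow> 'a) \<Rightarrow> ('a \<times> int \<times> 'a) set"
  where "DR_kernel X T = {\<alpha> \<in> arrows (DR_groupoid X T). DR_cocycle \<alpha> = 0}"

definition topologically_free :: "'a topology \<Rightarrow> ('a \<Rightarrow> 'a) \<Rightarrow> bool"
  where "topologically_free X T \<longleftrightarrow> topologically_principal (DR_groupoid X T)"

definition property_P :: "'a topology \<Rightarrow> ('a \<Rightarrow> 'a) \<Rightarrow> ('a \<Rightarrow> 'a) \<Rightarrow> bool"
  where "property_P X T h \<longleftrightarrow> (\<exists>m. \<forall>x\<in>topspace X. (T ^^ (m + 1)) (h x) = (T ^^ m) (h (T x)))"

definition eventual_automorphism_group :: "'a topology \<Rightarrow> ('a \<Rightarrow> 'a) \<Rightarrow> ('a \<Rightarrow> 'a) monoid"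
  where "eventual_automorphism_group X T = BijGroup (topspace X) \<lparr>carrier :=
    {h \<in> Bij (topspace X). homeomorphic_map X X h \<and>
      property_P X T h \<and> property_P X T (inv_into (topspace X) h)}\<rparr>"

lemma inv_BijGroup_apply:
  assumes "f \<in> Bij S" "x \<in> S"
  shows "f (restrict (inv_into S f) S x) = x"
  using assms by (simp add: Bij_def bij_betw_def f_inv_into_f)

lemma group_BijGroup_subset:
  assumes "C \<subseteq> Bij S" and "(\<lambda>x\<in>S. x) \<in> C"
    and "\<And>f g. f \<in> C \<Longrightarrow> g \<in> C \<Longrightarrow> compose S f g \<in> C"
    and "\<And>f. f \<in> C \<Longrightarrow> restrict (inv_into S f) S \<in> C"
  shows "group (BijGroup S \<lparr>carrier := C\<rparr>)"
proof (rule subgroup.subgroup_is_group[OF _ group_BijGroup])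
  show "subgroup C (BijGroup S)"
  proof
    show "C \<subseteq> carrier (BijGroup S)" using assms(1) by (simp add: BijGroup_def)
    show "f \<otimes>\<^bsub>BijGroup S\<^esub> g \<in> C" if "f \<in> C" "g \<in> C" for f g
    proof -
      have "f \<in> Bij S" "g \<in> Bij S" using that assms(1) by auto
      then show ?thesis using that assms(3) by (simp add: BijGroup_def)
    qed
    show "\<one>\<^bsub>BijGroup S\<^esub> \<in> C" using assms(2) by (simp add: BijGroup_def)
    show "inv\<^bsub>BijGroup S\<^esub> f \<in> C" if "f \<in> C" for f
      using that assms(1,4) inv_BijGroup[of f S] by auto
  qed
qed

lemma homeomorphic_map_restrict_inv:
  assumes "homeomorphic_map X X h"
  shows "homeomorphic_map X X (restrict (inv_into (topspace X) h) (topspace X))"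
proof -
  obtain g where g: "homeomorphic_maps X X h g" using assms homeomorphic_map_maps by blast
  then have g': "homeomorphic_map X X g" using homeomorphic_maps_map by blast
  have inj: "inj_on h (topspace X)"
    using assms by (simp add: homeomorphic_imp_injective_map)
  show ?thesis
  proof (rule homeomorphic_map_eq[OF g'])
    fix x assume x: "x \<in> topspace X"
    then have "h (g x) = x" "g x \<in> topspace X"
      using g g' by (auto simp: homeomorphic_maps_def continuous_map_def)
    then show "g x = restrict (inv_into (topspace X) h) (topspace X) x"
      using inj x by (metis inv_into_f_f restrict_apply')
  qed
qed

lemma homeomorphic_map_compose_restrict:
  assumes "homeomorphic_map X X f" "homeomorphic_map X X g"
  shows "homeomorphic_map X X (compose (topspace X) f g)"
  by (rule homeomorphic_map_eq[OF homeomorphic_map_compose[OF assms(2,1)]]) (simp add: compose_def)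

lemma homeomorphic_map_id_restrict: "homeomorphic_map X X (\<lambda>x\<in>topspace X. x)"
  by (rule homeomorphic_map_eq[of X X id]) auto

lemma group_Aut_groupoid_rel_DR:
  assumes "H \<subseteq> arrows (DR_groupoid X T)"
  shows "group (Aut_groupoid_rel (DR_groupoid X T) H)"
proof -
  let ?G = "DR_groupoid X T"
  let ?A = "arrows ?G"
  have dom: "gdom ?G \<alpha> \<in> ?A" and rng: "grng ?G \<alpha> \<in> ?A" if "\<alpha> \<in> ?A" for \<alpha>
    using that unfolding arrows_DR_groupoid by (auto simp: DR_groupoid_def)
  have mul: "gmul ?G \<alpha> \<beta> \<in> ?A" if ab: "\<alpha> \<in> ?A" "\<beta> \<in> ?A" "gdom ?G \<alpha> = grng ?G \<beta>" for \<alpha> \<beta>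
  proof -
    obtain z n m y where a: "\<alpha> = (z, int n - int m, y)" "z \<in> topspace X" "(T ^^ n) z = (T ^^ m) y"
      using ab(1) unfolding arrows_DR_groupoid by auto
    obtain k l x where b: "\<beta> = (y, int k - int l, x)" "x \<in> topspace X" "(T ^^ k) y = (T ^^ l) x"
      using ab(2,3) a(1) unfolding arrows_DR_groupoid by (auto simp: DR_groupoid_def)
    have "(T ^^ (k + n)) z = (T ^^ k) ((T ^^ m) y)" using a(3) by (simp add: funpow_add)
    also have "\<dots> = (T ^^ m) ((T ^^ k) y)" by (metis add.commute comp_apply funpow_add)
    also have "\<dots> = (T ^^ (m + l)) x" using b(3) by (simp add: funpow_add)
    finally have "(z, int (k + n) - int (m + l), x) \<in> ?A"
      using a b unfolding arrows_DR_groupoid by blast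
    then show ?thesis using a b by (simp add: DR_groupoid_def algebra_simps)
  qed
  show ?thesis
    unfolding Aut_groupoid_rel_def
  proof (rule group_BijGroup_subset)
    show "{\<Phi> \<in> groupoid_automorphisms ?G. \<Phi> ` H = H} \<subseteq> Bij ?A"
      by (auto simp: groupoid_automorphisms_def)
    have id: "homeomorphic_map (gtop ?G) (gtop ?G) (\<lambda>x\<in>?A. x)"
      unfolding arrows_def by (rule homeomorphic_map_id_restrict)
    have "(\<lambda>x\<in>?A. x) \<in> groupoid_automorphisms ?G"
      unfolding groupoid_automorphisms_def
      by (intro CollectI conjI ballI impI id_Bij id) (simp_all only: restrict_apply' dom rng mul)
    moreover have "(\<lambda>x\<in>?A. x) ` H = (\<lambda>x. x) ` H"
      using assms by (intro image_cong) auto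
    ultimately show "(\<lambda>x\<in>?A. x) \<in> {\<Phi> \<in> groupoid_automorphisms ?G. \<Phi> ` H = H}" by simp
  next
    fix f g
    assume f: "f \<in> {\<Phi> \<in> groupoid_automorphisms ?G. \<Phi> ` H = H}"
      and g: "g \<in> {\<Phi> \<in> groupoid_automorphisms ?G. \<Phi> ` H = H}"
    have B: "f \<in> Bij ?A" "g \<in> Bij ?A"
      and hom: "homeomorphic_map (gtop ?G) (gtop ?G) f" "homeomorphic_map (gtop ?G) (gtop ?G) g"
      using f g unfolding groupoid_automorphisms_def by blast+
    have gA: "g \<alpha> \<in> ?A" if "\<alpha> \<in> ?A" for \<alpha>
      using B(2) that by (auto simp: Bij_def bij_betw_def)
    have f': "gdom ?G (f \<alpha>) = f (gdom ?G \<alpha>)" "grng ?G (f \<alpha>) = f (grng ?G \<alpha>)"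
      and g': "gdom ?G (g \<alpha>) = g (gdom ?G \<alpha>)" "grng ?G (g \<alpha>) = g (grng ?G \<alpha>)"
      if "\<alpha> \<in> ?A" for \<alpha>
      using f g that unfolding groupoid_automorphisms_def by blast+
    have fm: "f (gmul ?G \<alpha> \<beta>) = gmul ?G (f \<alpha>) (f \<beta>)"
      and gm: "g (gmul ?G \<alpha> \<beta>) = gmul ?G (g \<alpha>) (g \<beta>)"
      if "\<alpha> \<in> ?A" "\<beta> \<in> ?A" "gdom ?G \<alpha> = grng ?G \<beta>" for \<alpha> \<beta>
      using f g that unfolding groupoid_automorphisms_def by blast+
    have fg: "homeomorphic_map (gtop ?G) (gtop ?G) (compose ?A f g)"
      unfolding arrows_def by (rule homeomorphic_map_compose_restrict[OF hom])
    have "compose ?A f g \<in> groupoid_automorphisms ?G"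
      unfolding groupoid_automorphisms_def
      by (intro CollectI conjI ballI impI compose_Bij B fg)
        (simp_all only: compose_eq dom rng mul f' g' fm gm gA)
    moreover have "compose ?A f g ` H = f ` (g ` H)"
      unfolding image_image using assms by (intro image_cong) (auto simp: compose_def)
    ultimately show "compose ?A f g \<in> {\<Phi> \<in> groupoid_automorphisms ?G. \<Phi> ` H = H}"
      using f g by simp
  next
    fix f assume f: "f \<in> {\<Phi> \<in> groupoid_automorphisms ?G. \<Phi> ` H = H}"
    let ?g = "restrict (inv_into ?A f) ?A"
    have B: "f \<in> Bij ?A" using f by (simp add: groupoid_automorphisms_def)
    have gB: "?g \<in> Bij ?A" using B by (rule restrict_inv_into_Bij)
    have gA: "?g \<alpha> \<in> ?A" if "\<alpha> \<in> ?A" for \<alpha>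
      using gB that by (auto simp: Bij_def bij_betw_def)
    have gf: "?g (f \<alpha>) = \<alpha>" if "\<alpha> \<in> ?A" for \<alpha>
      using B that by (auto simp: Bij_def bij_betw_def inv_into_f_f)
    have fg: "f (?g \<alpha>) = \<alpha>" if "\<alpha> \<in> ?A" for \<alpha>
      using inv_BijGroup_apply[OF B that] .
    have fd: "gdom ?G (f \<alpha>) = f (gdom ?G \<alpha>)" "grng ?G (f \<alpha>) = f (grng ?G \<alpha>)"
      if "\<alpha> \<in> ?A" for \<alpha>
      using f that by (auto simp: groupoid_automorphisms_def)
    have fm: "f (gmul ?G \<alpha> \<beta>) = gmul ?G (f \<alpha>) (f \<beta>)"
      if "\<alpha> \<in> ?A" "\<beta> \<in> ?A" "gdom ?G \<alpha> = grng ?G \<beta>" for \<alpha> \<beta>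
      using f that by (auto simp: groupoid_automorphisms_def)
    have gd1: "gdom ?G (?g \<alpha>) = ?g (gdom ?G \<alpha>)" if "\<alpha> \<in> ?A" for \<alpha>
      using fd(1)[OF gA[OF that]] gf[OF dom[OF gA[OF that]]] fg[OF that] by metis
    have gd2: "grng ?G (?g \<alpha>) = ?g (grng ?G \<alpha>)" if "\<alpha> \<in> ?A" for \<alpha>
      using fd(2)[OF gA[OF that]] gf[OF rng[OF gA[OF that]]] fg[OF that] by metis
    note gd = gd1 gd2
    have gm: "?g (gmul ?G \<alpha> \<beta>) = gmul ?G (?g \<alpha>) (?g \<beta>)"
      if ab: "\<alpha> \<in> ?A" "\<beta> \<in> ?A" "gdom ?G \<alpha> = grng ?G \<beta>" for \<alpha> \<beta>
    proof -
      have c: "gdom ?G (?g \<alpha>) = grng ?G (?g \<beta>)" by (simp only: gd[OF ab(1)] gd[OF ab(2)] ab(3))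
      have "f (gmul ?G (?g \<alpha>) (?g \<beta>)) = gmul ?G \<alpha> \<beta>"
        by (simp only: fm[OF gA[OF ab(1)] gA[OF ab(2)] c] fg[OF ab(1)] fg[OF ab(2)])
      then show ?thesis using gf[OF mul[OF gA[OF ab(1)] gA[OF ab(2)] c]] by (simp only:)
    qed
    have "homeomorphic_map (gtop ?G) (gtop ?G) f"
      using f unfolding groupoid_automorphisms_def by blast
    then have hom: "homeomorphic_map (gtop ?G) (gtop ?G) ?g"
      unfolding arrows_def by (rule homeomorphic_map_restrict_inv)
    have "?g \<in> groupoid_automorphisms ?G"
      unfolding groupoid_automorphisms_def
      by (intro CollectI conjI ballI impI gB hom gd gm)
    moreover have "?g ` H = H"
    proof -
      have "?g ` (f ` H) = (\<lambda>x. x) ` H"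
        unfolding image_image using gf assms by (intro image_cong) blast+
      then show ?thesis using f by simp
    qed
    ultimately show "?g \<in> {\<Phi> \<in> groupoid_automorphisms ?G. \<Phi> ` H = H}" by blast
  qed
qed

lemma property_P_funpow:
  assumes "T \<in> topspace X \<rightarrow> topspace X"
    and "\<And>x. x \<in> topspace X \<Longrightarrow> (T ^^ (m + 1)) (h x) = (T ^^ m) (h (T x))"
    and "x \<in> topspace X"
  shows "(T ^^ (m + k)) (h x) = (T ^^ m) (h ((T ^^ k) x))"
  using assms(3)
proof (induction k arbitrary: x)
  case (Suc k)
  have "(T ^^ (m + Suc k)) (h x) = (T ^^ k) ((T ^^ (m + 1)) (h x))"
    by (metis add.commute add.left_commute comp_apply funpow_add plus_1_eq_Suc)
  also have "\<dots> = (T ^^ (m + k)) (h (T x))"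
    using assms(2)[OF Suc.prems] by (metis add.commute comp_apply funpow_add)
  also have "\<dots> = (T ^^ m) (h ((T ^^ k) (T x)))"
    using Suc.prems assms(1) by (intro Suc.IH) auto
  finally show ?case by (simp add: funpow_swap1)
qed simp

lemma property_P_cong:
  assumes "T \<in> topspace X \<rightarrow> topspace X" "\<And>x. x \<in> topspace X \<Longrightarrow> f x = g x"
  shows "property_P X T f \<longleftrightarrow> property_P X T g"
proof -
  have "f x = g x" "f (T x) = g (T x)" if "x \<in> topspace X" for x
    using assms that by auto
  then show ?thesis unfolding property_P_def by simp
qed

lemma property_P_compose:
  assumes T: "T \<in> topspace X \<rightarrow> topspace X" and g: "g \<in> topspace X \<rightarrow> topspace X"
    and "property_P X T f" "property_P X T g"
  shows "property_P X T (\<lambda>x. f (g x))"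
proof -
  obtain m where m: "\<And>x. x \<in> topspace X \<Longrightarrow> (T ^^ (m + 1)) (f x) = (T ^^ m) (f (T x))"
    using assms(3) unfolding property_P_def by blast
  obtain n where n: "\<And>x. x \<in> topspace X \<Longrightarrow> (T ^^ (n + 1)) (g x) = (T ^^ n) (g (T x))"
    using assms(4) unfolding property_P_def by blast
  have "(T ^^ (m + n + 1)) (f (g x)) = (T ^^ (m + n)) (f (g (T x)))" if x: "x \<in> topspace X" for x
  proof -
    have gx: "g x \<in> topspace X" "g (T x) \<in> topspace X" using x T g by auto
    have "(T ^^ (m + (n + 1))) (f (g x)) = (T ^^ m) (f ((T ^^ (n + 1)) (g x)))"
      by (rule property_P_funpow[where h = f and m = m, OF T m gx(1)])
    also have "\<dots> = (T ^^ m) (f ((T ^^ n) (g (T x))))" using n[OF x] by simp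
    also have "\<dots> = (T ^^ (m + n)) (f (g (T x)))"
      by (rule property_P_funpow[where h = f and m = m, OF T m gx(2), symmetric])
    finally show ?thesis by (simp add: add.assoc)
  qed
  then show ?thesis unfolding property_P_def by blast
qed

lemma group_eventual_automorphism_group:
  assumes T: "T \<in> topspace X \<rightarrow> topspace X"
  shows "group (eventual_automorphism_group X T)"
proof -
  let ?S = "topspace X"
  note cong = property_P_cong[OF T]
  have maps: "f \<in> ?S \<rightarrow> ?S" "inv_into ?S f \<in> ?S \<rightarrow> ?S" if "f \<in> Bij ?S" for f
    using that bij_betw_inv_into[of f ?S ?S] by (auto simp: Bij_def bij_betw_def)
  have inv: "f (inv_into ?S f x) = x" "inv_into ?S f (f x) = x" if "f \<in> Bij ?S" "x \<in> ?S" for f x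
    using that by (auto simp: Bij_def bij_betw_def f_inv_into_f inv_into_f_f)
  have inv_eq: "inv_into ?S f x = y" if "f \<in> Bij ?S" "y \<in> ?S" "f y = x" for f x y
    using inv(2)[of f y] that by simp
  show ?thesis
    unfolding eventual_automorphism_group_def
  proof (rule group_BijGroup_subset, goal_cases)
    case 1 then show ?case by blast
  next
    case 2
    have "property_P X T (\<lambda>x. x)" by (auto simp: property_P_def funpow_swap1)
    moreover have "inv_into ?S (\<lambda>x\<in>?S. x) x = x" if "x \<in> ?S" for x
      using that by (intro inv_eq) (auto simp: id_Bij)
    ultimately show ?case
      using homeomorphic_map_id_restrict[of X]
        cong[of "\<lambda>x\<in>?S. x" "\<lambda>x. x"] cong[of "inv_into ?S (\<lambda>x\<in>?S. x)" "\<lambda>x. x"]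
      by (simp add: id_Bij)
  next
    case (3 f g)
    then have B: "f \<in> Bij ?S" "g \<in> Bij ?S" by auto
    have P: "property_P X T f" "property_P X T g"
      "property_P X T (inv_into ?S f)" "property_P X T (inv_into ?S g)"
      "homeomorphic_map X X f" "homeomorphic_map X X g"
      using 3 by blast+
    have "property_P X T (\<lambda>x. f (g x))"
      by (rule property_P_compose[OF T maps(1)[OF B(2)] P(1,2)])
    then have 1: "property_P X T (compose ?S f g)"
      by (rule cong[THEN iffD2, rotated]) (simp add: compose_eq)
    have 2: "inv_into ?S (compose ?S f g) x = inv_into ?S g (inv_into ?S f x)" if "x \<in> ?S" for x
    proof (rule inv_eq[OF compose_Bij[OF B]])
      have a: "inv_into ?S f x \<in> ?S" by (rule PiE[OF maps(2)[OF B(1)]]) (use that in auto)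
      show b: "inv_into ?S g (inv_into ?S f x) \<in> ?S"
        by (rule PiE[OF maps(2)[OF B(2)]]) (use a in auto)
      show "compose ?S f g (inv_into ?S g (inv_into ?S f x)) = x"
        by (simp only: compose_eq[OF b] inv(1)[OF B(2) a] inv(1)[OF B(1) that])
    qed
    have "property_P X T (\<lambda>x. inv_into ?S g (inv_into ?S f x))"
      by (rule property_P_compose[OF T maps(2)[OF B(1)] P(4,3)])
    then have "property_P X T (inv_into ?S (compose ?S f g))"
      by (rule cong[THEN iffD2, rotated]) (rule 2)
    with 1 show ?case
      using compose_Bij[OF B] homeomorphic_map_compose_restrict[OF P(5,6)] by blast
  next
    case (4 f)
    then have B: "f \<in> Bij ?S" by auto
    let ?g = "restrict (inv_into ?S f) ?S"
    have gB: "?g \<in> Bij ?S" using B by (rule restrict_inv_into_Bij)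
    have "inv_into ?S ?g x = f x" if "x \<in> ?S" for x
      using that inv(2)[OF B] maps(1)[OF B] by (intro inv_eq[OF gB]) auto
    then have "property_P X T (inv_into ?S ?g)"
      using 4 cong[of "inv_into ?S ?g" f] by simp
    moreover have "property_P X T ?g" using 4 cong[of ?g "inv_into ?S f"] by simp
    ultimately show ?case using 4 gB homeomorphic_map_restrict_inv[of X f] by simp
  qed
qed

end

theory Submission
  imports Defs
begin

text \<open>
  Both a groupoid automorphism preserving \<open>ker \<sigma>\<close> and an automorphism of
  \<open>C\<^sup>*\<^sub>r(G)\<close> preserving \<open>C\<^sup>*\<^sub>r(ker \<sigma>)\<close> and the diagonal induce a homeomorphism
  \<open>h\<close> of \<open>X\<close> such that conjugation by \<open>h\<close> maps germs of arrows to germs of arrows and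
  preserves those in \<open>ker \<sigma>\<close>; for C*-automorphisms this is read off from the symbols of
  the images of the indicator functions of the compact open sets \<open>Z(X,i,j,X)\<close>. By topological freeness,
  the cocycle value of the image of the germ of \<open>(x,1,Tx)\<close> is a well-defined locally constant function
  of \<open>x\<close>. It is invariant under \<open>ker \<sigma>\<close>, hence a constant \<open>p\<close> by topological
  transitivity. The constants of \<open>h\<close> and of its inverse multiply to \<open>1\<close>, and \<open>p = -1\<close> is
  excluded by counting the points in the fibres of the powers of \<open>T\<close>. Therefore \<open>p = 1\<close>, which by
  compactness is property (P). Conversely, \<open>(y,n,x) \<mapsto> (h y,n,h x)\<close> is an automorphism of
  \<open>G\<close> if \<open>h\<close> and its inverse have property (P), and it acts on \<open>C\<^sup>*\<^sub>r(G)\<close>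
  by a spatial automorphism.
\<close>

subsection \<open>Square summable families\<close>

text \<open>Topological freeness provides trivial isotropy only on a dense set, so two cocycle
  values with the same endpoints can be compared only after moving to a nearby point. Hence
  \<open>admissible\<close> speaks of neighbourhoods, and every comparison of cocycle values takes
  place on an open set. On the C*-algebraic side, the image of an indicator operator need not be
  supported on a bisection. What survives is the relation (d o T^i) a = a (d o T^j) for d in C(X):
  it is algebraic, an automorphism transports it along h, and it locates the support. The value -1
  is the reversal of time, as for h with h T = T^{-1} h when T is a homeomorphism; the properness of
  the subset U rules it out, because it makes T surjective but not injective while fibres stay
  finite. Finally, *-automorphisms are algebraic by definition, so their continuity is derived from
  square roots in the algebra. It serves to show that an automorphism fixing the diagonal preserves
  the subalgebra of the kernel, without which the denominator of the quotient would not lie inside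
  the numerator.\<close>

lemma ell2_eqI: "(\<And>i. ell2_coord x i = ell2_coord y i) \<Longrightarrow> x = y"
  by (simp add: ell2_coord_inject[symmetric] fun_eq_iff)

lemma ell2_coord_minus: "ell2_coord (x - y) i = ell2_coord x i - ell2_coord y i"
  unfolding minus_ell2_def plus_ell2.rep_eq uminus_ell2.rep_eq by simp

lemma ell2_coord_scaleR: "ell2_coord (r *\<^sub>R x) i = of_real r * ell2_coord x i"
  by (simp add: scaleR_ell2_def ell2_scaleC.rep_eq)

lemmas ell2_coord_simps = plus_ell2.rep_eq zero_ell2.rep_eq uminus_ell2.rep_eq
  ell2_scaleC.rep_eq ell2_coord_minus ell2_coord_scaleR

lemma ell2_coord_sum: "ell2_coord (sum f F) i = (\<Sum>j\<in>F. ell2_coord (f j) i)"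
  by (induction F rule: infinite_finite_induct) (auto simp: ell2_coord_simps)

lemma ell2_scaleC_add: "ell2_scaleC c (x + y) = ell2_scaleC c x + ell2_scaleC c y"
  by (rule ell2_eqI) (simp add: ell2_coord_simps distrib_left)

lemma ell2_scaleC_diff: "ell2_scaleC c (x - y) = ell2_scaleC c x - ell2_scaleC c y"
  by (rule ell2_eqI) (simp add: ell2_coord_simps right_diff_distrib)

lemma ell2_scaleC_scaleC: "ell2_scaleC c (ell2_scaleC d x) = ell2_scaleC (c * d) x"
  by (rule ell2_eqI) (simp add: ell2_coord_simps)

lemma ell2_scaleC_of_real: "ell2_scaleC (of_real r) x = r *\<^sub>R x"
  by (simp add: scaleR_ell2_def)

lemma ell2_norm_sq: "(norm x)\<^sup>2 = (\<Sum>\<^sub>\<infinity>i. (cmod (ell2_coord x i))\<^sup>2)"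
  by (simp add: norm_ell2_def infsum_nonneg)

lemma ell2_sum_le_norm:
  assumes "finite F" shows "(\<Sum>i\<in>F. (cmod (ell2_coord x i))\<^sup>2) \<le> (norm x)\<^sup>2"
  unfolding ell2_norm_sq by (rule finite_sum_le_infsum) (auto simp: ell2_summable assms)

lemma ell2_coord_le_norm: "cmod (ell2_coord x i) \<le> norm x"
proof (rule power2_le_imp_le)
  show "(cmod (ell2_coord x i))\<^sup>2 \<le> (norm x)\<^sup>2" using ell2_sum_le_norm[of "{i}" x] by simp
qed simp

text \<open>Source of vectors with prescribed coordinates: completeness, adjoints, convolution
  operators and translations of arrows all reduce to a bound on finite sums of squares, which also
  gives the norm estimate.\<close>

lemma ell2_of_bounded_sums:
  assumes "\<And>F. finite F \<Longrightarrow> (\<Sum>i\<in>F. (cmod (f i))\<^sup>2) \<le> C\<^sup>2" and "0 \<le> C"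
  obtains x where "ell2_coord x = f" "norm x \<le> C"
proof -
  have s: "(\<lambda>i. (cmod (f i))\<^sup>2) summable_on UNIV"
    by (rule nonneg_bdd_above_summable_on) (auto intro!: bdd_aboveI[of _ "C\<^sup>2"] assms)
  have "ell2_coord (Abs_ell2 f) = f" using s by (simp add: Abs_ell2_inverse)
  moreover have "(norm (Abs_ell2 f))\<^sup>2 \<le> C\<^sup>2"
    unfolding ell2_norm_sq calculation using s assms(1) by (intro infsum_le_finite_sums) auto
  ultimately show thesis using that assms(2) power2_le_imp_le by blast
qed

lift_definition ell2_delta :: "'i \<Rightarrow> 'i ell2" is "\<lambda>i j. if j = i then 1 else 0"
proof -
  fix i :: 'i
  have "(\<lambda>j. (cmod (if j = i then 1 else 0))\<^sup>2) summable_on {i}" by simp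
  then show "(\<lambda>j. (cmod (if j = i then 1 else 0))\<^sup>2) summable_on UNIV"
    by (rule summable_on_cong_neutral[THEN iffD1, rotated -1]) auto
qed

lemma ell2_cinner_scaleC_right: "ell2_cinner x (ell2_scaleC c y) = cnj c * ell2_cinner x y"
  by (metis ell2_cinner_cnj ell2_cinner_scaleC complex_cnj_mult)

lemma ell2_cinner_add_right: "ell2_cinner x (y + z) = ell2_cinner x y + ell2_cinner x z"
  by (metis ell2_cinner_cnj ell2_cinner_add complex_cnj_add)

lemma ell2_cinner_zero: "ell2_cinner 0 y = 0"
  by (simp add: ell2_cinner_def zero_ell2.rep_eq)

lemma ell2_cinner_sum: "ell2_cinner (sum f F) y = (\<Sum>j\<in>F. ell2_cinner (f j) y)"
  by (induction F rule: infinite_finite_induct)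
    (auto simp: ell2_cinner_add ell2_cinner_zero)

lemma ell2_cinner_norm: "ell2_cinner x x = complex_of_real ((norm x)\<^sup>2)"
  by (simp add: ell2_cinner_self ell2_norm_sq)

lemma ell2_cinner_diff: "ell2_cinner (x - y) z = ell2_cinner x z - ell2_cinner y z"
  by (metis add_diff_cancel diff_add_cancel ell2_cinner_add)

text \<open>Rotating \<open>x\<close> by the conjugate phase \<open>c\<close> makes the pairing real
  and nonnegative, so the real Cauchy-Schwarz inequality for \<open>inner\<close>, the real part of
  the pairing, applies.\<close>

lemma ell2_Cauchy_Schwarz: "cmod (ell2_cinner x y) \<le> norm x * norm y"
proof (cases "ell2_cinner x y = 0")
  case False
  define c where "c = cnj (ell2_cinner x y) / cmod (ell2_cinner x y)"
  have c: "cmod c = 1" using False by (simp add: c_def norm_divide)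
  have "c * ell2_cinner x y = complex_of_real (cmod (ell2_cinner x y))"
    using False by (simp add: c_def field_simps complex_norm_square[symmetric] power2_eq_square[symmetric])
  then have "cmod (ell2_cinner x y) = inner (ell2_scaleC c x) y"
    by (simp add: inner_ell2_def ell2_cinner_scaleC)
  also have "\<dots> \<le> norm (ell2_scaleC c x) * norm y" by (rule norm_cauchy_schwarz)
  finally show ?thesis by (simp add: ell2_norm_scaleC c)
qed simp

lemma ell2_cinner_delta: "ell2_cinner (ell2_delta i) x = cnj (ell2_coord x i)"
proof -
  have "ell2_cinner (ell2_delta i) x = (\<Sum>\<^sub>\<infinity>j\<in>{i}. cnj (ell2_coord x j))"
    unfolding ell2_cinner_def by (rule infsum_cong_neutral) (auto simp: ell2_delta.rep_eq)
  then show ?thesis by simp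
qed

lemma ell2_delta_approx:
  assumes "0 < e"
  obtains F where "finite F"
    "norm (x - (\<Sum>j\<in>F. ell2_scaleC (ell2_coord x j) (ell2_delta j))) < e"
proof -
  let ?g = "\<lambda>i. (cmod (ell2_coord x i))\<^sup>2"
  have "(?g has_sum (infsum ?g UNIV)) UNIV" by (simp add: ell2_summable)
  then have "\<forall>\<^sub>F F in finite_subsets_at_top UNIV. dist (sum ?g F) (infsum ?g UNIV) < e\<^sup>2"
    unfolding has_sum_def tendsto_iff using assms by simp
  then obtain F where F: "finite F" "dist (sum ?g F) (infsum ?g UNIV) < e\<^sup>2"
    by (auto simp: eventually_finite_subsets_at_top)
  let ?y = "x - (\<Sum>j\<in>F. ell2_scaleC (ell2_coord x j) (ell2_delta j))"
  have y: "ell2_coord ?y i = (if i \<in> F then 0 else ell2_coord x i)" for i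
    using F(1) by (simp add: ell2_coord_simps ell2_coord_sum ell2_delta.rep_eq if_distrib
        cong: if_cong)
  have "(norm ?y)\<^sup>2 = infsum ?g (UNIV - F)"
    unfolding ell2_norm_sq y by (rule infsum_cong_neutral) auto
  also have "\<dots> = infsum ?g UNIV - infsum ?g F"
    using F(1) by (intro infsum_Diff ell2_summable summable_on_finite) auto
  also have "\<dots> < e\<^sup>2" using F by (simp add: dist_real_def)
  finally show thesis using that F(1) assms power2_less_imp_less by (meson less_imp_le)
qed

text \<open>Makes the space of operators complete, as the fixed point argument for square roots
  requires. The limit is taken coordinatewise; it is square summable because the Cauchy bound on
  finite sums puts its difference from some \<open>X N\<close> into the space.\<close>

instance ell2 :: (type) banach
proof
  fix X :: "nat \<Rightarrow> 'a ell2" assume X: "Cauchy X"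
  have co: "cmod (ell2_coord (X n) i - ell2_coord (X m) i) \<le> norm (X n - X m)" for n m i
    by (metis ell2_coord_le_norm ell2_coord_minus)
  have "Cauchy (\<lambda>n. ell2_coord (X n) i)" for i
    using X unfolding Cauchy_def dist_norm by (meson co le_less_trans)
  then have "\<exists>c. (\<lambda>n. ell2_coord (X n) i) \<longlonglongrightarrow> c" for i
    by (simp add: Cauchy_convergent_iff convergent_def)
  then obtain c where c: "\<And>i. (\<lambda>n. ell2_coord (X n) i) \<longlonglongrightarrow> c i" by metis
  have ap: "\<exists>N. \<forall>n\<ge>N. \<exists>d. ell2_coord d = (\<lambda>i. ell2_coord (X n) i - c i) \<and> norm d \<le> e"
    if e: "0 < e" for e :: real
  proof -
    obtain N where N: "\<And>m n. m \<ge> N \<Longrightarrow> n \<ge> N \<Longrightarrow> norm (X m - X n) < e"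
      using X e unfolding Cauchy_def dist_norm by blast
    show ?thesis
    proof (intro exI[of _ N] allI impI)
      fix n assume n: "N \<le> n"
      have "(\<Sum>i\<in>F. (cmod (ell2_coord (X n) i - c i))\<^sup>2) \<le> e\<^sup>2" if F: "finite F" for F
      proof (rule tendsto_upperbound[OF _ eventually_sequentiallyI])
        show "(\<lambda>m. \<Sum>i\<in>F. (cmod (ell2_coord (X n) i - ell2_coord (X m) i))\<^sup>2) \<longlonglongrightarrow>
            (\<Sum>i\<in>F. (cmod (ell2_coord (X n) i - c i))\<^sup>2)"
          by (intro tendsto_intros c)
        fix m assume m: "N \<le> m"
        have "(\<Sum>i\<in>F. (cmod (ell2_coord (X n) i - ell2_coord (X m) i))\<^sup>2) \<le> (norm (X n - X m))\<^sup>2"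
          using ell2_sum_le_norm[OF F, of "X n - X m"] by (simp add: ell2_coord_minus)
        also have "\<dots> \<le> e\<^sup>2" using N[OF n m] by (intro power_mono) auto
        finally show "(\<Sum>i\<in>F. (cmod (ell2_coord (X n) i - ell2_coord (X m) i))\<^sup>2) \<le> e\<^sup>2" .
      qed simp
      then show "\<exists>d. ell2_coord d = (\<lambda>i. ell2_coord (X n) i - c i) \<and> norm d \<le> e"
        using ell2_of_bounded_sums[of "\<lambda>i. ell2_coord (X n) i - c i" e] e
        by (metis less_imp_le)
    qed
  qed
  obtain N d where d: "ell2_coord d = (\<lambda>i. ell2_coord (X N) i - c i)" using ap[of 1] by auto
  define x where "x = X N - d"
  have x: "ell2_coord x i = c i" for i by (simp add: x_def ell2_coord_minus d)
  have "X \<longlonglongrightarrow> x"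
    unfolding lim_sequentially dist_norm
  proof (intro allI impI)
    fix e :: real assume e: "0 < e"
    obtain N where N: "\<And>n. N \<le> n \<Longrightarrow> \<exists>d. ell2_coord d = (\<lambda>i. ell2_coord (X n) i - c i) \<and> norm d \<le> e/2"
      using ap[of "e/2"] e by auto
    show "\<exists>N. \<forall>n\<ge>N. norm (X n - x) < e"
    proof (intro exI[of _ N] allI impI)
      fix n assume "N \<le> n"
      then obtain d where d: "ell2_coord d = (\<lambda>i. ell2_coord (X n) i - c i)" "norm d \<le> e/2"
        using N by blast
      have "X n - x = d" by (rule ell2_eqI) (simp add: ell2_coord_minus d x)
      then show "norm (X n - x) < e" using d(2) e by simp
    qed
  qed
  then show "convergent X" by (auto simp: convergent_def)
qed

subsection \<open>Complex linear operators and adjoints\<close>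

definition complex_linear :: "'i ell2_op \<Rightarrow> bool"
  where "complex_linear a \<longleftrightarrow> (\<forall>c x. blinfun_apply a (ell2_scaleC c x) = ell2_scaleC c (blinfun_apply a x))"

lemma complex_linearD:
  "complex_linear a \<Longrightarrow> blinfun_apply a (ell2_scaleC c x) = ell2_scaleC c (blinfun_apply a x)"
  by (simp add: complex_linear_def)

lemma blinfun_coord_bounded_linear:
  fixes x :: "'i ell2"
  shows "bounded_linear (\<lambda>a :: 'i ell2_op. ell2_coord (blinfun_apply a x) i)"
proof (rule bounded_linear_intro[of _ "norm x"])
  fix a :: "'i ell2_op"
  have "cmod (ell2_coord (blinfun_apply a x) i) \<le> norm (blinfun_apply a x)"
    by (rule ell2_coord_le_norm)
  also have "\<dots> \<le> norm a * norm x" by (rule norm_blinfun)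
  finally show "norm (ell2_coord (blinfun_apply a x) i) \<le> norm a * norm x" .
qed (auto simp: blinfun.add_left blinfun.scaleR_left ell2_coord_simps scaleR_conv_of_real)

text \<open>The condition is an intersection of coordinate equations, each continuous in the
  operator; this lets it pass to the norm closures that define the algebras.\<close>

lemma closed_complex_linear: "closed {a. complex_linear (a :: 'i ell2_op)}"
proof -
  have "{a. complex_linear (a :: 'i ell2_op)} =
      (\<Inter>c x i. {a. ell2_coord (blinfun_apply a (ell2_scaleC c x)) i = c * ell2_coord (blinfun_apply a x) i})"
    by (auto simp: complex_linear_def ell2_scaleC.rep_eq intro!: ell2_eqI)
  moreover have "closed \<dots>"
    by (intro closed_INT ballI closed_Collect_eq
        continuous_intros bounded_linear.continuous_on[OF blinfun_coord_bounded_linear])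
  ultimately show ?thesis by simp
qed

lemma complex_linear_simps [intro]:
  "complex_linear a \<Longrightarrow> complex_linear b \<Longrightarrow> complex_linear (a + b)"
  "complex_linear a \<Longrightarrow> complex_linear b \<Longrightarrow> complex_linear (a - b)"
  "complex_linear a \<Longrightarrow> complex_linear b \<Longrightarrow> complex_linear (a o\<^sub>L b)"
  "complex_linear a \<Longrightarrow> complex_linear (op_scaleC c a)"
  "complex_linear id_blinfun"
  by (auto simp: complex_linear_def blinfun.add_left blinfun.diff_left ell2_scaleC_add
      ell2_scaleC_diff op_scaleC_apply ell2_scaleC_scaleC mult.commute)

text \<open>Truncating \<open>x\<close> to finitely many coordinates changes coordinate
  \<open>i\<close> of the image by less than its supposed nonzero modulus, while the truncation
  contributes 0. The summand 1 next to \<open>norm a\<close> covers the zero operator.\<close>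

lemma complex_linear_row_zero:
  assumes a: "complex_linear a" and z: "\<And>j. ell2_coord x j \<noteq> 0 \<Longrightarrow> ell2_coord (blinfun_apply a (ell2_delta j)) i = 0"
  shows "ell2_coord (blinfun_apply a x) i = 0"
proof (rule ccontr)
  assume "ell2_coord (blinfun_apply a x) i \<noteq> 0" (is "?v \<noteq> 0")
  then have e: "0 < cmod ?v / (norm a + 1)"
    by (intro divide_pos_pos) (auto simp: add_nonneg_pos)
  obtain F where F: "finite F"
    "norm (x - (\<Sum>j\<in>F. ell2_scaleC (ell2_coord x j) (ell2_delta j))) < cmod ?v / (norm a + 1)"
    (is "norm (x - ?s) < _")
    using ell2_delta_approx[OF e] by blast
  have "ell2_coord (blinfun_apply a ?s) i =
      (\<Sum>j\<in>F. ell2_coord x j * ell2_coord (blinfun_apply a (ell2_delta j)) i)"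
    by (simp add: blinfun.sum_right ell2_coord_sum complex_linearD[OF a] ell2_scaleC.rep_eq)
  also have "\<dots> = 0" using z by (intro sum.neutral) auto
  finally have "?v = ell2_coord (blinfun_apply a (x - ?s)) i"
    by (simp add: blinfun.diff_right ell2_coord_minus)
  then have "cmod ?v \<le> norm (blinfun_apply a (x - ?s))" by (metis ell2_coord_le_norm)
  also have "\<dots> \<le> norm a * norm (x - ?s)" by (rule norm_blinfun)
  also have "\<dots> \<le> (norm a + 1) * norm (x - ?s)" by (intro mult_right_mono) auto
  also have "\<dots> < (norm a + 1) * (cmod ?v / (norm a + 1))"
    by (intro mult_strict_left_mono F) (auto simp: add_nonneg_pos)
  also have "\<dots> = cmod ?v" by (simp add: add_nonneg_pos add_nonneg_eq_0_iff)
  finally show False by simp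
qed

lemma complex_linear_eqI:
  assumes "complex_linear a" "complex_linear b"
    and "\<And>i j. ell2_coord (blinfun_apply a (ell2_delta j)) i = ell2_coord (blinfun_apply b (ell2_delta j)) i"
  shows "a = b"
proof (rule blinfun_eqI, rule ell2_eqI)
  fix x i
  have "ell2_coord (blinfun_apply (a - b) x) i = 0"
    by (rule complex_linear_row_zero) (auto simp: assms blinfun.diff_left ell2_coord_minus)
  then show "ell2_coord (blinfun_apply a x) i = ell2_coord (blinfun_apply b x) i"
    by (simp add: blinfun.diff_left ell2_coord_minus)
qed

lemma ell2_cinner_right_cancel:
  assumes "\<And>x. ell2_cinner x y = ell2_cinner x z" shows "y = z"
  by (rule ell2_eqI) (metis assms ell2_cinner_delta complex_cnj_cancel_iff)

text \<open>Testing on basis vectors forces the coordinates of the adjoint. They are square summable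
  because pairing with the truncated candidate, of squared norm s, gives s <= norm a * sqrt s * norm
  y.\<close>

lemma adjoint_exists:
  fixes a :: "'i ell2_op"
  assumes a: "complex_linear a"
  obtains b where "complex_linear b"
    "\<And>x y. ell2_cinner (blinfun_apply a x) y = ell2_cinner x (blinfun_apply b y)"
    "norm b \<le> norm a"
proof -
  have "\<exists>z. ell2_coord z = (\<lambda>i. cnj (ell2_cinner (blinfun_apply a (ell2_delta i)) y)) \<and>
      norm z \<le> norm a * norm y" for y
  proof -
    let ?c = "\<lambda>i. cnj (ell2_cinner (blinfun_apply a (ell2_delta i)) y)"
    have "(\<Sum>i\<in>F. (cmod (?c i))\<^sup>2) \<le> (norm a * norm y)\<^sup>2" if F: "finite F" for F
    proof -
      define s where "s = (\<Sum>i\<in>F. (cmod (?c i))\<^sup>2)"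
      define x where "x = (\<Sum>i\<in>F. ell2_scaleC (?c i) (ell2_delta i))"
      have s0: "0 \<le> s" by (simp add: s_def sum_nonneg)
      have xc: "ell2_coord x i = (if i \<in> F then ?c i else 0)" for i
        using F by (simp add: x_def ell2_coord_sum ell2_coord_simps ell2_delta.rep_eq if_distrib cong: if_cong)
      have nx: "(norm x)\<^sup>2 = s"
      proof -
        have "(norm x)\<^sup>2 = infsum (\<lambda>i. (cmod (?c i))\<^sup>2) F"
          unfolding ell2_norm_sq xc by (rule infsum_cong_neutral) auto
        then show ?thesis using F by (simp add: s_def)
      qed
      have "ell2_cinner (blinfun_apply a x) y = (\<Sum>i\<in>F. ?c i * cnj (?c i))"
        by (simp add: x_def blinfun.sum_right ell2_cinner_sum complex_linearD[OF a] ell2_cinner_scaleC)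
      also have "\<dots> = complex_of_real s" by (simp only: s_def of_real_sum complex_norm_square)
      finally have "s \<le> norm (blinfun_apply a x) * norm y"
        using ell2_Cauchy_Schwarz[of "blinfun_apply a x" y] s0 by simp
      also have "\<dots> \<le> norm a * norm x * norm y" by (intro mult_right_mono norm_blinfun) auto
      finally have 1: "(norm x)\<^sup>2 \<le> (norm a * norm y) * norm x" using nx by (simp add: mult_ac)
      then have "norm x \<le> norm a * norm y"
        by (cases "x = 0") (auto simp: power2_eq_square)
      then have "(norm x)\<^sup>2 \<le> (norm a * norm y)\<^sup>2" by (intro power_mono) auto
      then show ?thesis by (simp add: nx s_def)
    qed
    then show ?thesis
      by (rule ell2_of_bounded_sums) (auto simp: )
  qed
  then obtain B where B: "\<And>y i. ell2_coord (B y) i = cnj (ell2_cinner (blinfun_apply a (ell2_delta i)) y)"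
    and Bn: "\<And>y. norm (B y) \<le> norm a * norm y" by metis
  have bl: "bounded_linear B"
  proof (rule bounded_linear_intro[of _ "norm a"])
    show "B (x + y) = B x + B y" for x y
      by (rule ell2_eqI) (simp add: ell2_coord_simps B ell2_cinner_add_right)
    show "B (r *\<^sub>R x) = r *\<^sub>R B x" for r x
      by (rule ell2_eqI) (simp add: ell2_coord_simps B ell2_cinner_scaleC_right flip: ell2_scaleC_of_real)
    show "norm (B x) \<le> norm x * norm a" for x using Bn[of x] by (simp add: mult.commute)
  qed
  have app: "blinfun_apply (Blinfun B) y = B y" for y by (simp add: bounded_linear_Blinfun_apply bl)
  show thesis
  proof (rule that[of "Blinfun B"])
    show "complex_linear (Blinfun B)"
      unfolding complex_linear_def app
      by (intro allI ell2_eqI) (simp add: ell2_coord_simps B ell2_cinner_scaleC_right)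
    show "norm (Blinfun B) \<le> norm a" by (rule norm_blinfun_bound) (auto simp: app Bn)
    fix x y
    show "ell2_cinner (blinfun_apply a x) y = ell2_cinner x (blinfun_apply (Blinfun B) y)"
    proof (rule ccontr)
      assume ne: "ell2_cinner (blinfun_apply a x) y \<noteq> ell2_cinner x (blinfun_apply (Blinfun B) y)"
      \<comment> \<open>Both sides are linear in \<open>x\<close> and agree on finite combinations
        of basis vectors. \<open>C\<close> is a Lipschitz constant of their difference, enlarged by
        1 to be positive.\<close>
      define C where "C = 2 * norm a * norm y + 1"
      have C: "0 < C" by (simp add: C_def add_nonneg_pos)
      let ?D = "\<lambda>x. ell2_cinner (blinfun_apply a x) y - ell2_cinner x (B y)"
      have e: "0 < cmod (?D x) / C" using ne C by (simp add: app)
      obtain F where F: "norm (x - (\<Sum>j\<in>F. ell2_scaleC (ell2_coord x j) (ell2_delta j))) < cmod (?D x) / C"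
        (is "norm (x - ?s) < _") using ell2_delta_approx[OF e] by blast
      have "?D ?s = 0"
        by (simp add: blinfun.sum_right ell2_cinner_sum complex_linearD[OF a] ell2_cinner_scaleC
            ell2_cinner_delta B)
      then have D: "?D x = ?D (x - ?s)"
        by (simp add: blinfun.diff_right ell2_cinner_diff)
      have "cmod (?D (x - ?s)) \<le> norm (blinfun_apply a (x - ?s)) * norm y + norm (x - ?s) * norm (B y)"
        by (intro order.trans[OF norm_triangle_ineq4] add_mono ell2_Cauchy_Schwarz)
      also have "\<dots> \<le> (norm a * norm (x - ?s)) * norm y + norm (x - ?s) * (norm a * norm y)"
        by (intro add_mono mult_mono norm_blinfun Bn) auto
      also have "\<dots> \<le> C * norm (x - ?s)" by (simp add: C_def algebra_simps)
      also have "\<dots> < C * (cmod (?D x) / C)" by (rule mult_strict_left_mono[OF F C])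
      also have "\<dots> = cmod (?D x)" using C by simp
      finally show False using D by simp
    qed
  qed
qed

lemma op_star_eqI:
  assumes "\<And>x y. ell2_cinner (blinfun_apply a x) y = ell2_cinner x (blinfun_apply b y)"
  shows "op_star a = b"
  unfolding op_star_def
proof (rule the_equality)
  show "\<forall>x y. ell2_cinner (blinfun_apply a x) y = ell2_cinner x (blinfun_apply b y)" using assms by blast
  fix c assume "\<forall>x y. ell2_cinner (blinfun_apply a x) y = ell2_cinner x (blinfun_apply c y)"
  then show "c = b" by (intro blinfun_eqI ell2_cinner_right_cancel) (metis assms)
qed

lemma op_star_all:
  assumes "complex_linear a"
  shows "complex_linear (op_star a)"
    and "ell2_cinner (blinfun_apply a x) y = ell2_cinner x (blinfun_apply (op_star a) y)"
    and "norm (op_star a) \<le> norm a"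
proof -
  obtain b where b: "complex_linear b"
    "\<And>x y. ell2_cinner (blinfun_apply a x) y = ell2_cinner x (blinfun_apply b y)" "norm b \<le> norm a"
    using adjoint_exists[OF assms] by blast
  have "op_star a = b" by (rule op_star_eqI[OF b(2)])
  then show "complex_linear (op_star a)"
    "ell2_cinner (blinfun_apply a x) y = ell2_cinner x (blinfun_apply (op_star a) y)"
    "norm (op_star a) \<le> norm a" using b by auto
qed

lemma op_star_cinner:
  assumes "complex_linear a"
  shows "ell2_cinner x (blinfun_apply a y) = ell2_cinner (blinfun_apply (op_star a) x) y"
  by (subst (1 2) ell2_cinner_cnj) (simp add: op_star_all(2)[OF assms])

lemma op_star_op_star: "complex_linear a \<Longrightarrow> op_star (op_star a) = a"
  by (rule op_star_eqI) (simp add: op_star_cinner)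

lemma op_star_matrix:
  assumes "complex_linear a"
  shows "ell2_coord (blinfun_apply (op_star a) (ell2_delta j)) i = cnj (ell2_coord (blinfun_apply a (ell2_delta i)) j)"
proof -
  have "cnj (ell2_coord (blinfun_apply (op_star a) (ell2_delta j)) i) =
      ell2_cinner (blinfun_apply a (ell2_delta i)) (ell2_delta j)"
    by (simp add: op_star_all(2)[OF assms] ell2_cinner_delta)
  also have "\<dots> = ell2_coord (blinfun_apply a (ell2_delta i)) j"
    by (subst ell2_cinner_cnj) (simp add: ell2_cinner_delta)
  finally show ?thesis by (metis complex_cnj_cnj)
qed

lemma op_star_comp:
  "complex_linear a \<Longrightarrow> complex_linear b \<Longrightarrow> op_star (a o\<^sub>L b) = op_star b o\<^sub>L op_star a"
  by (rule op_star_eqI) (simp add: op_star_all(2))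

lemma op_star_add:
  "complex_linear a \<Longrightarrow> complex_linear b \<Longrightarrow> op_star (a + b) = op_star a + op_star b"
  by (rule op_star_eqI)
    (simp add: blinfun.add_left ell2_cinner_add ell2_cinner_add_right op_star_all(2))

lemma op_star_scaleC: "complex_linear a \<Longrightarrow> op_star (op_scaleC c a) = op_scaleC (cnj c) (op_star a)"
  by (rule op_star_eqI)
    (simp add: op_scaleC_apply ell2_cinner_scaleC ell2_cinner_scaleC_right op_star_all(2))

lemma op_scaleC_of_real: "op_scaleC (of_real r) a = r *\<^sub>R a"
  by (rule blinfun_eqI) (simp add: op_scaleC_apply ell2_scaleC_of_real blinfun.scaleR_left)

lemma op_star_diff:
  "complex_linear a \<Longrightarrow> complex_linear b \<Longrightarrow> op_star (a - b) = op_star a - op_star b"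
  using op_star_add[of "a - b" b] by (simp add: complex_linear_simps)

subsection \<open>Automorphisms of operator algebras are contractive\<close>

text \<open>The unit \<open>e\<close> is an element of \<open>A\<close> and not in general the
  identity operator: in the application it is the projection onto the vectors supported on the
  arrows.\<close>

definition concrete_star_algebra :: "'i ell2_op set \<Rightarrow> 'i ell2_op \<Rightarrow> bool"
  where "concrete_star_algebra A e \<longleftrightarrow> closed A \<and> e \<in> A \<and> op_star e = e \<and>
    (\<forall>a\<in>A. e o\<^sub>L a = a \<and> a o\<^sub>L e = a) \<and>
    (\<forall>a\<in>A. complex_linear a \<and> op_star a \<in> A \<and> (\<forall>c. op_scaleC c a \<in> A)) \<and>
    (\<forall>a\<in>A. \<forall>b\<in>A. a + b \<in> A \<and> a o\<^sub>L b \<in> A)"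

lemma concrete_star_algebraD:
  assumes "concrete_star_algebra A e"
  shows "closed A" "e \<in> A" "a \<in> A \<Longrightarrow> complex_linear a" "a \<in> A \<Longrightarrow> op_star a \<in> A"
    "a \<in> A \<Longrightarrow> op_scaleC c a \<in> A" "a \<in> A \<Longrightarrow> b \<in> A \<Longrightarrow> a + b \<in> A"
    "a \<in> A \<Longrightarrow> b \<in> A \<Longrightarrow> a o\<^sub>L b \<in> A" "a \<in> A \<Longrightarrow> r *\<^sub>R a \<in> A" "a \<in> A \<Longrightarrow> b \<in> A \<Longrightarrow> a - b \<in> A"
    "a \<in> A \<Longrightarrow> e o\<^sub>L a = a" "a \<in> A \<Longrightarrow> a o\<^sub>L e = a" "op_star e = e"
proof -
  show *: "a \<in> A \<Longrightarrow> r *\<^sub>R a \<in> A" for a r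
    using assms unfolding concrete_star_algebra_def op_scaleC_of_real[symmetric] by blast
  show "a \<in> A \<Longrightarrow> b \<in> A \<Longrightarrow> a - b \<in> A"
    using assms *[of b "-1"] unfolding concrete_star_algebra_def by (metis diff_conv_add_uminus scaleR_minus1_left)
qed (use assms in \<open>auto simp: concrete_star_algebra_def\<close>)

lemma star_automorphismsD:
  assumes "\<phi> \<in> star_automorphisms A"
  shows "\<phi> \<in> Bij A" "a \<in> A \<Longrightarrow> \<phi> a \<in> A" "a \<in> A \<Longrightarrow> b \<in> A \<Longrightarrow> \<phi> (a + b) = \<phi> a + \<phi> b"
    "a \<in> A \<Longrightarrow> \<phi> (op_scaleC c a) = op_scaleC c (\<phi> a)"
    "a \<in> A \<Longrightarrow> b \<in> A \<Longrightarrow> \<phi> (a o\<^sub>L b) = \<phi> a o\<^sub>L \<phi> b"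
    "a \<in> A \<Longrightarrow> \<phi> (op_star a) = op_star (\<phi> a)"
    "a \<in> A \<Longrightarrow> \<phi> (r *\<^sub>R a) = r *\<^sub>R \<phi> a"
  using assms unfolding star_automorphisms_def op_scaleC_of_real[symmetric]
  by (auto simp: Bij_def bij_betw_def)

lemma star_automorphism_diff:
  assumes A: "concrete_star_algebra A e" and p: "\<phi> \<in> star_automorphisms A" and "a \<in> A" "b \<in> A"
  shows "\<phi> (a - b) = \<phi> a - \<phi> b"
  using star_automorphismsD(3)[OF p, of "a - b" b] assms concrete_star_algebraD(9)[OF A]
  by (simp add: algebra_simps)

lemma star_automorphism_unit:
  assumes A: "concrete_star_algebra A e" and p: "\<phi> \<in> star_automorphisms A"
  shows "\<phi> e = e"
proof -
  note D = concrete_star_algebraD[OF A]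
  obtain a where a: "a \<in> A" "\<phi> a = e"
    using star_automorphismsD(1)[OF p] D(2)
    by (metis Bij_def Int_iff bij_betw_def imageE mem_Collect_eq)
  have "e = \<phi> (a o\<^sub>L e)" using a D(11) by simp
  also have "\<dots> = \<phi> a o\<^sub>L \<phi> e" by (rule star_automorphismsD(5)[OF p a(1) D(2)])
  also have "\<dots> = \<phi> e" using a(2) D(10) star_automorphismsD(2)[OF p D(2)] by simp
  finally show ?thesis by simp
qed

text \<open>The fixed point \<open>x\<close> of \<open>x \<mapsto> (b + x\<^sup>2)/2\<close> satisfies \<open>e - b = (e - x)\<^sup>2\<close>.\<close>

lemma concrete_star_algebra_sqrt:
  assumes A: "concrete_star_algebra A e" and b: "b \<in> A" "op_star b = b" "norm b < 1"
  obtains c where "c \<in> A" "op_star c = c" "e - b = c o\<^sub>L c"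
proof -
  note [intro] = concrete_star_algebraD[OF A]
  \<comment> \<open>\<open>F\<close> maps the ball of radius \<open>norm b\<close> into itself, as
    norm b + (norm b)^2 <= 2 norm b, and contracts it by the factor \<open>norm b\<close>.
    Self-adjointness is built into \<open>S\<close> so that the fixed point inherits it.\<close>
  define S where "S = {x \<in> A. norm x \<le> norm b \<and> op_star x = x}"
  define F where "F x = (1/2) *\<^sub>R (b + (x o\<^sub>L x))" for x
  \<comment> \<open>\<open>op_star\<close> is a definite description; restated through inner
    products, self-adjointness becomes a family of equations that are continuous in the operator, so
    \<open>S\<close> is closed.\<close>
  have starS: "op_star x = x \<longleftrightarrow> (\<forall>y z. ell2_cinner (blinfun_apply x y) z = ell2_cinner y (blinfun_apply x z))"
    if "x \<in> A" for x
    using that by (metis op_star_all(2) op_star_eqI concrete_star_algebraD(3)[OF A])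
  have "closed S"
  proof -
    have c1: "isCont (\<lambda>x. ell2_cinner (blinfun_apply x y) z) x0"
      and c2: "isCont (\<lambda>x. ell2_cinner y (blinfun_apply x z)) x0" for x0 :: "'a ell2_op" and y z
    proof -
      have bl: "bounded_linear (\<lambda>x :: 'a ell2_op. ell2_cinner (blinfun_apply x y) z)" for y z
      proof (rule bounded_linear_intro)
        show "norm (ell2_cinner (blinfun_apply x y) z) \<le> norm x * (norm y * norm z)" for x
        proof -
          have "norm (ell2_cinner (blinfun_apply x y) z) \<le> norm (blinfun_apply x y) * norm z"
            by (rule ell2_Cauchy_Schwarz)
          also have "\<dots> \<le> (norm x * norm y) * norm z" by (intro mult_right_mono norm_blinfun) auto
          finally show ?thesis by (simp add: mult.assoc)
        qed
      qed (auto simp: blinfun.add_left blinfun.scaleR_left ell2_cinner_add ell2_cinner_scaleC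
          scaleR_conv_of_real simp flip: ell2_scaleC_of_real)
      show "isCont (\<lambda>x. ell2_cinner (blinfun_apply x y) z) x0"
        using bl by (simp add: linear_continuous_at)
      have "isCont (\<lambda>x. cnj (ell2_cinner (blinfun_apply x z) y)) x0"
        using bl by (intro continuous_intros linear_continuous_at)
      then show "isCont (\<lambda>x. ell2_cinner y (blinfun_apply x z)) x0"
        by (subst ell2_cinner_cnj)
    qed
    have "S = A \<inter> {x. norm x \<le> norm b} \<inter> (\<Inter>y z. {x. ell2_cinner (blinfun_apply x y) z = ell2_cinner y (blinfun_apply x z)})"
      unfolding S_def using starS by auto
    moreover have "closed \<dots>"
      by (intro closed_Int closed_INT ballI closed_Collect_eq closed_Collect_le continuous_intros
          concrete_star_algebraD(1)[OF A] continuous_at_imp_continuous_on c1 c2)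
    ultimately show ?thesis by simp
  qed
  then have "complete S" by (simp add: complete_eq_closed)
  moreover have "S \<noteq> {}"
  proof -
    have "0 *\<^sub>R b \<in> A" using b by blast
    moreover have "op_star (0 :: 'a ell2_op) = 0"
      by (rule op_star_eqI) (metis blinfun.zero_left ell2_cinner_zero ell2_cinner_cnj complex_cnj_zero)
    ultimately have "0 \<in> S" by (simp add: S_def)
    then show ?thesis by blast
  qed
  moreover have "F ` S \<subseteq> S"
  proof clarify
    fix x assume x: "x \<in> S"
    have cl: "complex_linear x" "complex_linear b" using x b A by (auto simp: S_def)
    have "norm (x o\<^sub>L x) \<le> norm x * norm x" by (rule norm_blinfun_compose)
    also have "\<dots> \<le> norm b * norm b" using x by (intro mult_mono) (auto simp: S_def)
    also have "\<dots> \<le> norm b * 1" using b by (intro mult_left_mono) auto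
    finally have "norm (b + (x o\<^sub>L x)) \<le> norm b + norm b"
      by (intro order.trans[OF norm_triangle_ineq] add_mono) auto
    moreover have "op_star (F x) = F x"
      using x b cl by (simp add: F_def op_star_scaleC op_star_add op_star_comp complex_linear_simps S_def
          flip: op_scaleC_of_real)
    moreover have "F x \<in> A" unfolding F_def using x b by (auto simp: S_def)
    ultimately show "F x \<in> S" by (simp add: S_def F_def)
  qed
  moreover have "\<forall>x\<in>S. \<forall>y\<in>S. dist (F x) (F y) \<le> norm b * dist x y"
  proof (intro ballI)
    fix x y assume xy: "x \<in> S" "y \<in> S"
    \<comment> \<open>Noncommutative form of the difference of squares: x x - y y = x (x - y) + (x -
      y) y.\<close>
    have "F x - F y = (1/2) *\<^sub>R ((x o\<^sub>L (x - y)) + ((x - y) o\<^sub>L y))"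
      by (rule blinfun_eqI) (simp add: F_def blinfun.diff_left blinfun.diff_right blinfun.add_left
          blinfun.scaleR_left scaleR_diff_right[symmetric] del: scaleR_half_double)
    moreover have "norm ((x o\<^sub>L (x - y)) + ((x - y) o\<^sub>L y)) \<le> norm x * norm (x - y) + norm (x - y) * norm y"
      by (intro order.trans[OF norm_triangle_ineq] add_mono norm_blinfun_compose)
    moreover have "norm x * norm (x - y) + norm (x - y) * norm y \<le> norm b * norm (x - y) + norm (x - y) * norm b"
      using xy by (intro add_mono mult_mono) (auto simp: S_def)
    ultimately show "dist (F x) (F y) \<le> norm b * dist x y" by (simp add: dist_norm)
  qed
  ultimately have "\<exists>!x. x \<in> S \<and> F x = x" using b(3) by (intro Banach_fix) auto
  then obtain x where x: "x \<in> S" "F x = x" by blast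
  have cl: "complex_linear x" using x A by (auto simp: S_def)
  show thesis
  proof (rule that[of "e - x"])
    note D = concrete_star_algebraD[OF A]
    have xA: "x \<in> A" using x(1) by (simp add: S_def)
    show "e - x \<in> A" using D(2) xA by (rule D(9))
    show "op_star (e - x) = e - x"
      using cl x(1) D(3)[OF D(2)] D(12) by (simp add: op_star_diff S_def)
    have eq: "2 *\<^sub>R blinfun_apply x \<xi> = blinfun_apply b \<xi> + blinfun_apply x (blinfun_apply x \<xi>)" for \<xi>
    proof -
      have "2 *\<^sub>R blinfun_apply (F x) \<xi> = blinfun_apply b \<xi> + blinfun_apply x (blinfun_apply x \<xi>)"
        by (simp add: F_def blinfun.scaleR_left blinfun.add_left)
      then show ?thesis using x(2) by simp
    qed
    show "e - b = (e - x) o\<^sub>L (e - x)"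
    proof (rule blinfun_eqI)
      fix \<xi>
      have u: "blinfun_apply e (blinfun_apply a \<xi>) = blinfun_apply a \<xi>"
        "blinfun_apply a (blinfun_apply e \<xi>) = blinfun_apply a \<xi>" if "a \<in> A" for a
        using D(10,11)[OF that] by (metis blinfun_apply_blinfun_compose)+
      show "blinfun_apply (e - b) \<xi> = blinfun_apply ((e - x) o\<^sub>L (e - x)) \<xi>"
        using eq[of \<xi>] by (simp add: blinfun.diff_left blinfun.diff_right scaleR_2 algebra_simps u D(2) xA)
    qed
  qed
qed

text \<open>For norm a < 1, the element e - op_star a a is the square of a self-adjoint c. Its image
  is the square of the self-adjoint \<phi> c, hence positive, so \<phi> a has norm at most 1;
  rescaling gives the general bound.\<close>

lemma star_automorphism_contractive:
  assumes A: "concrete_star_algebra A e" and p: "\<phi> \<in> star_automorphisms A" and a: "a \<in> A"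
  shows "norm (\<phi> a) \<le> norm a"
proof -
  note D = concrete_star_algebraD[OF A] and P = star_automorphismsD[OF p]
  have 1: "norm (\<phi> a) \<le> 1" if a: "a \<in> A" and n: "norm a < 1" for a
  proof -
    define b where "b = op_star a o\<^sub>L a"
    have cl: "complex_linear a" "complex_linear (op_star a)" using a D by auto
    have bA: "b \<in> A" unfolding b_def using a D by auto
    have bs: "op_star b = b" unfolding b_def using cl by (simp add: op_star_comp op_star_op_star)
    have "norm b \<le> norm (op_star a) * norm a" unfolding b_def by (rule norm_blinfun_compose)
    also have "\<dots> \<le> norm a * norm a" using cl by (intro mult_right_mono op_star_all) auto
    also have "\<dots> \<le> norm a * 1" using n by (intro mult_left_mono) auto
    finally have "norm b < 1" using n by simp
    then obtain c where c: "c \<in> A" "op_star c = c" "e - b = c o\<^sub>L c"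
      using concrete_star_algebra_sqrt[OF A bA bs] by blast
    have pc: "op_star (\<phi> c) = \<phi> c" using P(6)[OF c(1)] c(2) by simp
    have "e - \<phi> b = \<phi> (e - b)"
      using star_automorphism_diff[OF A p D(2) bA] star_automorphism_unit[OF A p] by simp
    also have "\<dots> = \<phi> c o\<^sub>L \<phi> c" unfolding c(3) using c(1) by (intro P)
    finally have eb: "e - \<phi> b = \<phi> c o\<^sub>L \<phi> c" .
    have pb: "\<phi> b = op_star (\<phi> a) o\<^sub>L \<phi> a"
      unfolding b_def using a D P by metis
    have cl': "complex_linear (\<phi> a)" "complex_linear (\<phi> c)" "complex_linear (op_star (\<phi> a))"
      using P(2) D(3,4) a c(1) by blast+
    show ?thesis
    proof (rule norm_blinfun_bound)
      fix x
      let ?u = "blinfun_apply (\<phi> a) x" and ?v = "blinfun_apply (\<phi> c) x"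
      let ?w = "blinfun_apply e x"
      \<comment> \<open>\<open>e\<close> is a self-adjoint idempotent, so <e x, x> is the squared
        norm of e x, which is at most that of x. This takes the place of an identity
        operator.\<close>
      have ew: "ell2_cinner ?w x = ell2_cinner ?w ?w"
        using op_star_all(2)[OF D(3)[OF D(2)], of ?w x] D(11)[OF D(2)] D(12)
        by (metis blinfun_apply_blinfun_compose)
      have "ell2_cinner ?w ?w - ell2_cinner ?u ?u = ell2_cinner (blinfun_apply (e - \<phi> b) x) x"
        by (simp add: blinfun.diff_left ell2_cinner_diff pb op_star_all(2)[OF cl'(3)] op_star_op_star[OF cl'(1)] ew)
      also have "\<dots> = ell2_cinner ?v ?v" unfolding eb by (simp add: op_star_all(2)[OF cl'(2)] pc)
      finally have "complex_of_real ((norm ?w)\<^sup>2 - (norm ?u)\<^sup>2) = complex_of_real ((norm ?v)\<^sup>2)"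
        by (simp add: ell2_cinner_norm)
      then have "(norm ?w)\<^sup>2 - (norm ?u)\<^sup>2 = (norm ?v)\<^sup>2" by (simp only: of_real_eq_iff)
      moreover have "0 \<le> (norm ?v)\<^sup>2" by (rule zero_le_power2)
      moreover have "(norm ?w)\<^sup>2 \<le> (norm x)\<^sup>2"
      proof -
        have "(norm ?w)\<^sup>2 \<le> norm ?w * norm x"
          using ell2_Cauchy_Schwarz[of ?w x] by (simp add: ew ell2_cinner_norm norm_power)
        then have "norm ?w \<le> norm x" by (cases "norm ?w = 0") (auto simp: power2_eq_square)
        then show ?thesis by (intro power_mono) auto
      qed
      ultimately have "(norm ?u)\<^sup>2 \<le> (norm x)\<^sup>2" by linarith
      then have "norm ?u \<le> norm x" by (rule power2_le_imp_le) (rule norm_ge_zero)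
      then show "norm ?u \<le> 1 * norm x" by (simp only: mult_1)
    qed simp
  qed
  show ?thesis
  proof (rule field_le_epsilon)
    fix \<epsilon> :: real assume \<epsilon>: "0 < \<epsilon>"
    define r where "r = norm a + \<epsilon>"
    have r: "0 < r" "norm a < r" using \<epsilon> by (auto simp: r_def add_nonneg_pos)
    have "norm (\<phi> ((1/r) *\<^sub>R a)) \<le> 1" using r a by (intro 1) (auto intro: D)
    then have "norm (\<phi> a) \<le> r" using r by (simp add: P(7)[OF a] field_simps)
    then show "norm (\<phi> a) \<le> norm a + \<epsilon>" by (simp add: r_def)
  qed
qed

subsection \<open>Compact Deaconu-Renault systems\<close>

lemma continuous_map_euclidean_iff:
  fixes f :: "'b \<Rightarrow> 'c::metric_space"
  shows "continuous_map Y euclidean f \<longleftrightarrow>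
    (\<forall>y\<in>topspace Y. \<forall>e>0. \<exists>U. openin Y U \<and> y \<in> U \<and> (\<forall>z\<in>U. dist (f z) (f y) < e))"
proof
  assume f: "continuous_map Y euclidean f"
  show "\<forall>y\<in>topspace Y. \<forall>e>0. \<exists>U. openin Y U \<and> y \<in> U \<and> (\<forall>z\<in>U. dist (f z) (f y) < e)"
  proof (intro ballI allI impI)
    fix y and e :: real assume "y \<in> topspace Y" "0 < e"
    then show "\<exists>U. openin Y U \<and> y \<in> U \<and> (\<forall>z\<in>U. dist (f z) (f y) < e)"
      using openin_continuous_map_preimage[OF f, of "ball (f y) e"]
      by (intro exI[of _ "{x \<in> topspace Y. f x \<in> ball (f y) e}"]) (auto simp: dist_commute)
  qed
next
  assume r: "\<forall>y\<in>topspace Y. \<forall>e>0. \<exists>U. openin Y U \<and> y \<in> U \<and> (\<forall>z\<in>U. dist (f z) (f y) < e)"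
  show "continuous_map Y euclidean f"
    unfolding continuous_map_def
  proof (intro conjI allI impI)
    fix U :: "'c set" assume "openin euclidean U"
    then have U: "open U" by simp
    show "openin Y {x \<in> topspace Y. f x \<in> U}"
    proof (subst openin_subopen, safe)
      fix y assume y: "y \<in> topspace Y" "f y \<in> U"
      then obtain e where e: "0 < e" "ball (f y) e \<subseteq> U" using U openE by blast
      then obtain W where W: "openin Y W" "y \<in> W" "\<forall>z\<in>W. dist (f z) (f y) < e"
        using r y(1) by meson
      then show "\<exists>W. openin Y W \<and> y \<in> W \<and> W \<subseteq> {x \<in> topspace Y. f x \<in> U}"
        using e(2) openin_subset[OF W(1)] by (intro exI[of _ W]) (auto simp: dist_commute subset_iff)
    qed
  qed simp
qed

lemma Cc_memI:
  assumes "continuous_map Y euclidean f" "\<And>x. x \<notin> topspace Y \<Longrightarrow> f x = 0"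
    and "compactin Y K" "closedin Y K" "\<And>x. x \<in> topspace Y \<Longrightarrow> f x \<noteq> 0 \<Longrightarrow> x \<in> K"
  shows "f \<in> Cc Y"
proof -
  have "Y closure_of {x \<in> topspace Y. f x \<noteq> 0} \<subseteq> K"
    using assms(4,5) by (intro closure_of_minimal) auto
  then show ?thesis
    unfolding Cc_def using assms by (auto intro: closed_compactin)
qed

text \<open>Compactness of X is left to the next locale because it is a consequence of the final
  theorem's hypotheses: continuity of \<open>T\<close>, proved here, is used to derive it.\<close>

locale DR_system =
  fixes X :: "'a topology" and T :: "'a \<Rightarrow> 'a"
  assumes DR: "Deaconu_Renault_system X T"
begin

abbreviation "S \<equiv> topspace X"
abbreviation "G \<equiv> DR_groupoid X T"
abbreviation "GA \<equiv> arrows (DR_groupoid X T)"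
abbreviation "\<G> \<equiv> gtop (DR_groupoid X T)"
abbreviation "H \<equiv> DR_kernel X T"

lemma Hausdorff_X: "Hausdorff_space X" using DR by (simp add: Deaconu_Renault_system_def)

lemma T_in: "x \<in> S \<Longrightarrow> T x \<in> S"
  using DR by (auto simp: Deaconu_Renault_system_def local_homeomorphism_def)

lemma Tn_in: "x \<in> S \<Longrightarrow> (T ^^ n) x \<in> S"
  by (induction n) (auto simp: T_in)

lemma T_local:
  assumes "x \<in> S"
  obtains U where "openin X U" "x \<in> U" "openin X (T ` U)"
    "homeomorphic_map (subtopology X U) (subtopology X (T ` U)) T"
  using DR assms unfolding Deaconu_Renault_system_def local_homeomorphism_def by blast

lemma T_cont: "continuous_map X X T"
  unfolding continuous_map_def
proof (intro conjI allI impI)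
  fix V assume V: "openin X V"
  show "openin X {x \<in> S. T x \<in> V}"
  proof (subst openin_subopen, safe)
    fix x assume x: "x \<in> S" "T x \<in> V"
    obtain U where U: "openin X U" "x \<in> U" "openin X (T ` U)"
      "homeomorphic_map (subtopology X U) (subtopology X (T ` U)) T" using T_local[OF x(1)] by blast
    have US: "U \<subseteq> S" using U(1) openin_subset by blast
    have "continuous_map (subtopology X U) (subtopology X (T ` U)) T"
      using U(4) homeomorphic_imp_continuous_map by blast
    then have "continuous_map (subtopology X U) X T" by (simp add: continuous_map_in_subtopology)
    then have "openin (subtopology X U) {x \<in> topspace (subtopology X U). T x \<in> V}"
      using V openin_continuous_map_preimage by blast
    then have "openin X {x \<in> topspace (subtopology X U). T x \<in> V}"
      using U(1) openin_trans_full by blast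
    then show "\<exists>W. openin X W \<and> x \<in> W \<and> W \<subseteq> {x \<in> S. T x \<in> V}"
      using x U(2) US by (intro exI[of _ "{x \<in> topspace (subtopology X U). T x \<in> V}"]) auto
  qed
qed (use T_in in auto)

end

locale compact_DR_system = DR_system +
  assumes compact_X: "compact_space X"
begin

lemma T_open: "openin X V \<Longrightarrow> openin X (T ` V)"
proof (subst openin_subopen, safe)
  fix x assume V: "openin X V" and x: "x \<in> V"
  then have xS: "x \<in> S" using openin_subset by blast
  obtain U where U: "openin X U" "x \<in> U" "openin X (T ` U)"
    "homeomorphic_map (subtopology X U) (subtopology X (T ` U)) T" using T_local[OF xS] by blast
  have "openin (subtopology X U) (V \<inter> U)" using V by (metis openin_subtopology)
  then have "openin (subtopology X (T ` U)) (T ` (V \<inter> U))"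
    using U(4) homeomorphic_imp_open_map unfolding open_map_def by blast
  then have "openin X (T ` (V \<inter> U))" using U(3) openin_trans_full by blast
  then show "\<exists>W. openin X W \<and> T x \<in> W \<and> W \<subseteq> T ` V"
    using x U(2) by (intro exI[of _ "T ` (V \<inter> U)"]) auto
qed

lemma Tn_cont: "continuous_map X X (T ^^ n)"
proof (induction n)
  case (Suc n)
  show ?case using continuous_map_compose[OF Suc T_cont] by (simp add: o_def)
qed (simp add: id_def)

lemma Tn_open: "openin X V \<Longrightarrow> openin X ((T ^^ n) ` V)"
proof (induction n arbitrary: V)
  case (Suc n)
  have "(T ^^ Suc n) ` V = T ` ((T ^^ n) ` V)" by (auto simp: image_comp)
  then show ?case using Suc T_open by metis
qed simp

lemma Tn_preimage_open: "openin X V \<Longrightarrow> openin X {x \<in> S. (T ^^ n) x \<in> V}"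
  using Tn_cont openin_continuous_map_preimage by blast

lemma Tn_locally_inj:
  assumes "x \<in> S"
  obtains W where "openin X W" "x \<in> W" "inj_on (T ^^ n) W"
proof -
  have "\<exists>W. openin X W \<and> x \<in> W \<and> inj_on (T ^^ n) W" using assms
  proof (induction n)
    case 0 then show ?case by (intro exI[of _ S]) auto
  next
    case (Suc n)
    then obtain W where W: "openin X W" "x \<in> W" "inj_on (T ^^ n) W" by blast
    obtain U where U: "openin X U" "(T ^^ n) x \<in> U" "openin X (T ` U)"
      "homeomorphic_map (subtopology X U) (subtopology X (T ` U)) T"
      using T_local Tn_in[OF Suc.prems] by blast
    have "inj_on T U" using homeomorphic_imp_injective_map[OF U(4)] U(1) openin_subset
      by (metis topspace_subtopology_subset)
    then have "inj_on (T ^^ Suc n) (W \<inter> {x \<in> S. (T ^^ n) x \<in> U})"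
      using W(3) by (auto simp: inj_on_def)
    moreover have "openin X (W \<inter> {x \<in> S. (T ^^ n) x \<in> U})"
      using W(1) Tn_preimage_open[OF U(1)] by (rule openin_Int)
    moreover have "x \<in> W \<inter> {x \<in> S. (T ^^ n) x \<in> U}" using W(2) U(2) Suc.prems by simp
    ultimately show ?case by blast
  qed
  then show thesis using that by blast
qed

section \<open>Arrows, the groupoid topology and its neighbourhood bases\<close>

lemma funpow_eq_add: "(T ^^ i) y = (T ^^ j) x \<Longrightarrow> (T ^^ (k + i)) y = (T ^^ (k + j)) x"
  by (simp add: funpow_add)

lemma funpow_eq_mono:
  assumes "(T ^^ i) y = (T ^^ j) x" "i \<le> i'" "int i' - int j' = int i - int j"
  shows "(T ^^ i') y = (T ^^ j') x"
proof -
  have "i' = (i' - i) + i" "j' = (i' - i) + j" using assms(2,3) by auto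
  then show ?thesis using funpow_eq_add[OF assms(1), of "i' - i"] by metis
qed

lemma arrows_iff: "(y, n, x) \<in> GA \<longleftrightarrow>
    y \<in> S \<and> x \<in> S \<and> (\<exists>i j. n = int i - int j \<and> (T ^^ i) y = (T ^^ j) x)"
  unfolding arrows_DR_groupoid by auto

lemma arrowI: "y \<in> S \<Longrightarrow> x \<in> S \<Longrightarrow> (T ^^ i) y = (T ^^ j) x \<Longrightarrow> (y, int i - int j, x) \<in> GA"
  unfolding arrows_iff by blast

lemma arrow_unit: "x \<in> S \<Longrightarrow> (x, 0, x) \<in> GA"
  using arrowI[of x x 0 0] by simp

lemma arrow_inv: "(y, n, x) \<in> GA \<Longrightarrow> (x, - n, y) \<in> GA"
  unfolding arrows_iff by (metis minus_diff_eq)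

lemma arrow_comp:
  assumes "(z, n, y) \<in> GA" "(y, m, x) \<in> GA" shows "(z, n + m, x) \<in> GA"
proof -
  obtain i j where 1: "z \<in> S" "n = int i - int j" "(T ^^ i) z = (T ^^ j) y" using assms(1) unfolding arrows_iff by blast
  obtain k l where 2: "x \<in> S" "m = int k - int l" "(T ^^ k) y = (T ^^ l) x" using assms(2) unfolding arrows_iff by blast
  have "(T ^^ (k + i)) z = (T ^^ (k + j)) y" using 1(3) by (rule funpow_eq_add)
  also have "\<dots> = (T ^^ (j + l)) x" using funpow_eq_add[OF 2(3), of j] by (simp add: add.commute)
  finally have "(z, int (k + i) - int (j + l), x) \<in> GA" using 1 2 by (intro arrowI) auto
  then show ?thesis by (simp add: 1(2) 2(2) algebra_simps)
qed

lemma arrow_T: "x \<in> S \<Longrightarrow> (x, int n, (T ^^ n) x) \<in> GA"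
  using arrowI[of x "(T ^^ n) x" n 0] Tn_in by simp

lemma G_simps [simp]:
  "gdom G (y, n, x) = (x, 0, x)" "grng G (y, n, x) = (y, 0, y)"
  "gmul G (y, n, x) (w, m, z) = (y, n + m, z)" "ginv G (y, n, x) = (x, - n, y)"
  by (auto simp: DR_groupoid_def)

lemma unit_space_eq: "unit_space G = {(x, 0, x) | x. x \<in> S}"
proof -
  have "unit_space G = (\<lambda>(y, n, x). (x, 0, x)) ` GA" by (simp add: unit_space_def DR_groupoid_def)
  moreover have "(x, 0, x) \<in> (\<lambda>(y, n, x). (x, 0, x)) ` GA" if "x \<in> S" for x
    using arrow_unit[OF that] by (intro image_eqI) auto
  ultimately show ?thesis by (auto simp: arrows_iff)
qed

lemma DR_basic_iff: "(y, n, x) \<in> DR_basic T U i j V \<longleftrightarrow>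
    y \<in> U \<and> x \<in> V \<and> n = int i - int j \<and> (T ^^ i) y = (T ^^ j) x"
  by (auto simp: DR_basic_def)

lemma topspace_G [simp]: "topspace \<G> = GA" by (simp add: arrows_def)

lemma basic_open: "openin X U \<Longrightarrow> openin X V \<Longrightarrow> openin \<G> (DR_basic T U i j V)"
  unfolding DR_groupoid_def by (auto intro!: topology_generated_by_Basis)

lemma basic_subset: "U \<subseteq> S \<Longrightarrow> V \<subseteq> S \<Longrightarrow> DR_basic T U i j V \<subseteq> GA"
  by (auto simp: DR_basic_def intro!: arrowI)

text \<open>Basic sets whose exponents have the same difference can be compared. Raising the
  exponents only enlarges the set. Lowering them from (i, j) to (k, l) means cancelling a power T^m,
  which is legitimate while T^k of the range point stays where T^m is injective.\<close>

lemma basic_shrink: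
  assumes yx: "y \<in> S" "x \<in> S" "(T ^^ i) y = (T ^^ j) x"
    and UV: "openin X U" "openin X V" "y \<in> U" "x \<in> V" "int i - int j = int k - int l"
    and kl: "(T ^^ k) y = (T ^^ l) x"
  shows "\<exists>U' V'. openin X U' \<and> openin X V' \<and> y \<in> U' \<and> x \<in> V' \<and>
    DR_basic T U' i j V' \<subseteq> DR_basic T U k l V"
proof (cases "i \<le> k")
  case True
  have "DR_basic T U i j V \<subseteq> DR_basic T U k l V"
    using True UV(5) by (auto simp: DR_basic_def intro: funpow_eq_mono[OF _ True UV(5)[symmetric]])
  then show ?thesis using UV by blast
next
  case False
  define m where "m = i - k"
  have m: "i = m + k" "j = m + l" using False UV(5) by (auto simp: m_def)
  obtain W where W: "openin X W" "(T ^^ k) y \<in> W" "inj_on (T ^^ m) W"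
    using Tn_locally_inj[OF Tn_in[OF yx(1)]] by blast
  let ?U = "U \<inter> {z \<in> S. (T ^^ k) z \<in> W}" and ?V = "V \<inter> {z \<in> S. (T ^^ l) z \<in> W}"
  have "DR_basic T ?U i j ?V \<subseteq> DR_basic T U k l V"
    using W(3) UV(5) by (auto simp: DR_basic_def m funpow_add dest: inj_onD)
  moreover have "openin X ?U" "openin X ?V" using UV W(1) Tn_preimage_open by auto
  moreover have "y \<in> ?U" "x \<in> ?V" using UV yx W(2) kl by auto
  ultimately show ?thesis by blast
qed

text \<open>The generating sets come with arbitrary exponents, and \<open>basic_shrink\<close>
  converts each of them to the pair at hand. Continuity on the groupoid thereby becomes a statement
  about the single equation T^i y = T^j x.\<close>

lemma nbhd_basis:
  assumes "openin \<G> W" "y \<in> S" "x \<in> S" "(T ^^ i) y = (T ^^ j) x" "(y, int i - int j, x) \<in> W"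
  obtains U V where "openin X U" "openin X V" "y \<in> U" "x \<in> V" "DR_basic T U i j V \<subseteq> W"
proof -
  have "generate_topology_on {DR_basic T U n m V | U n m V. openin X U \<and> openin X V} W"
    using assms(1) by (simp add: DR_groupoid_def openin_topology_generated_by_iff)
  then have "\<exists>U V. openin X U \<and> openin X V \<and> y \<in> U \<and> x \<in> V \<and> DR_basic T U i j V \<subseteq> W"
    using assms(5)
  proof induction
    case (Int a b)
    then obtain U V U' V' where "openin X U" "openin X V" "y \<in> U" "x \<in> V" "DR_basic T U i j V \<subseteq> a"
      "openin X U'" "openin X V'" "y \<in> U'" "x \<in> V'" "DR_basic T U' i j V' \<subseteq> b" by auto
    then show ?case
      by (intro exI[of _ "U \<inter> U'"] exI[of _ "V \<inter> V'"]) (auto simp: DR_basic_def)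
  next
    case (UN K)
    then show ?case by (meson UnionE Union_upper order_trans)
  next
    case (Basis s)
    then obtain U k l V where s: "s = DR_basic T U k l V" "openin X U" "openin X V" by blast
    have "y \<in> U" "x \<in> V" "int i - int j = int k - int l" "(T ^^ k) y = (T ^^ l) x"
      using Basis.prems by (auto simp: s(1) DR_basic_iff)
    then show ?case unfolding s(1) using basic_shrink[OF assms(2-4) s(2,3)] by blast
  qed simp
  then show thesis using that by blast
qed

lemma G_continuousD:
  fixes f :: "'a \<times> int \<times> 'a \<Rightarrow> 'c::metric_space"
  assumes "continuous_map \<G> euclidean f" "y \<in> S" "x \<in> S" "(T ^^ i) y = (T ^^ j) x" "0 < e"
  obtains U V where "openin X U" "openin X V" "y \<in> U" "x \<in> V"
    "\<And>y' x'. y' \<in> U \<Longrightarrow> x' \<in> V \<Longrightarrow> (T ^^ i) y' = (T ^^ j) x' \<Longrightarrow>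
      dist (f (y', int i - int j, x')) (f (y, int i - int j, x)) < e"
proof -
  have a: "(y, int i - int j, x) \<in> GA" by (rule arrowI[OF assms(2-4)])
  then obtain W where W: "openin \<G> W" "(y, int i - int j, x) \<in> W"
    "\<forall>z\<in>W. dist (f z) (f (y, int i - int j, x)) < e"
    using assms(1,5) unfolding continuous_map_euclidean_iff topspace_G by blast
  obtain U V where "openin X U" "openin X V" "y \<in> U" "x \<in> V" "DR_basic T U i j V \<subseteq> W"
    using nbhd_basis[OF W(1) assms(2-4) W(2)] by blast
  moreover have "(y', int i - int j, x') \<in> DR_basic T U i j V"
    if "y' \<in> U" "x' \<in> V" "(T ^^ i) y' = (T ^^ j) x'" for y' x'
    using that by (simp add: DR_basic_iff)
  ultimately show thesis using W(3) by (intro that[of U V]) auto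
qed

lemma G_continuousI:
  fixes f :: "'a \<times> int \<times> 'a \<Rightarrow> 'c::metric_space"
  assumes "\<And>y x n e. (y, n, x) \<in> GA \<Longrightarrow> 0 < e \<Longrightarrow> \<exists>i j U V. n = int i - int j \<and>
      (T ^^ i) y = (T ^^ j) x \<and> openin X U \<and> openin X V \<and> y \<in> U \<and> x \<in> V \<and>
    (\<forall>y'\<in>U. \<forall>x'\<in>V. (T ^^ i) y' = (T ^^ j) x' \<longrightarrow> dist (f (y', n, x')) (f (y, n, x)) < e)"
  shows "continuous_map \<G> euclidean f"
  unfolding continuous_map_euclidean_iff
proof (intro ballI allI impI)
  fix \<alpha> and e :: real assume \<alpha>: "\<alpha> \<in> topspace \<G>" and e: "0 < e"
  obtain y n x where a: "\<alpha> = (y, n, x)" by (metis prod_cases3)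
  then obtain i j U V where *: "n = int i - int j" "(T ^^ i) y = (T ^^ j) x" "openin X U" "openin X V"
    "y \<in> U" "x \<in> V"
    "\<forall>y'\<in>U. \<forall>x'\<in>V. (T ^^ i) y' = (T ^^ j) x' \<longrightarrow> dist (f (y', n, x')) (f (y, n, x)) < e"
    using assms[of y n x e] \<alpha> e by auto
  show "\<exists>U. openin \<G> U \<and> \<alpha> \<in> U \<and> (\<forall>z\<in>U. dist (f z) (f \<alpha>) < e)"
    using * basic_open[OF *(3,4), of i j]
    by (intro exI[of _ "DR_basic T U i j V"]) (auto simp: a DR_basic_iff DR_basic_def)
qed

lemma rng_cont: "continuous_map \<G> X fst" and dom_cont: "continuous_map \<G> X (snd \<circ> snd)"
proof -
  have "openin \<G> {\<alpha> \<in> GA. fst \<alpha> \<in> U}" "openin \<G> {\<alpha> \<in> GA. snd (snd \<alpha>) \<in> U}" if U: "openin X U" for U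
  proof -
    have "U \<subseteq> S" using U openin_subset by blast
    then have US: "z \<in> U \<Longrightarrow> z \<in> S" for z by blast
    have 1: "\<alpha> \<in> {\<alpha> \<in> GA. fst \<alpha> \<in> U} \<longleftrightarrow> \<alpha> \<in> (\<Union>i j. DR_basic T U i j S)"
      and 2: "\<alpha> \<in> {\<alpha> \<in> GA. snd (snd \<alpha>) \<in> U} \<longleftrightarrow> \<alpha> \<in> (\<Union>i j. DR_basic T S i j U)" for \<alpha>
    proof -
      obtain y n x where a: "\<alpha> = (y, n, x)" by (metis prod_cases3)
      show "\<alpha> \<in> {\<alpha> \<in> GA. fst \<alpha> \<in> U} \<longleftrightarrow> \<alpha> \<in> (\<Union>i j. DR_basic T U i j S)"
        using US[of y] by (auto simp: a DR_basic_iff arrows_iff)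
      show "\<alpha> \<in> {\<alpha> \<in> GA. snd (snd \<alpha>) \<in> U} \<longleftrightarrow> \<alpha> \<in> (\<Union>i j. DR_basic T S i j U)"
        using US[of x] by (auto simp: a DR_basic_iff arrows_iff)
    qed
    have "{\<alpha> \<in> GA. fst \<alpha> \<in> U} = (\<Union>i j. DR_basic T U i j S)" by (intro Set.set_eqI 1)
    moreover have "{\<alpha> \<in> GA. snd (snd \<alpha>) \<in> U} = (\<Union>i j. DR_basic T S i j U)" by (intro Set.set_eqI 2)
    moreover have "openin \<G> (\<Union>i j. DR_basic T U i j S)" "openin \<G> (\<Union>i j. DR_basic T S i j U)"
      using U by (auto intro!: openin_Union basic_open)
    ultimately show "openin \<G> {\<alpha> \<in> GA. fst \<alpha> \<in> U}" "openin \<G> {\<alpha> \<in> GA. snd (snd \<alpha>) \<in> U}" by simp_all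
  qed
  then show "continuous_map \<G> X fst" "continuous_map \<G> X (snd \<circ> snd)"
    by (auto simp: continuous_map_def arrows_iff)
qed

lemma cocycle_level_open: "openin \<G> {\<alpha> \<in> GA. P (DR_cocycle \<alpha>)}"
proof -
  have "\<alpha> \<in> {\<alpha> \<in> GA. P (DR_cocycle \<alpha>)} \<longleftrightarrow> \<alpha> \<in> (\<Union>{DR_basic T S i j S | i j. P (int i - int j)})" for \<alpha>
  proof (cases \<alpha>)
    case (fields y n x)
    have "\<alpha> \<in> (\<Union>{DR_basic T S i j S | i j. P (int i - int j)}) \<longleftrightarrow>
        (\<exists>i j. P (int i - int j) \<and> \<alpha> \<in> DR_basic T S i j S)" by blast
    then show ?thesis by (auto simp: fields DR_basic_iff arrows_iff DR_cocycle_def)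
  qed
  then have "{\<alpha> \<in> GA. P (DR_cocycle \<alpha>)} = (\<Union>{DR_basic T S i j S | i j. P (int i - int j)})" by blast
  moreover have "openin \<G> \<dots>" using basic_open by (intro openin_Union) auto
  ultimately show ?thesis by simp
qed

lemma H_iff: "(y, n, x) \<in> H \<longleftrightarrow> (y, n, x) \<in> GA \<and> n = 0"
  by (auto simp: DR_kernel_def DR_cocycle_def)

lemma H_subset: "H \<subseteq> GA" by (auto simp: DR_kernel_def)

lemma openin_H: "openin \<G> H"
  unfolding DR_kernel_def by (rule cocycle_level_open)

lemma closedin_H: "closedin \<G> H"
proof -
  have "GA - H = {\<alpha> \<in> GA. DR_cocycle \<alpha> \<noteq> 0}" by (auto simp: DR_kernel_def)
  then show ?thesis using cocycle_level_open[of "\<lambda>n. n \<noteq> 0"] H_subset by (simp add: closedin_def)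
qed

section \<open>Compact open sets of arrows and compactly supported functions\<close>

definition "Z i j = DR_basic T S i j S"

lemma Z_iff: "(y, n, x) \<in> Z i j \<longleftrightarrow> y \<in> S \<and> x \<in> S \<and> n = int i - int j \<and> (T ^^ i) y = (T ^^ j) x"
  by (auto simp: Z_def DR_basic_iff)

lemma openin_Z: "openin \<G> (Z i j)" unfolding Z_def by (intro basic_open) auto

lemma Z_subset: "Z i j \<subseteq> GA" unfolding Z_def by (intro basic_subset) auto

lemma closedin_Z: "closedin \<G> (Z i j)"
proof -
  have "Z i j = {\<alpha> \<in> topspace \<G>. (T ^^ i) (fst \<alpha>) = (T ^^ j) ((snd \<circ> snd) \<alpha>)} \<inter>
      (topspace \<G> - {\<alpha> \<in> GA. DR_cocycle \<alpha> \<noteq> int i - int j})"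
    using Z_subset by (auto simp: Z_iff DR_cocycle_def arrows_iff)
  moreover have "closedin \<G> {\<alpha> \<in> topspace \<G>. (T ^^ i) (fst \<alpha>) = (T ^^ j) ((snd \<circ> snd) \<alpha>)}"
    by (rule closedin_continuous_maps_eq[OF Hausdorff_X])
      (use continuous_map_compose[OF rng_cont Tn_cont] continuous_map_compose[OF dom_cont Tn_cont]
        in \<open>auto simp: o_def\<close>)
  moreover have "closedin \<G> (topspace \<G> - {\<alpha> \<in> GA. DR_cocycle \<alpha> \<noteq> int i - int j})"
    by (intro closedin_diff closedin_topspace cocycle_level_open)
  ultimately show ?thesis by (simp only: closedin_Int)
qed

text \<open>The pairs with T^i y = T^j x form a closed subset of the compact square of X. Inserting
  the constant middle entry is continuous by \<open>nbhd_basis\<close>, used with these very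
  exponents.\<close>

lemma compactin_Z: "compactin \<G> (Z i j)"
proof -
  let ?R = "{p \<in> topspace (prod_topology X X). (T ^^ i) (fst p) = (T ^^ j) (snd p)}"
  let ?P = "subtopology (prod_topology X X) ?R"
  have "closedin (prod_topology X X) ?R"
    by (rule closedin_continuous_maps_eq[OF Hausdorff_X])
      (use continuous_map_compose[OF continuous_map_fst Tn_cont] continuous_map_compose[OF continuous_map_snd Tn_cont]
        in \<open>auto simp: o_def\<close>)
  then have "compactin (prod_topology X X) ?R"
    by (intro closedin_compact_space) (auto simp: compact_space_prod_topology compact_X)
  then have c: "compactin ?P ?R" by (simp add: compactin_subtopology)
  let ?f = "\<lambda>p. (fst p, int i - int j, snd p)"
  have "continuous_map ?P \<G> ?f"
    unfolding continuous_map_def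
  proof (intro conjI allI impI)
    show "?f \<in> topspace ?P \<rightarrow> topspace \<G>" by (auto intro!: arrowI)
    fix W assume W: "openin \<G> W"
    show "openin ?P {p \<in> topspace ?P. ?f p \<in> W}"
    proof (subst openin_subopen, intro ballI)
      fix p assume p: "p \<in> {p \<in> topspace ?P. ?f p \<in> W}"
      obtain y x where yx: "p = (y, x)" by fastforce
      obtain U V where *: "openin X U" "openin X V" "y \<in> U" "x \<in> V" "DR_basic T U i j V \<subseteq> W"
        using nbhd_basis[OF W, of y x i j] p yx by auto
      have "openin ?P (?R \<inter> U \<times> V)"
        using *(1,2) by (subst Int_commute) (auto simp: openin_prod_Times_iff intro: openin_subtopology_Int)
      moreover have "?R \<inter> U \<times> V \<subseteq> {p \<in> topspace ?P. ?f p \<in> W}"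
        using *(5) by (auto simp: DR_basic_def)
      ultimately show "\<exists>N. openin ?P N \<and> p \<in> N \<and> N \<subseteq> {p \<in> topspace ?P. ?f p \<in> W}"
        using p yx *(3,4) by (intro exI[of _ "?R \<inter> U \<times> V"]) auto
    qed
  qed
  then have "compactin \<G> (?f ` ?R)" using c image_compactin by blast
  moreover have "?f ` ?R = Z i j" by (force simp: Z_iff)
  ultimately show ?thesis by simp
qed

text \<open>An increasing exhaustion by compact open sets in which the exponent of the source is
  always N. Cocycle values between -N and N then need range exponents up to 2 N. A single number
  controls every compact support.\<close>

definition "K N = (\<Union>i\<le>2 * N. Z i N)"

lemma K_iff: "(y, n, x) \<in> K N \<longleftrightarrow>
    y \<in> S \<and> x \<in> S \<and> \<bar>n\<bar> \<le> int N \<and> (T ^^ nat (int N + n)) y = (T ^^ N) x"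
proof
  assume "(y, n, x) \<in> K N"
  then show "y \<in> S \<and> x \<in> S \<and> \<bar>n\<bar> \<le> int N \<and> (T ^^ nat (int N + n)) y = (T ^^ N) x"
    by (auto simp: K_def Z_iff)
next
  assume *: "y \<in> S \<and> x \<in> S \<and> \<bar>n\<bar> \<le> int N \<and> (T ^^ nat (int N + n)) y = (T ^^ N) x"
  then show "(y, n, x) \<in> K N" unfolding K_def by (intro UN_I[of "nat (int N + n)"]) (auto simp: Z_iff)
qed

lemma openin_K: "openin \<G> (K N)" and closedin_K: "closedin \<G> (K N)" and compactin_K: "compactin \<G> (K N)"
  and K_subset: "K N \<subseteq> GA"
proof -
  show "openin \<G> (K N)" "closedin \<G> (K N)" "compactin \<G> (K N)"
    unfolding K_def using openin_Z closedin_Z compactin_Z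
    by (auto intro!: closedin_Union compactin_Union)
  show "K N \<subseteq> GA" unfolding K_def using Z_subset by blast
qed

lemma K_mono: "N \<le> N' \<Longrightarrow> K N \<subseteq> K N'"
  by (auto simp: K_iff elim!: funpow_eq_mono)

lemma Z_subset_K: "i \<le> N \<Longrightarrow> j \<le> N \<Longrightarrow> Z i j \<subseteq> K N"
  by (auto simp: K_iff Z_iff elim!: funpow_eq_mono)

lemma GA_eq_UN_K: "GA = (\<Union>N. K N)"
proof
  show "GA \<subseteq> (\<Union>N. K N)"
  proof clarify
    fix y n x assume "(y, n, x) \<in> GA"
    then obtain i j where "(y, n, x) \<in> Z i j" by (auto simp: arrows_iff Z_iff)
    then show "(y, n, x) \<in> (\<Union>N. K N)" using Z_subset_K[of i "max i j" j] by auto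
  qed
qed (use K_subset in blast)

lemma compactin_subset_K:
  assumes "compactin \<G> C" obtains N where "C \<subseteq> K N"
proof -
  have C: "C \<subseteq> GA" using assms compactin_subset_topspace by fastforce
  obtain F where F: "finite F" "F \<subseteq> range K" "C \<subseteq> \<Union>F"
    using assms C GA_eq_UN_K unfolding compactin_def
    by (metis (no_types, lifting) imageE openin_K)
  then obtain I where I: "finite I" "F = K ` I" by (meson finite_subset_image subset_image_iff)
  have "K i \<subseteq> K (Max (insert 0 I))" if "i \<in> I" for i
    using that I(1) by (intro K_mono Max_ge) auto
  then have "C \<subseteq> K (Max (insert 0 I))" using F(3) I(2) by blast
  then show thesis using that by blast
qed

lemma CcI:
  assumes "continuous_map \<G> euclidean f" "\<And>\<alpha>. f \<alpha> \<noteq> 0 \<Longrightarrow> \<alpha> \<in> K N"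
  shows "f \<in> Cc \<G>"
proof (rule Cc_memI[OF assms(1) _ compactin_K closedin_K])
  show "f \<alpha> = 0" if "\<alpha> \<notin> topspace \<G>" for \<alpha> using that assms(2)[of \<alpha>] K_subset[of N] topspace_G by blast
qed (rule assms(2))

lemma CcD:
  assumes "f \<in> Cc \<G>"
  shows "continuous_map \<G> euclidean f" "\<exists>N. \<forall>\<alpha>. f \<alpha> \<noteq> 0 \<longrightarrow> \<alpha> \<in> K N" "\<exists>C\<ge>0. \<forall>\<alpha>. cmod (f \<alpha>) \<le> C"
proof -
  show c: "continuous_map \<G> euclidean f" using assms by (simp add: Cc_def)
  let ?s = "\<G> closure_of {x \<in> topspace \<G>. f x \<noteq> 0}"
  obtain N where "?s \<subseteq> K N" using assms compactin_subset_K unfolding Cc_def by blast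
  moreover have "{x \<in> topspace \<G>. f x \<noteq> 0} \<subseteq> ?s" by (intro closure_of_subset) auto
  moreover have "f \<alpha> = 0" if "\<alpha> \<notin> topspace \<G>" for \<alpha> using that assms unfolding Cc_def by blast
  ultimately have N: "\<forall>\<alpha>. f \<alpha> \<noteq> 0 \<longrightarrow> \<alpha> \<in> K N" by blast
  then show "\<exists>N. \<forall>\<alpha>. f \<alpha> \<noteq> 0 \<longrightarrow> \<alpha> \<in> K N" by blast
  have "compactin euclidean (f ` K N)" using image_compactin[OF compactin_K c] .
  then have "bounded (f ` K N)" by (simp add: compact_imp_bounded)
  then obtain C where C: "\<forall>\<alpha>\<in>K N. cmod (f \<alpha>) \<le> C" by (auto simp: bounded_iff)
  have "cmod (f \<alpha>) \<le> max C 0" for \<alpha>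
  proof (cases "f \<alpha> = 0")
    case False
    then have "cmod (f \<alpha>) \<le> C" using C N by blast
    then show ?thesis by (rule max.coboundedI1)
  qed simp
  then show "\<exists>C\<ge>0. \<forall>\<alpha>. cmod (f \<alpha>) \<le> C" by (intro exI[of _ "max C 0"]) auto
qed

text \<open>\<open>H\<close> is both open and closed: openness and closedness make extension by zero
  continuous, and closedness makes a compact set of arrows meet \<open>H\<close> in a compact
  set.\<close>

lemma Cc_H_iff: "f \<in> Cc (subtopology \<G> H) \<longleftrightarrow> f \<in> Cc \<G> \<and> (\<forall>\<alpha>. f \<alpha> \<noteq> 0 \<longrightarrow> \<alpha> \<in> H)"
proof
  assume f: "f \<in> Cc (subtopology \<G> H)"
  have tH: "topspace (subtopology \<G> H) = H" using H_subset by auto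
  have fH: "f \<alpha> = 0" if "\<alpha> \<notin> H" for \<alpha>
    using f that unfolding Cc_def tH by blast
  have fc: "continuous_map (subtopology \<G> H) euclidean f" using f unfolding Cc_def by simp
  let ?s = "(subtopology \<G> H) closure_of {x \<in> topspace (subtopology \<G> H). f x \<noteq> 0}"
  have "compactin \<G> ?s" using f unfolding Cc_def compactin_subtopology by simp
  then obtain N where "?s \<subseteq> K N" using compactin_subset_K by blast
  moreover have "{x \<in> topspace (subtopology \<G> H). f x \<noteq> 0} \<subseteq> ?s" by (intro closure_of_subset) auto
  ultimately have N: "f \<alpha> \<noteq> 0 \<Longrightarrow> \<alpha> \<in> K N" for \<alpha> using fH[of \<alpha>] unfolding tH by blast
  have "continuous_map \<G> euclidean f"
    unfolding continuous_map_euclidean_iff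
  proof (intro ballI allI impI)
    fix \<alpha> and e :: real assume a: "\<alpha> \<in> topspace \<G>" and e: "0 < e"
    show "\<exists>U. openin \<G> U \<and> \<alpha> \<in> U \<and> (\<forall>z\<in>U. dist (f z) (f \<alpha>) < e)"
    proof (cases "\<alpha> \<in> H")
      case True
      then obtain U where "openin (subtopology \<G> H) U" "\<alpha> \<in> U" "\<forall>z\<in>U. dist (f z) (f \<alpha>) < e"
        using fc e unfolding continuous_map_euclidean_iff tH by blast
      then show ?thesis using openin_H openin_trans_full by blast
    next
      case False
      have "openin \<G> (topspace \<G> - H)" using closedin_H by (simp add: closedin_def)
      then show ?thesis using False a e fH by (intro exI[of _ "topspace \<G> - H"]) auto
    qed
  qed
  then show "f \<in> Cc \<G> \<and> (\<forall>\<alpha>. f \<alpha> \<noteq> 0 \<longrightarrow> \<alpha> \<in> H)" using N fH CcI by blast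
next
  assume f: "f \<in> Cc \<G> \<and> (\<forall>\<alpha>. f \<alpha> \<noteq> 0 \<longrightarrow> \<alpha> \<in> H)"
  then obtain N where N: "\<forall>\<alpha>. f \<alpha> \<noteq> 0 \<longrightarrow> \<alpha> \<in> K N" using CcD(2) by blast
  show "f \<in> Cc (subtopology \<G> H)"
  proof (rule Cc_memI[of _ _ "K N \<inter> H"])
    show "continuous_map (subtopology \<G> H) euclidean f"
      using f CcD(1) continuous_map_from_subtopology by blast
    have "compactin \<G> (K N \<inter> H)" by (intro compact_Int_closedin compactin_K closedin_H)
    then show "compactin (subtopology \<G> H) (K N \<inter> H)" by (simp add: compactin_subtopology)
    show "closedin (subtopology \<G> H) (K N \<inter> H)"
      using closedin_K by (metis closedin_subtopology)
    have tH: "topspace (subtopology \<G> H) = H" using H_subset by auto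
    show "f \<alpha> = 0" if "\<alpha> \<notin> topspace (subtopology \<G> H)" for \<alpha> using that f unfolding tH by blast
    show "\<alpha> \<in> K N \<inter> H" if "\<alpha> \<in> topspace (subtopology \<G> H)" "f \<alpha> \<noteq> 0" for \<alpha>
      using that N unfolding tH by blast
  qed
qed

section \<open>Finite fibres and local sections of the powers of T\<close>

text \<open>X has a finite cover by open sets on which T^n is injective, and each of them contains
  at most one point of any fibre. The uniformity in \<open>v\<close> is what makes convolution
  operators bounded.\<close>

lemma fibre_bound: "\<exists>M. \<forall>v. finite {w \<in> S. (T ^^ n) w = v} \<and> card {w \<in> S. (T ^^ n) w = v} \<le> M"
proof -
  let ?W = "{W. openin X W \<and> inj_on (T ^^ n) W}"
  have "S \<subseteq> \<Union>?W" using Tn_locally_inj by blast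
  then obtain F where F: "finite F" "F \<subseteq> ?W" "S \<subseteq> \<Union>F"
    using compact_X unfolding compact_space_alt by (metis (no_types, lifting) mem_Collect_eq)
  have "finite {w \<in> S. (T ^^ n) w = v} \<and> card {w \<in> S. (T ^^ n) w = v} \<le> card F" for v
  proof -
    have 1: "W \<inter> {w. (T ^^ n) w = v} \<subseteq> {THE w. w \<in> W \<and> (T ^^ n) w = v}" if "W \<in> F" for W
    proof
      fix w assume w: "w \<in> W \<inter> {w. (T ^^ n) w = v}"
      then have "(THE w. w \<in> W \<and> (T ^^ n) w = v) = w"
        using that F(2) by (intro the_equality) (auto dest: inj_onD)
      then show "w \<in> {THE w. w \<in> W \<and> (T ^^ n) w = v}" by simp
    qed
    have s: "{w \<in> S. (T ^^ n) w = v} \<subseteq> (\<lambda>W. THE w. w \<in> W \<and> (T ^^ n) w = v) ` F"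
    proof
      fix w assume w: "w \<in> {w \<in> S. (T ^^ n) w = v}"
      then obtain W where "W \<in> F" "w \<in> W" using F(3) by blast
      then show "w \<in> (\<lambda>W. THE w. w \<in> W \<and> (T ^^ n) w = v) ` F" using 1[of W] w by blast
    qed
    have "card {w \<in> S. (T ^^ n) w = v} \<le> card ((\<lambda>W. THE w. w \<in> W \<and> (T ^^ n) w = v) ` F)"
      using F(1) s by (intro card_mono) auto
    also have "\<dots> \<le> card F" using F(1) by (rule card_image_le)
    finally show ?thesis using finite_subset[OF s] F(1) by auto
  qed
  then show ?thesis by blast
qed

lemma finite_fibre: "finite {w \<in> S. (T ^^ n) w = v}" using fibre_bound by blast

text \<open>T^n is open, closed and locally injective with finite fibres, hence an evenly covered
  map near \<open>v0\<close>. Placing the sheets inside prescribed neighbourhoods \<open>Q w\<close>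
  turns sums over nearby fibres into sums over one fixed index set.\<close>

lemma fibre_sections:
  assumes v0: "v0 \<in> S" and Q: "\<And>w. w \<in> S \<Longrightarrow> (T ^^ n) w = v0 \<Longrightarrow> openin X (Q w) \<and> w \<in> Q w"
  obtains V where "openin X V" "v0 \<in> V"
    "\<And>v. v \<in> V \<Longrightarrow> \<exists>s. bij_betw s {w \<in> S. (T ^^ n) w = v0} {w \<in> S. (T ^^ n) w = v} \<and>
      (\<forall>w\<in>{w \<in> S. (T ^^ n) w = v0}. s w \<in> Q w)"
proof -
  let ?F = "{w \<in> S. (T ^^ n) w = v0}"
  have "\<exists>A B. openin X A \<and> openin X B \<and> w \<in> A \<and> w' \<in> B \<and> disjnt A B" if "w \<in> S" "w' \<in> S" "w \<noteq> w'" for w w'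
    using Hausdorff_X that unfolding Hausdorff_space_def by blast
  then obtain A B where AB: "\<And>w w'. w \<in> S \<Longrightarrow> w' \<in> S \<Longrightarrow> w \<noteq> w' \<Longrightarrow>
    openin X (A w w') \<and> openin X (B w w') \<and> w \<in> A w w' \<and> w' \<in> B w w' \<and> disjnt (A w w') (B w w')" by metis
  have "\<exists>W. openin X W \<and> w \<in> W \<and> inj_on (T ^^ n) W" if "w \<in> S" for w
    using Tn_locally_inj[OF that] by blast
  then obtain W where W: "\<And>w. w \<in> S \<Longrightarrow> openin X (W w) \<and> w \<in> W w \<and> inj_on (T ^^ n) (W w)" by metis
  \<comment> \<open>The sheets: pairwise disjoint by Hausdorff separation, and small enough for T^n
    to be injective on each. Intersecting with \<open>S\<close> handles a one-point fibre, where the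
    family of separating sets is empty.\<close>
  define P where "P w = Q w \<inter> W w \<inter> ((\<Inter>w'\<in>?F - {w}. A w w' \<inter> B w' w) \<inter> S)" for w
  have P: "openin X (P w)" "w \<in> P w" if "w \<in> ?F" for w
  proof -
    have "openin X ((\<Inter>w'\<in>?F - {w}. A w w' \<inter> B w' w) \<inter> S)"
      using AB that finite_fibre[of n v0] by (intro openin_INT) auto
    then show "openin X (P w)" using Q W that unfolding P_def by auto
    show "w \<in> P w" using Q W that AB unfolding P_def by auto
  qed
  have Pd: "P w \<inter> P w' = {}" if "w \<in> ?F" "w' \<in> ?F" "w \<noteq> w'" for w w'
  proof -
    have "P w \<subseteq> A w w'" "P w' \<subseteq> B w w'" using that unfolding P_def by auto
    then show ?thesis using AB[of w w'] that by (auto simp: disjnt_def)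
  qed
  \<comment> \<open>The first factor excludes values having a preimage outside the sheets and is
    open because T^n is a closed map; the second keeps only values attained on every sheet.\<close>
  define V where "V = (S - (T ^^ n) ` (S - (\<Union>w\<in>?F. P w))) \<inter> ((\<Inter>w\<in>?F. (T ^^ n) ` P w) \<inter> S)"
  show thesis
  proof (rule that[of V])
    have "closed_map X X (T ^^ n)"
      by (rule T1_Spaces.continuous_imp_closed_map[OF Tn_cont compact_X Hausdorff_X])
    moreover have "closedin X (S - (\<Union>w\<in>?F. P w))" using P(1) by (intro closedin_diff openin_Union) auto
    ultimately have 1: "openin X (S - (T ^^ n) ` (S - (\<Union>w\<in>?F. P w)))"
      unfolding closed_map_def by blast
    have 2: "openin X ((\<Inter>w\<in>?F. (T ^^ n) ` P w) \<inter> S)"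
      by (intro openin_INT finite_fibre Tn_open P(1))
    show "openin X V" unfolding V_def using 1 2 by auto
    show "v0 \<in> V" unfolding V_def using v0 P(2) by auto
    fix v assume v: "v \<in> V"
    have "\<exists>z. z \<in> P w \<and> (T ^^ n) z = v" if "w \<in> ?F" for w using v that unfolding V_def by auto
    then obtain s where s: "\<And>w. w \<in> ?F \<Longrightarrow> s w \<in> P w \<and> (T ^^ n) (s w) = v" by metis
    have PS: "P w \<subseteq> S" "P w \<subseteq> Q w" "P w \<subseteq> W w" for w by (auto simp: P_def)
    have "bij_betw s ?F {w \<in> S. (T ^^ n) w = v}"
      unfolding bij_betw_def
    proof
      show "inj_on s ?F" using s Pd by (metis (no_types, lifting) disjoint_iff inj_onI)
      show "s ` ?F = {w \<in> S. (T ^^ n) w = v}"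
      proof
        show "s ` ?F \<subseteq> {w \<in> S. (T ^^ n) w = v}" using s PS(1) by blast
        show "{w \<in> S. (T ^^ n) w = v} \<subseteq> s ` ?F"
        proof
          fix z assume z: "z \<in> {w \<in> S. (T ^^ n) w = v}"
          then obtain w where w: "w \<in> ?F" "z \<in> P w" using v unfolding V_def by blast
          have "inj_on (T ^^ n) (W w)" using W w(1) by blast
          moreover have "z \<in> W w" "s w \<in> W w" using w s PS(3) by blast+
          moreover have "(T ^^ n) z = (T ^^ n) (s w)" using z s[OF w(1)] by simp
          ultimately have "z = s w" by (meson inj_onD)
          then show "z \<in> s ` ?F" using w(1) by blast
        qed
      qed
    qed
    then show "\<exists>s. bij_betw s ?F {w \<in> S. (T ^^ n) w = v} \<and> (\<forall>w\<in>?F. s w \<in> Q w)"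
      using s PS(2) by blast
  qed
qed

end

subsection \<open>The reduced algebra in terms of matrix coefficients\<close>

lemma complex_mult_close:
  fixes a b :: complex
  assumes "0 < e"
  obtains d where "0 < d" "\<And>a' b'. dist a' a < d \<Longrightarrow> dist b' b < d \<Longrightarrow> dist (a' * b') (a * b) < e"
proof -
  have "((\<lambda>p. fst p * snd p) \<longlongrightarrow> a * b) (at (a, b))"
    by (rule tendsto_eq_intros tendsto_ident_at refl | simp)+
  then have "isCont (\<lambda>p. fst p * snd p) (a, b)" by (simp add: isCont_def)
  then obtain d where d: "0 < d" "\<And>p. dist p (a, b) < d \<Longrightarrow> dist (fst p * snd p) (a * b) < e"
    using assms unfolding continuous_at_eps_delta by (metis fst_conv snd_conv)
  show thesis
  proof (rule that[of "d / 2"])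
    fix a' b' assume "dist a' a < d / 2" "dist b' b < d / 2"
    moreover have "dist (a', b') (a, b) \<le> dist a' a + dist b' b"
      by (simp add: dist_Pair_Pair sqrt_sum_squares_le_sum)
    ultimately show "dist (a' * b') (a * b) < e" using d(2)[of "(a', b')"] by simp
  qed (use d in simp)
qed

lemma norm_ell2_delta [simp]: "norm (ell2_delta i) = 1"
proof -
  have "complex_of_real ((norm (ell2_delta i))\<^sup>2) = 1"
    unfolding ell2_cinner_norm[symmetric] ell2_cinner_delta by (simp add: ell2_delta.rep_eq)
  then have "(norm (ell2_delta i))\<^sup>2 = 1" using of_real_eq_1_iff by blast
  then have "norm (ell2_delta i) = 1 \<or> norm (ell2_delta i) = - 1" by (simp add: power2_eq_1_iff)
  then show ?thesis using norm_ge_zero[of "ell2_delta i"] by linarith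
qed

context compact_DR_system
begin

section \<open>Boundedness of convolution operators\<close>

text \<open>The possibly nonzero coefficients f (y, k, w) of a function supported in
  \<open>K N\<close>: \<open>Krow\<close> lists them for a given range, \<open>Kcol\<close> for a
  given source.\<close>

definition "Krow N y = {(k, w). (y, k, w) \<in> K N}"
definition "Kcol N w = {(k, y). (y, k, w) \<in> K N}"

lemma Krow_eq: "Krow N y = (\<Union>i\<le>2 * N. (\<lambda>w. (int i - int N, w)) ` {w \<in> S. (T ^^ N) w = (T ^^ i) y \<and> y \<in> S})"
  by (force simp: Krow_def K_def Z_iff)

lemma Kcol_eq: "Kcol N w = (\<Union>i\<le>2 * N. (\<lambda>y. (int i - int N, y)) ` {y \<in> S. (T ^^ i) y = (T ^^ N) w \<and> w \<in> S})"
  by (force simp: Kcol_def K_def Z_iff)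

lemma Krow_Kcol_bound: "\<exists>M. \<forall>y. finite (Krow N y) \<and> finite (Kcol N y) \<and> card (Krow N y) \<le> M \<and> card (Kcol N y) \<le> M"
proof -
  have "\<forall>n. \<exists>M. \<forall>v. finite {w \<in> S. (T ^^ n) w = v} \<and> card {w \<in> S. (T ^^ n) w = v} \<le> M"
    using fibre_bound by blast
  then obtain m where m: "\<And>n v. finite {w \<in> S. (T ^^ n) w = v}" "\<And>n v. card {w \<in> S. (T ^^ n) w = v} \<le> m n"
    by metis
  have fin: "finite {w \<in> S. (T ^^ n) w = v \<and> P}" and crd: "card {w \<in> S. (T ^^ n) w = v \<and> P} \<le> m n" for n v P
  proof -
    have sub: "{w \<in> S. (T ^^ n) w = v \<and> P} \<subseteq> {w \<in> S. (T ^^ n) w = v}" by blast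
    show "finite {w \<in> S. (T ^^ n) w = v \<and> P}" by (rule finite_subset[OF sub m(1)])
    show "card {w \<in> S. (T ^^ n) w = v \<and> P} \<le> m n"
      using card_mono[OF m(1) sub] m(2)[of n v] by linarith
  qed
  let ?M = "(\<Sum>i\<le>2 * N. m N) + (\<Sum>i\<le>2 * N. m i)"
  have "finite (Krow N y) \<and> finite (Kcol N y) \<and> card (Krow N y) \<le> ?M \<and> card (Kcol N y) \<le> ?M" for y
  proof (intro conjI)
    show "finite (Krow N y)" unfolding Krow_eq using fin by blast
    show "finite (Kcol N y)" unfolding Kcol_eq using fin by blast
    have "card (Krow N y) \<le> (\<Sum>i\<le>2 * N. card ((\<lambda>w. (int i - int N, w)) ` {w \<in> S. (T ^^ N) w = (T ^^ i) y \<and> y \<in> S}))"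
      unfolding Krow_eq by (rule card_UN_le) simp
    also have "\<dots> \<le> (\<Sum>i\<le>2 * N. m N)"
      by (intro sum_mono order.trans[OF card_image_le crd] fin)
    finally show "card (Krow N y) \<le> ?M" by simp
    have "card (Kcol N y) \<le> (\<Sum>i\<le>2 * N. card ((\<lambda>w. (int i - int N, w)) ` {w \<in> S. (T ^^ i) w = (T ^^ N) y \<and> y \<in> S}))"
      unfolding Kcol_eq by (rule card_UN_le) simp
    also have "\<dots> \<le> (\<Sum>i\<le>2 * N. m i)"
      by (intro sum_mono order.trans[OF card_image_le crd] fin)
    finally show "card (Kcol N y) \<le> ?M" by simp
  qed
  then show ?thesis by blast
qed

lemma finite_Krow: "finite (Krow N y)" using Krow_Kcol_bound by blast

text \<open>The infinite sum over a range fibre collapses to the finite index set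
  \<open>Krow N y\<close>; the later computations with convolutions use this form.\<close>

lemma convolution_eq:
  assumes f: "\<And>\<alpha>. f \<alpha> \<noteq> 0 \<Longrightarrow> \<alpha> \<in> K N" and a: "(y, n, x) \<in> GA"
  shows "convolution G f \<xi> (y, n, x) = (\<Sum>(k, w)\<in>Krow N y. f (y, k, w) * \<xi> (w, n - k, x))"
proof -
  let ?h = "\<lambda>(k, w). (y, k, w)"
  let ?g = "\<lambda>\<beta>. f \<beta> * \<xi> (gmul G (ginv G \<beta>) (y, n, x))"
  have "convolution G f \<xi> (y, n, x) = infsum ?g {\<beta> \<in> GA. grng G \<beta> = grng G (y, n, x)}"
    using a by (simp add: convolution_def)
  also have "\<dots> = infsum ?g (?h ` Krow N y)"
  proof (rule infsum_cong_neutral)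
    fix \<beta> assume b: "\<beta> \<in> {\<beta> \<in> GA. grng G \<beta> = grng G (y, n, x)} - ?h ` Krow N y"
    obtain y' k w where \<beta>: "\<beta> = (y', k, w)" by (metis prod_cases3)
    have "y' = y" using b by (simp add: \<beta>)
    have "\<beta> \<notin> K N"
    proof
      assume "\<beta> \<in> K N"
      then have "(k, w) \<in> Krow N y" using \<open>y' = y\<close> by (simp add: Krow_def \<beta>)
      then have "?h (k, w) \<in> ?h ` Krow N y" by (rule imageI)
      then show False using b \<open>y' = y\<close> by (simp add: \<beta>)
    qed
    then show "?g \<beta> = 0" using f by fastforce
  next
    fix \<beta> assume b: "\<beta> \<in> ?h ` Krow N y - {\<beta> \<in> GA. grng G \<beta> = grng G (y, n, x)}"
    then obtain k w where \<beta>: "\<beta> = (y, k, w)" "(y, k, w) \<in> K N" by (auto simp: Krow_def)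
    then have False using b K_subset[of N] by (auto simp: subset_iff)
    then show "?g \<beta> = 0" ..
  qed simp
  also have "\<dots> = infsum (?g \<circ> ?h) (Krow N y)" by (rule infsum_reindex) (auto simp: inj_on_def)
  also have "\<dots> = (\<Sum>(k, w)\<in>Krow N y. f (y, k, w) * \<xi> (w, n - k, x))"
    using finite_Krow by (auto intro!: sum.cong)
  finally show ?thesis .
qed

lemma convolution_outside: "\<alpha> \<notin> GA \<Longrightarrow> convolution G f \<xi> \<alpha> = 0"
  by (simp add: convolution_def)

text \<open>Schur's test: the supports meet every row and every column in boundedly many points.\<close>

lemma convolution_bounded:
  assumes f: "\<And>\<alpha>. f \<alpha> \<noteq> 0 \<Longrightarrow> \<alpha> \<in> K N" and C: "\<And>\<alpha>. cmod (f \<alpha>) \<le> C" "0 \<le> C"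
  shows "\<exists>B\<ge>0. \<forall>\<xi>. \<exists>\<eta>. ell2_coord \<eta> = convolution G f (ell2_coord \<xi>) \<and> norm \<eta> \<le> B * norm \<xi>"
proof -
  obtain M where M: "\<And>y. finite (Krow N y)" "\<And>y. finite (Kcol N y)"
    "\<And>y. card (Krow N y) \<le> M" "\<And>y. card (Kcol N y) \<le> M" using Krow_Kcol_bound[of N] by blast
  have "\<exists>\<eta>. ell2_coord \<eta> = convolution G f (ell2_coord \<xi>) \<and> norm \<eta> \<le> real M * C * norm \<xi>" for \<xi>
  proof -
    let ?\<xi> = "ell2_coord \<xi>"
    let ?g = "\<lambda>\<gamma>. (cmod (?\<xi> \<gamma>))\<^sup>2"
    have row: "(cmod (convolution G f ?\<xi> (y, n, x)))\<^sup>2 \<le>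
        real M * C\<^sup>2 * (\<Sum>p\<in>Krow N y. ?g (snd p, n - fst p, x))" if "(y, n, x) \<in> GA" for y n x
    proof -
      have "convolution G f ?\<xi> (y, n, x) = (\<Sum>p\<in>Krow N y. f (y, fst p, snd p) * ?\<xi> (snd p, n - fst p, x))"
        using convolution_eq[of f N, OF f that] by (simp add: split_def)
      moreover have "cmod (\<Sum>p\<in>Krow N y. f (y, fst p, snd p) * ?\<xi> (snd p, n - fst p, x)) \<le>
          (\<Sum>p\<in>Krow N y. C * cmod (?\<xi> (snd p, n - fst p, x)))"
        by (rule order.trans[OF norm_sum], rule sum_mono)
          (auto simp: norm_mult intro!: mult_right_mono C)
      ultimately have "cmod (convolution G f ?\<xi> (y, n, x)) \<le> (\<Sum>p\<in>Krow N y. C * cmod (?\<xi> (snd p, n - fst p, x)))"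
        by simp
      then have "(cmod (convolution G f ?\<xi> (y, n, x)))\<^sup>2 \<le> (\<Sum>p\<in>Krow N y. C * cmod (?\<xi> (snd p, n - fst p, x)))\<^sup>2"
        by (intro power_mono) auto
      \<comment> \<open>Cauchy-Schwarz against the constant 1, which brings in the length of the
        row; the length of a column enters below as a multiplicity.\<close>
      also have "\<dots> \<le> (\<Sum>p\<in>Krow N y. (C * cmod (?\<xi> (snd p, n - fst p, x)))\<^sup>2) * card (Krow N y)"
        by (rule sum_squared_le_sum_of_squares)
      also have "\<dots> \<le> (\<Sum>p\<in>Krow N y. (C * cmod (?\<xi> (snd p, n - fst p, x)))\<^sup>2) * real M"
        using M(3) by (intro mult_left_mono sum_nonneg) auto
      also have "\<dots> = real M * C\<^sup>2 * (\<Sum>p\<in>Krow N y. ?g (snd p, n - fst p, x))"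
        by (simp add: power_mult_distrib sum_distrib_left mult_ac)
      finally show ?thesis .
    qed
    have "(\<Sum>\<alpha>\<in>F. (cmod (convolution G f ?\<xi> \<alpha>))\<^sup>2) \<le> (real M * C * norm \<xi>)\<^sup>2" if F: "finite F" for F
    proof -
      let ?P = "SIGMA \<alpha>:F \<inter> GA. Krow N (fst \<alpha>)"
      \<comment> \<open>The argument at which \<xi> is evaluated in the term (\<alpha>, p). The
        double sum is regrouped by this argument.\<close>
      let ?\<psi> = "\<lambda>(\<alpha>, p). (snd p, fst (snd \<alpha>) - fst p, snd (snd \<alpha>))"
      have fin: "finite ?P" using F M(1) by auto
      have "(\<Sum>\<alpha>\<in>F. (cmod (convolution G f ?\<xi> \<alpha>))\<^sup>2) = (\<Sum>\<alpha>\<in>F \<inter> GA. (cmod (convolution G f ?\<xi> \<alpha>))\<^sup>2)"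
        using F by (intro sum.mono_neutral_right) (auto simp: convolution_outside)
      also have "\<dots> \<le> (\<Sum>\<alpha>\<in>F \<inter> GA. real M * C\<^sup>2 * (\<Sum>p\<in>Krow N (fst \<alpha>). ?g (?\<psi> (\<alpha>, p))))"
        using row by (intro sum_mono) (auto simp: split_def)
      also have "\<dots> = real M * C\<^sup>2 * (\<Sum>q\<in>?P. ?g (?\<psi> q))"
        unfolding sum_distrib_left[symmetric] using F M(1) by (subst sum.Sigma) (auto simp: split_def)
      also have "(\<Sum>q\<in>?P. ?g (?\<psi> q)) = (\<Sum>\<gamma>\<in>?\<psi> ` ?P. \<Sum>q\<in>{q \<in> ?P. ?\<psi> q = \<gamma>}. ?g (?\<psi> q))"
        by (rule sum.image_gen[OF fin])
      also have "\<dots> = (\<Sum>\<gamma>\<in>?\<psi> ` ?P. real (card {q \<in> ?P. ?\<psi> q = \<gamma>}) * ?g \<gamma>)"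
        by (intro sum.cong refl) simp
      also have "\<dots> \<le> (\<Sum>\<gamma>\<in>?\<psi> ` ?P. real M * ?g \<gamma>)"
      proof (intro sum_mono mult_right_mono)
        fix \<gamma> :: "'a \<times> int \<times> 'a"
        obtain w m x where \<gamma>: "\<gamma> = (w, m, x)" by (metis prod_cases3)
        \<comment> \<open>Once \<gamma> is fixed, the cocycle value k and the range y determine the
          term, so a column size bounds the multiplicity.\<close>
        let ?i = "\<lambda>(\<alpha>, p). (fst p, fst \<alpha>)"
        have "card {q \<in> ?P. ?\<psi> q = \<gamma>} \<le> card (Kcol N w)"
        proof (rule card_inj_on_le[of ?i])
          show "inj_on ?i {q \<in> ?P. ?\<psi> q = \<gamma>}" by (auto simp: inj_on_def \<gamma>)
          show "?i ` {q \<in> ?P. ?\<psi> q = \<gamma>} \<subseteq> Kcol N w" by (auto simp: \<gamma> Krow_def Kcol_def)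
        qed (rule M(2))
        then show "real (card {q \<in> ?P. ?\<psi> q = \<gamma>}) \<le> real M" using M(4)[of w] by linarith
      qed simp
      also have "\<dots> = real M * (\<Sum>\<gamma>\<in>?\<psi> ` ?P. ?g \<gamma>)" by (simp add: sum_distrib_left)
      also have "\<dots> \<le> real M * (norm \<xi>)\<^sup>2"
        using fin by (intro mult_left_mono ell2_sum_le_norm) auto
      finally have "(\<Sum>\<alpha>\<in>F. (cmod (convolution G f ?\<xi> \<alpha>))\<^sup>2) \<le> real M * C\<^sup>2 * (real M * (norm \<xi>)\<^sup>2)"
        by (simp add: mult_left_mono)
      then show ?thesis by (simp add: power2_eq_square mult_ac)
    qed
    then show ?thesis
      by (rule ell2_of_bounded_sums) (use C(2) in auto)
  qed
  then show ?thesis using C(2) by (intro exI[of _ "real M * C"]) auto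
qed

definition cop :: "('a \<times> int \<times> 'a \<Rightarrow> complex) \<Rightarrow> ('a \<times> int \<times> 'a) ell2_op"
  where "cop f = (SOME a. complex_linear a \<and> (\<forall>\<xi>. ell2_coord (blinfun_apply a \<xi>) = convolution G f (ell2_coord \<xi>)))"

lemma cop:
  assumes f: "f \<in> Cc \<G>"
  shows "complex_linear (cop f)" "ell2_coord (blinfun_apply (cop f) \<xi>) = convolution G f (ell2_coord \<xi>)"
proof -
  obtain N where N: "\<And>\<alpha>. f \<alpha> \<noteq> 0 \<Longrightarrow> \<alpha> \<in> K N" using CcD(2)[OF f] by blast
  obtain C where C: "0 \<le> C" "\<And>\<alpha>. cmod (f \<alpha>) \<le> C" using CcD(3)[OF f] by blast
  obtain B a where B: "0 \<le> B" and a: "\<And>\<xi>. ell2_coord (a \<xi>) = convolution G f (ell2_coord \<xi>)" "\<And>\<xi>. norm (a \<xi>) \<le> B * norm \<xi>"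
    using convolution_bounded[of f N C] N C by metis
  have add: "a (x + y) = a x + a y" for x y
  proof (rule ell2_eqI)
    fix \<alpha>
    show "ell2_coord (a (x + y)) \<alpha> = ell2_coord (a x + a y) \<alpha>"
    proof (cases "\<alpha> \<in> GA")
      case True
      obtain y' n x' where \<alpha>: "\<alpha> = (y', n, x')" by (metis prod_cases3)
      show ?thesis using True unfolding \<alpha> a ell2_coord_simps
        by (simp add: convolution_eq[OF N] split_def distrib_left sum.distrib)
    qed (simp add: a ell2_coord_simps convolution_outside)
  qed
  have scl: "a (ell2_scaleC c x) = ell2_scaleC c (a x)" for c x
  proof (rule ell2_eqI)
    fix \<alpha>
    show "ell2_coord (a (ell2_scaleC c x)) \<alpha> = ell2_coord (ell2_scaleC c (a x)) \<alpha>"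
    proof (cases "\<alpha> \<in> GA")
      case True
      obtain y' n x' where \<alpha>: "\<alpha> = (y', n, x')" by (metis prod_cases3)
      show ?thesis using True unfolding \<alpha> a ell2_coord_simps
        by (simp add: convolution_eq[OF N] split_def sum_distrib_left mult_ac)
    qed (simp add: a ell2_coord_simps convolution_outside)
  qed
  have bl: "bounded_linear a"
    by (rule bounded_linear_intro[of _ B])
      (auto simp: add scl a(2) mult.commute simp flip: ell2_scaleC_of_real)
  have "complex_linear (Blinfun a) \<and> (\<forall>\<xi>. ell2_coord (blinfun_apply (Blinfun a) \<xi>) = convolution G f (ell2_coord \<xi>))"
    by (simp add: complex_linear_def bounded_linear_Blinfun_apply[OF bl] scl a)
  then have "complex_linear (cop f) \<and> (\<forall>\<xi>. ell2_coord (blinfun_apply (cop f) \<xi>) = convolution G f (ell2_coord \<xi>))"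
    unfolding cop_def by (rule someI)
  then show "complex_linear (cop f)" "ell2_coord (blinfun_apply (cop f) \<xi>) = convolution G f (ell2_coord \<xi>)" by auto
qed

lemma regular_operators_eq: "F \<subseteq> Cc \<G> \<Longrightarrow> regular_operators G F = cop ` F"
proof
  assume F: "F \<subseteq> Cc \<G>"
  show "cop ` F \<subseteq> regular_operators G F" unfolding regular_operators_def using cop F by blast
  show "regular_operators G F \<subseteq> cop ` F"
  proof
    fix a assume "a \<in> regular_operators G F"
    then obtain f where f: "f \<in> F" "\<And>\<xi>. ell2_coord (blinfun_apply a \<xi>) = convolution G f (ell2_coord \<xi>)"
      unfolding regular_operators_def by blast
    have "a = cop f" by (rule blinfun_eqI, rule ell2_eqI) (use f cop F in auto)
    then show "a \<in> cop ` F" using f(1) by blast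
  qed
qed

text \<open>The entry at (\<alpha>, \<beta>) is f at the quotient \<alpha> \<beta>^{-1} when the
  sources agree: left convolution is invariant under right translation.\<close>

lemma cop_matrix:
  assumes f: "f \<in> Cc \<G>"
  shows "ell2_coord (blinfun_apply (cop f) (ell2_delta (z, m, x'))) (y, n, x) =
    (if (y, n, x) \<in> GA \<and> (z, m, x') \<in> GA \<and> x = x' then f (y, n - m, z) else 0)"
proof -
  obtain N where N: "\<And>\<alpha>. f \<alpha> \<noteq> 0 \<Longrightarrow> \<alpha> \<in> K N" using CcD(2)[OF f] by blast
  show ?thesis
  proof (cases "(y, n, x) \<in> GA")
    case True
    have "ell2_coord (blinfun_apply (cop f) (ell2_delta (z, m, x'))) (y, n, x) =
        (\<Sum>(k, w)\<in>Krow N y. f (y, k, w) * ell2_coord (ell2_delta (z, m, x')) (w, n - k, x))"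
      unfolding cop(2)[OF f] by (rule convolution_eq[OF N True])
    also have "\<dots> = (\<Sum>p\<in>Krow N y. if p = (n - m, z) then (if x = x' then f (y, n - m, z) else 0) else 0)"
      by (intro sum.cong refl) (auto simp: ell2_delta.rep_eq split: if_splits)
    also have "\<dots> = (if (n - m, z) \<in> Krow N y \<and> x = x' then f (y, n - m, z) else 0)"
      using finite_Krow by simp
    also have "\<dots> = (if x = x' then f (y, n - m, z) else 0)"
      using N[of "(y, n - m, z)"] by (auto simp: Krow_def)
    also have "\<dots> = (if (y, n, x) \<in> GA \<and> (z, m, x') \<in> GA \<and> x = x' then f (y, n - m, z) else 0)"
    proof -
      have "(z, m, x) \<in> GA" if "f (y, n - m, z) \<noteq> 0"
      proof -
        have "(y, n - m, z) \<in> GA" using N[OF that] K_subset[of N] by blast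
        then show ?thesis using arrow_comp[OF arrow_inv True] by fastforce
      qed
      then show ?thesis using True by auto
    qed
    finally show ?thesis .
  qed (simp add: cop(2)[OF f] convolution_outside)
qed

text \<open>The symbol of an element of the reduced algebra, i.e. Renault's map \<open>j\<close> from
  \<open>C\<^sup>*\<^sub>r(G)\<close> to \<open>C\<^sub>0(G)\<close>.\<close>

definition sym :: "('a \<times> int \<times> 'a) ell2_op \<Rightarrow> 'a \<times> int \<times> 'a \<Rightarrow> complex"
  where "sym a = (\<lambda>(y, n, x). ell2_coord (blinfun_apply a (ell2_delta (x, 0, x))) (y, n, x))"

text \<open>The entry at (\<alpha>, \<beta>) depends only on \<alpha> \<beta>^{-1} and vanishes when
  this quotient does not exist. The condition is closed, so it holds on the whole reduced algebra,
  and it makes the symbol injective there.\<close>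

definition equivariant :: "('a \<times> int \<times> 'a) ell2_op \<Rightarrow> bool"
  where "equivariant a \<longleftrightarrow> complex_linear a \<and> (\<forall>y n x z m x'.
    ell2_coord (blinfun_apply a (ell2_delta (z, m, x'))) (y, n, x) =
      (if (y, n, x) \<in> GA \<and> (z, m, x') \<in> GA \<and> x = x' then sym a (y, n - m, z) else 0))"

lemma equivariantD:
  assumes "equivariant a"
  shows "complex_linear a" "ell2_coord (blinfun_apply a (ell2_delta (z, m, x'))) (y, n, x) =
      (if (y, n, x) \<in> GA \<and> (z, m, x') \<in> GA \<and> x = x' then sym a (y, n - m, z) else 0)"
  using assms unfolding equivariant_def by blast+

lemma equivariant_eqI:
  assumes "equivariant a" "equivariant b" "sym a = sym b" shows "a = b"
proof (rule complex_linear_eqI)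
  fix \<alpha> \<beta> :: "'a \<times> int \<times> 'a"
  show "ell2_coord (blinfun_apply a (ell2_delta \<beta>)) \<alpha> = ell2_coord (blinfun_apply b (ell2_delta \<beta>)) \<alpha>"
    by (cases \<alpha>; cases \<beta>) (simp only: equivariantD(2)[OF assms(1)] equivariantD(2)[OF assms(2)] assms(3))
qed (use assms equivariantD in blast)+

lemma sym_outside: "equivariant a \<Longrightarrow> \<alpha> \<notin> GA \<Longrightarrow> sym a \<alpha> = 0"
proof (cases \<alpha>)
  case (fields y n x)
  assume "equivariant a" "\<alpha> \<notin> GA"
  then show ?thesis using equivariantD(2)[of a x 0 x y n x] by (simp add: sym_def fields)
qed

lemma sym_bounded_linear: "bounded_linear (\<lambda>a. sym a \<alpha>)"
  unfolding sym_def split_def by (rule blinfun_coord_bounded_linear)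

lemma closed_equivariant: "closed {a. equivariant a}"
proof -
  define E where "E \<alpha> \<beta> = {a. ell2_coord (blinfun_apply a (ell2_delta \<beta>)) \<alpha> =
      (if \<alpha> \<in> GA \<and> \<beta> \<in> GA \<and> snd (snd \<alpha>) = snd (snd \<beta>)
       then sym a (fst \<alpha>, fst (snd \<alpha>) - fst (snd \<beta>), fst \<beta>) else 0)}" for \<alpha> \<beta>
  have "closed (E \<alpha> \<beta>)" for \<alpha> \<beta>
    unfolding E_def
    by (cases "\<alpha> \<in> GA \<and> \<beta> \<in> GA \<and> snd (snd \<alpha>) = snd (snd \<beta>)")
      (simp_all only: if_True if_False simp_thms closed_Collect_eq continuous_on_const
        bounded_linear.continuous_on[OF blinfun_coord_bounded_linear]
        bounded_linear.continuous_on[OF sym_bounded_linear] continuous_on_id)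
  then have "closed ({a. complex_linear a} \<inter> (\<Inter>\<alpha> \<beta>. E \<alpha> \<beta>))"
    by (intro closed_Int closed_complex_linear closed_INT ballI)
  moreover have "{a. equivariant a} = {a. complex_linear a} \<inter> (\<Inter>\<alpha> \<beta>. E \<alpha> \<beta>)"
    by (auto simp: equivariant_def E_def)
  ultimately show ?thesis by simp
qed

lemma Cc_outside: "f \<in> Cc \<G> \<Longrightarrow> \<alpha> \<notin> GA \<Longrightarrow> f \<alpha> = 0"
  using topspace_G unfolding Cc_def by blast

lemma sym_cop:
  assumes f: "f \<in> Cc \<G>" shows "sym (cop f) = f"
proof (rule ext)
  fix \<alpha> :: "'a \<times> int \<times> 'a"
  obtain y n x where \<alpha>: "\<alpha> = (y, n, x)" by (metis prod_cases3)
  have "(x, 0, x) \<in> GA" if "(y, n, x) \<in> GA" using that arrow_unit by (simp add: arrows_iff)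
  then show "sym (cop f) \<alpha> = f \<alpha>"
    using Cc_outside[OF f, of \<alpha>] by (auto simp: sym_def \<alpha> cop_matrix[OF f])
qed

lemma equivariant_cop: "f \<in> Cc \<G> \<Longrightarrow> equivariant (cop f)"
  unfolding equivariant_def sym_cop by (simp add: cop(1) cop_matrix)

abbreviation "A \<equiv> reduced_algebra (DR_groupoid X T)"
abbreviation "B \<equiv> reduced_subalgebra (DR_groupoid X T) (DR_kernel X T)"

lemma A_eq: "A = closure (cop ` Cc \<G>)"
  unfolding reduced_algebra_def by (simp add: regular_operators_eq)

lemma Cc_H_subset: "Cc (subtopology \<G> H) \<subseteq> Cc \<G>"
  using Cc_H_iff by blast

lemma B_eq: "B = closure (cop ` Cc (subtopology \<G> H))"
  unfolding reduced_subalgebra_def by (simp add: regular_operators_eq Cc_H_subset)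

lemma B_subset_A: "B \<subseteq> A"
  unfolding A_eq B_eq by (intro closure_mono image_mono Cc_H_subset)

lemma cop_in_A: "f \<in> Cc \<G> \<Longrightarrow> cop f \<in> A"
  unfolding A_eq by (meson closure_subset imageI subsetD)

lemma A_equivariant: "a \<in> A \<Longrightarrow> equivariant a"
proof -
  have "A \<subseteq> {a. equivariant a}"
    unfolding A_eq using equivariant_cop by (intro closure_minimal closed_equivariant) blast
  then show "a \<in> A \<Longrightarrow> equivariant a" by blast
qed

lemma cmod_sym_le: "cmod (sym a \<alpha>) \<le> norm a"
proof (cases \<alpha>)
  case (fields y n x)
  have "cmod (sym a \<alpha>) \<le> norm (blinfun_apply a (ell2_delta (x, 0, x)))"
    unfolding sym_def fields by (simp add: ell2_coord_le_norm)
  also have "\<dots> \<le> norm a" using norm_blinfun[of a "ell2_delta (x, 0, x)"] by simp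
  finally show ?thesis .
qed

lemma sym_diff: "sym (a - b) \<alpha> = sym a \<alpha> - sym b \<alpha>"
  by (simp add: sym_def split_def blinfun.diff_left ell2_coord_minus)

text \<open>The symbol is bounded pointwise by the operator norm, so elements of the closure have
  symbols that are uniform limits of functions in \<open>Cc\<close>.\<close>

lemma A_sym_continuous: assumes a: "a \<in> A" shows "continuous_map \<G> euclidean (sym a)"
  unfolding continuous_map_euclidean_iff
proof (intro ballI allI impI)
  fix \<alpha> and e :: real assume \<alpha>: "\<alpha> \<in> topspace \<G>" and e: "0 < e"
  obtain b where "b \<in> cop ` Cc \<G>" "dist b a < e / 3"
    using a e unfolding A_eq closure_approachable by (metis zero_less_divide_iff zero_less_numeral)
  then obtain f where f: "f \<in> Cc \<G>" "norm (cop f - a) < e / 3" by (auto simp: dist_norm)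
  have close: "dist (f \<beta>) (sym a \<beta>) < e / 3" for \<beta>
    using cmod_sym_le[of "cop f - a" \<beta>] f(2) by (simp add: sym_diff sym_cop[OF f(1)] dist_norm)
  obtain U where U: "openin \<G> U" "\<alpha> \<in> U" "\<forall>z\<in>U. dist (f z) (f \<alpha>) < e / 3"
    using CcD(1)[OF f(1)] \<alpha> e unfolding continuous_map_euclidean_iff
    by (metis zero_less_divide_iff zero_less_numeral)
  have "dist (sym a z) (sym a \<alpha>) < e" if "z \<in> U" for z
  proof -
    have "dist (sym a z) (sym a \<alpha>) \<le> dist (f z) (sym a z) + (dist (f z) (f \<alpha>) + dist (f \<alpha>) (sym a \<alpha>))"
      by (metis dist_commute dist_triangle dist_triangle_le add_left_mono order_trans)
    then show ?thesis using close[of z] close[of \<alpha>] U(3) that by fastforce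
  qed
  then show "\<exists>U. openin \<G> U \<and> \<alpha> \<in> U \<and> (\<forall>z\<in>U. dist (sym a z) (sym a \<alpha>) < e)" using U by blast
qed

text \<open>By injectivity of the symbol, an element with compactly supported symbol is a
  convolution operator. This allows membership in \<open>B\<close> to be read off from a
  symbol.\<close>

lemma A_eq_cop: "a \<in> A \<Longrightarrow> sym a \<in> Cc \<G> \<Longrightarrow> a = cop (sym a)"
  by (intro equivariant_eqI A_equivariant equivariant_cop) (simp_all add: sym_cop)

lemma B_sym: "a \<in> B \<Longrightarrow> sym a \<alpha> \<noteq> 0 \<Longrightarrow> \<alpha> \<in> H"
proof -
  have "closed {a. sym a \<alpha> = 0}"
    by (intro closed_Collect_eq bounded_linear.continuous_on[OF sym_bounded_linear] continuous_on_id continuous_on_const)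
  moreover have "cop ` Cc (subtopology \<G> H) \<subseteq> {a. sym a \<alpha> = 0}" if "\<alpha> \<notin> H"
  proof clarify
    fix f assume "f \<in> Cc (subtopology \<G> H)"
    then have "f \<in> Cc \<G>" "f \<alpha> = 0" using that Cc_H_iff by blast+
    then show "sym (cop f) \<alpha> = 0" by (simp add: sym_cop)
  qed
  ultimately have "B \<subseteq> {a. sym a \<alpha> = 0}" if "\<alpha> \<notin> H"
    unfolding B_eq using that by (intro closure_minimal)
  then show "a \<in> B \<Longrightarrow> sym a \<alpha> \<noteq> 0 \<Longrightarrow> \<alpha> \<in> H" by blast
qed

end

context compact_DR_system
begin

section \<open>Convolution operators form a star-algebra\<close>

lemma Cc_add:
  assumes "f \<in> Cc \<G>" "g \<in> Cc \<G>" shows "(\<lambda>\<alpha>. f \<alpha> + g \<alpha>) \<in> Cc \<G>"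
proof -
  obtain N where N: "\<And>\<alpha>. f \<alpha> \<noteq> 0 \<Longrightarrow> \<alpha> \<in> K N" using CcD(2)[OF assms(1)] by blast
  obtain N' where N': "\<And>\<alpha>. g \<alpha> \<noteq> 0 \<Longrightarrow> \<alpha> \<in> K N'" using CcD(2)[OF assms(2)] by blast
  have "\<alpha> \<in> K (max N N')" if "f \<alpha> + g \<alpha> \<noteq> 0" for \<alpha>
    using that N[of \<alpha>] N'[of \<alpha>] K_mono[of N "max N N'"] K_mono[of N' "max N N'"]
    by (metis add.right_neutral max.cobounded1 max.cobounded2 subsetD)
  then show ?thesis
    using assms CcD(1) by (intro CcI continuous_map_add)
qed

lemma Cc_cmult: assumes "f \<in> Cc \<G>" shows "(\<lambda>\<alpha>. c * f \<alpha>) \<in> Cc \<G>"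
proof -
  obtain N where N: "\<And>\<alpha>. f \<alpha> \<noteq> 0 \<Longrightarrow> \<alpha> \<in> K N" using CcD(2)[OF assms] by blast
  have "continuous_map \<G> euclidean (\<lambda>\<alpha>. c * f \<alpha>)"
    using continuous_map_compose[OF CcD(1)[OF assms], of euclidean "\<lambda>z. c * z"]
    by (simp add: o_def continuous_on_mult_left)
  then show ?thesis using N by (intro CcI) auto
qed

lemma cop_add: "f \<in> Cc \<G> \<Longrightarrow> g \<in> Cc \<G> \<Longrightarrow> cop f + cop g = cop (\<lambda>\<alpha>. f \<alpha> + g \<alpha>)"
proof (rule complex_linear_eqI)
  fix \<alpha> \<beta> :: "'a \<times> int \<times> 'a" assume fg: "f \<in> Cc \<G>" "g \<in> Cc \<G>"
  obtain y n x z m x' where "\<alpha> = (y, n, x)" "\<beta> = (z, m, x')" by (metis prod_cases3)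
  then show "ell2_coord (blinfun_apply (cop f + cop g) (ell2_delta \<beta>)) \<alpha> =
      ell2_coord (blinfun_apply (cop (\<lambda>\<alpha>. f \<alpha> + g \<alpha>)) (ell2_delta \<beta>)) \<alpha>"
    by (auto simp: blinfun.add_left plus_ell2.rep_eq cop_matrix[OF fg(1)] cop_matrix[OF fg(2)] cop_matrix[OF Cc_add[OF fg]])
qed (auto intro!: complex_linear_simps cop(1) Cc_add)

lemma cop_scaleC: "f \<in> Cc \<G> \<Longrightarrow> op_scaleC c (cop f) = cop (\<lambda>\<alpha>. c * f \<alpha>)"
proof (rule complex_linear_eqI)
  fix \<alpha> \<beta> :: "'a \<times> int \<times> 'a" assume f: "f \<in> Cc \<G>"
  obtain y n x z m x' where "\<alpha> = (y, n, x)" "\<beta> = (z, m, x')" by (metis prod_cases3)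
  then show "ell2_coord (blinfun_apply (op_scaleC c (cop f)) (ell2_delta \<beta>)) \<alpha> =
      ell2_coord (blinfun_apply (cop (\<lambda>\<alpha>. c * f \<alpha>)) (ell2_delta \<beta>)) \<alpha>"
    by (auto simp: op_scaleC_apply ell2_scaleC.rep_eq cop_matrix[OF f] cop_matrix[OF Cc_cmult[OF f]])
qed (auto intro!: complex_linear_simps cop(1) Cc_cmult)

lemma Cc_star:
  assumes f: "f \<in> Cc \<G>" shows "(\<lambda>(y, n, x). cnj (f (x, - n, y))) \<in> Cc \<G>"
proof -
  obtain N where N: "\<And>\<alpha>. f \<alpha> \<noteq> 0 \<Longrightarrow> \<alpha> \<in> K N" using CcD(2)[OF f] by blast
  \<comment> \<open>\<open>K N\<close> fixes the exponent of the source. After inversion the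
    exponent N belongs to the range, and that of the source may be as large as 2 N.\<close>
  have "(y, n, x) \<in> K (2 * N)" if "f (x, - n, y) \<noteq> 0" for y n x
  proof -
    have "(x, - n, y) \<in> K N" using N[OF that] .
    then have k: "y \<in> S" "x \<in> S" "\<bar>n\<bar> \<le> int N" "(T ^^ nat (int N - n)) x = (T ^^ N) y" by (auto simp: K_iff)
    have "(y, int N - int (nat (int N - n)), x) \<in> Z N (nat (int N - n))" using k by (simp add: Z_iff)
    moreover have "Z N (nat (int N - n)) \<subseteq> K (2 * N)" using k(3) by (intro Z_subset_K) auto
    moreover have "int N - int (nat (int N - n)) = n" using k(3) by simp
    ultimately show ?thesis by auto
  qed
  then have s: "\<alpha> \<in> K (2 * N)" if "(\<lambda>(y, n, x). cnj (f (x, - n, y))) \<alpha> \<noteq> 0" for \<alpha>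
    using that by (cases \<alpha>) auto
  show ?thesis
  proof (rule CcI[OF G_continuousI s])
    fix y n x and e :: real assume a: "(y, n, x) \<in> GA" and e: "0 < e"
    obtain i j where ij: "y \<in> S" "x \<in> S" "n = int i - int j" "(T ^^ i) y = (T ^^ j) x" using a by (auto simp: arrows_iff)
    obtain U V where UV: "openin X U" "openin X V" "x \<in> U" "y \<in> V"
      "\<And>y' x'. y' \<in> U \<Longrightarrow> x' \<in> V \<Longrightarrow> (T ^^ j) y' = (T ^^ i) x' \<Longrightarrow>
        dist (f (y', int j - int i, x')) (f (x, int j - int i, y)) < e"
      using G_continuousD[OF CcD(1)[OF f] ij(2,1) ij(4)[symmetric] e] by blast
    have "\<forall>y'\<in>V. \<forall>x'\<in>U. (T ^^ i) y' = (T ^^ j) x' \<longrightarrow> dist (cnj (f (x', - n, y'))) (cnj (f (x, - n, y))) < e"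
      using UV(5) ij(3) by (simp add: dist_norm flip: complex_cnj_diff)
    then show "\<exists>i j U V. n = int i - int j \<and> (T ^^ i) y = (T ^^ j) x \<and> openin X U \<and> openin X V \<and> y \<in> U \<and> x \<in> V \<and>
      (\<forall>y'\<in>U. \<forall>x'\<in>V. (T ^^ i) y' = (T ^^ j) x' \<longrightarrow>
        dist ((\<lambda>(y, n, x). cnj (f (x, - n, y))) (y', n, x')) ((\<lambda>(y, n, x). cnj (f (x, - n, y))) (y, n, x)) < e)"
      using ij(3,4) UV(1-4) by (intro exI[of _ i] exI[of _ j] exI[of _ V] exI[of _ U]) simp
  qed
qed

lemma op_star_cop: assumes f: "f \<in> Cc \<G>" shows "op_star (cop f) = cop (\<lambda>(y, n, x). cnj (f (x, - n, y)))"
proof (rule complex_linear_eqI)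
  fix \<alpha> \<beta> :: "'a \<times> int \<times> 'a"
  obtain y n x z m x' where "\<alpha> = (y, n, x)" "\<beta> = (z, m, x')" by (metis prod_cases3)
  then show "ell2_coord (blinfun_apply (op_star (cop f)) (ell2_delta \<beta>)) \<alpha> =
      ell2_coord (blinfun_apply (cop (\<lambda>(y, n, x). cnj (f (x, - n, y)))) (ell2_delta \<beta>)) \<alpha>"
    by (auto simp: op_star_matrix[OF cop(1)[OF f]] cop_matrix[OF f] cop_matrix[OF Cc_star[OF f]])
qed (use cop(1) Cc_star f op_star_all(1) in blast)+

text \<open>The index set of the sum moves with y. Local sections of T^N near T^p y identify
  neighbouring fibres, after which continuity of the terms along the sections suffices.\<close>

lemma fibre_sum_continuous:
  fixes h :: "'a \<times> int \<times> 'a \<Rightarrow> 'a \<Rightarrow> complex"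
  assumes h: "\<And>y i j x w e. y \<in> S \<Longrightarrow> x \<in> S \<Longrightarrow> w \<in> S \<Longrightarrow> (T ^^ i) y = (T ^^ j) x \<Longrightarrow> (T ^^ N) w = (T ^^ p) y \<Longrightarrow> 0 < e \<Longrightarrow>
    \<exists>U V Q. openin X U \<and> openin X V \<and> openin X Q \<and> y \<in> U \<and> x \<in> V \<and> w \<in> Q \<and>
      (\<forall>y'\<in>U. \<forall>x'\<in>V. \<forall>w'\<in>Q. (T ^^ i) y' = (T ^^ j) x' \<longrightarrow> (T ^^ N) w' = (T ^^ p) y' \<longrightarrow>
        dist (h (y', int i - int j, x') w') (h (y, int i - int j, x) w) < e)"
  shows "continuous_map \<G> euclidean (\<lambda>\<alpha>. \<Sum>w | w \<in> S \<and> (T ^^ N) w = (T ^^ p) (fst \<alpha>). h \<alpha> w)"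
proof (rule G_continuousI)
  fix y n x and e :: real assume a: "(y, n, x) \<in> GA" and e: "0 < e"
  obtain i j where ij: "y \<in> S" "x \<in> S" "n = int i - int j" "(T ^^ i) y = (T ^^ j) x" using a by (auto simp: arrows_iff)
  let ?F = "\<lambda>v. {w \<in> S. (T ^^ N) w = v}"
  let ?v = "(T ^^ p) y"
  \<comment> \<open>The admissible error is shared among the points of the fibre; the added 1 gives
    a strict inequality and covers an empty fibre.\<close>
  let ?d = "e / (real (card (?F ?v)) + 1)"
  have d: "0 < ?d" using e by (intro divide_pos_pos) auto
  define near where "near w U V Q \<longleftrightarrow> openin X U \<and> openin X V \<and> openin X Q \<and> y \<in> U \<and> x \<in> V \<and> w \<in> Q \<and>
      (\<forall>y'\<in>U. \<forall>x'\<in>V. \<forall>w'\<in>Q. (T ^^ i) y' = (T ^^ j) x' \<longrightarrow> (T ^^ N) w' = (T ^^ p) y' \<longrightarrow>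
        dist (h (y', n, x') w') (h (y, n, x) w) < ?d)" for w U V Q
  have "\<exists>U V Q. near w U V Q" if "w \<in> ?F ?v" for w
    unfolding near_def ij(3) using h[OF ij(1,2) _ ij(4) _ d, of w] that by simp
  then obtain U V Q where "\<And>w. w \<in> ?F ?v \<Longrightarrow> near w (U w) (V w) (Q w)" by metis
  note UVQ = this[unfolded near_def]
  have Qw: "openin X (Q w) \<and> w \<in> Q w" if "w \<in> S" "(T ^^ N) w = ?v" for w using UVQ[of w] that by blast
  obtain W where W: "openin X W" "?v \<in> W" "\<And>v. v \<in> W \<Longrightarrow> \<exists>s. bij_betw s (?F ?v) (?F v) \<and> (\<forall>w\<in>?F ?v. s w \<in> Q w)"
    using fibre_sections[of ?v N Q, OF Tn_in[OF ij(1)] Qw] by blast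
  define U' where "U' = ((\<Inter>w\<in>?F ?v. U w) \<inter> S) \<inter> {z \<in> S. (T ^^ p) z \<in> W}"
  define V' where "V' = (\<Inter>w\<in>?F ?v. V w) \<inter> S"
  have "openin X U'" unfolding U'_def using UVQ
    by (intro openin_Int openin_INT finite_fibre Tn_preimage_open[OF W(1)]) blast
  moreover have "openin X V'" unfolding V'_def using UVQ by (intro openin_INT finite_fibre) blast
  moreover have "y \<in> U'" unfolding U'_def using UVQ ij(1) W(2) by blast
  moreover have "x \<in> V'" unfolding V'_def using UVQ ij(2) by blast
  moreover have "dist (\<Sum>w\<in>?F ((T ^^ p) y'). h (y', n, x') w) (\<Sum>w\<in>?F ?v. h (y, n, x) w) < e"
    if y': "y' \<in> U'" and x': "x' \<in> V'" and eq: "(T ^^ i) y' = (T ^^ j) x'" for y' x'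
  proof -
    have "(T ^^ p) y' \<in> W" using y' unfolding U'_def by blast
    then obtain s where s: "bij_betw s (?F ?v) (?F ((T ^^ p) y'))" "\<forall>w\<in>?F ?v. s w \<in> Q w" using W(3) by blast
    have "(\<Sum>w\<in>?F ((T ^^ p) y'). h (y', n, x') w) = (\<Sum>w\<in>?F ?v. h (y', n, x') (s w))"
      by (rule sum.reindex_bij_betw[OF s(1), symmetric])
    then have "dist (\<Sum>w\<in>?F ((T ^^ p) y'). h (y', n, x') w) (\<Sum>w\<in>?F ?v. h (y, n, x) w) =
        norm (\<Sum>w\<in>?F ?v. h (y', n, x') (s w) - h (y, n, x) w)"
      by (simp add: dist_norm sum_subtractf)
    also have "\<dots> \<le> (\<Sum>w\<in>?F ?v. ?d)"
    proof (rule order.trans[OF norm_sum], rule sum_mono)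
      fix w assume w: "w \<in> ?F ?v"
      have "(T ^^ N) (s w) = (T ^^ p) y'" using s(1) w unfolding bij_betw_def by blast
      moreover have "y' \<in> U w" "x' \<in> V w" using y' x' w unfolding U'_def V'_def by blast+
      ultimately have "dist (h (y', n, x') (s w)) (h (y, n, x) w) < ?d" using UVQ[OF w] s(2) w eq by blast
      then show "norm (h (y', n, x') (s w) - h (y, n, x) w) \<le> ?d" by (simp add: dist_norm)
    qed
    also have "\<dots> < e" using e by (simp add: field_simps)
    finally show ?thesis .
  qed
  ultimately show "\<exists>i j U V. n = int i - int j \<and> (T ^^ i) y = (T ^^ j) x \<and> openin X U \<and> openin X V \<and> y \<in> U \<and> x \<in> V \<and>
    (\<forall>y'\<in>U. \<forall>x'\<in>V. (T ^^ i) y' = (T ^^ j) x' \<longrightarrow>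
      dist (\<Sum>w | w \<in> S \<and> (T ^^ N) w = (T ^^ p) (fst (y', n, x')). h (y', n, x') w)
        (\<Sum>w | w \<in> S \<and> (T ^^ N) w = (T ^^ p) (fst (y, n, x)). h (y, n, x) w) < e)"
    using ij(3,4) by (intro exI[of _ i] exI[of _ j] exI[of _ U'] exI[of _ V']) simp
qed

lemma K_comp:
  assumes "(y, k, w) \<in> K N" "(w, m, x) \<in> K N" shows "(y, k + m, x) \<in> K (2 * N)"
proof -
  have 1: "y \<in> S" "\<bar>k\<bar> \<le> int N" "(T ^^ nat (int N + k)) y = (T ^^ N) w"
    and 2: "x \<in> S" "\<bar>m\<bar> \<le> int N" "(T ^^ nat (int N + m)) w = (T ^^ N) x" using assms by (auto simp: K_iff)
  have "(T ^^ (nat (int N + m) + nat (int N + k))) y = (T ^^ (nat (int N + m) + N)) w"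
    by (rule funpow_eq_add[OF 1(3)])
  also have "\<dots> = (T ^^ (N + N)) x" using funpow_eq_add[OF 2(3), of N] by (simp add: add.commute)
  finally have "(T ^^ (nat (int N + m) + nat (int N + k))) y = (T ^^ (N + N)) x" .
  moreover have "nat (int N + m) + nat (int N + k) = nat (int (2 * N) + (k + m))" using 1(2) 2(2) by linarith
  ultimately have "(T ^^ nat (int (2 * N) + (k + m))) y = (T ^^ (2 * N)) x" by (simp only: mult_2)
  then show ?thesis using 1 2 by (simp add: K_iff)
qed

text \<open>Grouping the row sum by the cocycle value p - N leaves finitely many sums over fibres of
  T^N, each continuous by \<open>fibre_sum_continuous\<close>.\<close>

lemma Cc_convolution:
  assumes f: "f \<in> Cc \<G>" and g: "g \<in> Cc \<G>" shows "convolution G f g \<in> Cc \<G>"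
proof -
  obtain N1 where N1: "\<And>\<alpha>. f \<alpha> \<noteq> 0 \<Longrightarrow> \<alpha> \<in> K N1" using CcD(2)[OF f] by blast
  obtain N2 where N2: "\<And>\<alpha>. g \<alpha> \<noteq> 0 \<Longrightarrow> \<alpha> \<in> K N2" using CcD(2)[OF g] by blast
  define N where "N = max N1 N2"
  have "K N1 \<subseteq> K N" "K N2 \<subseteq> K N" unfolding N_def by (intro K_mono; simp)+
  then have fN: "f \<alpha> \<noteq> 0 \<Longrightarrow> \<alpha> \<in> K N" and gN: "g \<alpha> \<noteq> 0 \<Longrightarrow> \<alpha> \<in> K N" for \<alpha>
    using N1[of \<alpha>] N2[of \<alpha>] by blast+
  have eq: "convolution G f g \<alpha> = (\<Sum>p\<le>2 * N. \<Sum>w | w \<in> S \<and> (T ^^ N) w = (T ^^ p) (fst \<alpha>).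
      f (fst \<alpha>, int p - int N, w) * g (w, fst (snd \<alpha>) - (int p - int N), snd (snd \<alpha>)))" if "\<alpha> \<in> GA" for \<alpha>
  proof -
    obtain y n x where \<alpha>: "\<alpha> = (y, n, x)" by (metis prod_cases3)
    have y: "y \<in> S" using that by (simp add: \<alpha> arrows_iff)
    have "convolution G f g \<alpha> = (\<Sum>(k, w)\<in>Krow N y. f (y, k, w) * g (w, n - k, x))"
      unfolding \<alpha> using convolution_eq[of f N, OF fN] that \<alpha> by simp
    also have "\<dots> = (\<Sum>(p, w)\<in>(SIGMA p:{..2 * N}. {w \<in> S. (T ^^ N) w = (T ^^ p) y}).
        f (y, int p - int N, w) * g (w, n - (int p - int N), x))"
    proof (rule sum.reindex_bij_witness[of _ "\<lambda>(p, w). (int p - int N, w)" "\<lambda>(k, w). (nat (int N + k), w)"])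
      fix q assume "q \<in> (SIGMA p:{..2 * N}. {w \<in> S. (T ^^ N) w = (T ^^ p) y})"
      then show "(case case q of (p, w) \<Rightarrow> (int p - int N, w) of (k, w) \<Rightarrow> (nat (int N + k), w)) = q"
        "(case q of (p, w) \<Rightarrow> (int p - int N, w)) \<in> Krow N y"
        using y by (auto simp: Krow_def K_iff)
    qed (auto simp: Krow_def K_iff)
    also have "\<dots> = (\<Sum>p\<le>2 * N. \<Sum>w | w \<in> S \<and> (T ^^ N) w = (T ^^ p) y. f (y, int p - int N, w) * g (w, n - (int p - int N), x))"
      by (subst sum.Sigma) (auto simp: finite_fibre)
    finally show ?thesis by (simp add: \<alpha>)
  qed
  have "continuous_map \<G> euclidean (\<lambda>\<alpha>. \<Sum>w | w \<in> S \<and> (T ^^ N) w = (T ^^ p) (fst \<alpha>).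
      f (fst \<alpha>, int p - int N, w) * g (w, fst (snd \<alpha>) - (int p - int N), snd (snd \<alpha>)))" for p
  proof (rule fibre_sum_continuous)
    fix y i j x w and e :: real
    assume a: "y \<in> S" "x \<in> S" "w \<in> S" "(T ^^ i) y = (T ^^ j) x" "(T ^^ N) w = (T ^^ p) y" and e: "0 < e"
    let ?k = "int p - int N" let ?n = "int i - int j"
    \<comment> \<open>Exponents for the remaining factor: the inverse of (y, p - N, w) followed by
      (y, i - j, x) is an arrow from x to w with exponents (N + i, p + j), and continuity of
      \<open>g\<close> is used at this arrow.\<close>
    have lift: "(T ^^ (N + i)) w' = (T ^^ (p + j)) x'" if "(T ^^ i) y' = (T ^^ j) x'" "(T ^^ N) w' = (T ^^ p) y'" for y' x' w'
    proof -
      have "(T ^^ (i + N)) w' = (T ^^ (i + p)) y'" by (rule funpow_eq_add[OF that(2)])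
      also have "\<dots> = (T ^^ (p + j)) x'" using funpow_eq_add[OF that(1), of p] by (simp add: add.commute)
      finally show ?thesis by (simp add: add.commute)
    qed
    have m: "int (N + i) - int (p + j) = ?n - ?k" by simp
    obtain d where d: "0 < d" "\<And>a' b'. dist a' (f (y, ?k, w)) < d \<Longrightarrow> dist b' (g (w, ?n - ?k, x)) < d \<Longrightarrow>
        dist (a' * b') (f (y, ?k, w) * g (w, ?n - ?k, x)) < e"
      using complex_mult_close[OF e] by blast
    obtain U1 Q1 where 1: "openin X U1" "openin X Q1" "y \<in> U1" "w \<in> Q1"
      "\<And>y' w'. y' \<in> U1 \<Longrightarrow> w' \<in> Q1 \<Longrightarrow> (T ^^ p) y' = (T ^^ N) w' \<Longrightarrow> dist (f (y', ?k, w')) (f (y, ?k, w)) < d"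
      using G_continuousD[OF CcD(1)[OF f] a(1) a(3) a(5)[symmetric] d(1)] by blast
    obtain Q2 V2 where 2: "openin X Q2" "openin X V2" "w \<in> Q2" "x \<in> V2"
      "\<And>w' x'. w' \<in> Q2 \<Longrightarrow> x' \<in> V2 \<Longrightarrow> (T ^^ (N + i)) w' = (T ^^ (p + j)) x' \<Longrightarrow>
        dist (g (w', ?n - ?k, x')) (g (w, ?n - ?k, x)) < d"
      using G_continuousD[OF CcD(1)[OF g] a(3) a(2) lift[OF a(4,5)] d(1)] unfolding m by blast
    have "dist (f (y', ?k, w') * g (w', ?n - ?k, x')) (f (y, ?k, w) * g (w, ?n - ?k, x)) < e"
      if "y' \<in> U1" "x' \<in> V2" "w' \<in> Q1 \<inter> Q2" "(T ^^ i) y' = (T ^^ j) x'" "(T ^^ N) w' = (T ^^ p) y'" for y' x' w'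
      using that 1(5)[of y' w'] 2(5)[of w' x'] lift[OF that(4,5)] by (intro d(2)) auto
    then show "\<exists>U V Q. openin X U \<and> openin X V \<and> openin X Q \<and> y \<in> U \<and> x \<in> V \<and> w \<in> Q \<and>
      (\<forall>y'\<in>U. \<forall>x'\<in>V. \<forall>w'\<in>Q. (T ^^ i) y' = (T ^^ j) x' \<longrightarrow> (T ^^ N) w' = (T ^^ p) y' \<longrightarrow>
       dist (f (fst (y', int i - int j, x'), int p - int N, w') *
             g (w', fst (snd (y', int i - int j, x')) - (int p - int N), snd (snd (y', int i - int j, x'))))
        (f (fst (y, int i - int j, x), int p - int N, w) *
         g (w, fst (snd (y, int i - int j, x)) - (int p - int N), snd (snd (y, int i - int j, x)))) < e)"
      using 1(1-4) 2(1-4) openin_Int[OF 1(2) 2(1)]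
      by (intro exI[of _ U1] exI[of _ V2] exI[of _ "Q1 \<inter> Q2"]) simp
  qed
  then have "continuous_map \<G> euclidean (\<lambda>\<alpha>. \<Sum>p\<le>2 * N. \<Sum>w | w \<in> S \<and> (T ^^ N) w = (T ^^ p) (fst \<alpha>).
      f (fst \<alpha>, int p - int N, w) * g (w, fst (snd \<alpha>) - (int p - int N), snd (snd \<alpha>)))"
    by (intro continuous_map_sum) auto
  then have c: "continuous_map \<G> euclidean (convolution G f g)"
    by (rule continuous_map_eq) (simp add: eq)
  show ?thesis
  proof (rule CcI[OF c])
    fix \<alpha> assume nz: "convolution G f g \<alpha> \<noteq> 0"
    then have \<alpha>: "\<alpha> \<in> GA" using convolution_outside by blast
    obtain y n x where yx: "\<alpha> = (y, n, x)" by (metis prod_cases3)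
    have "(\<Sum>(k, w)\<in>Krow N y. f (y, k, w) * g (w, n - k, x)) \<noteq> 0"
      using nz convolution_eq[of f N, OF fN] \<alpha> yx by simp
    then obtain q where "q \<in> Krow N y" "(case q of (k, w) \<Rightarrow> f (y, k, w) * g (w, n - k, x)) \<noteq> 0"
      by (meson sum.not_neutral_contains_not_neutral)
    then obtain k w where "f (y, k, w) \<noteq> 0" "g (w, n - k, x) \<noteq> 0" by (auto split: prod.splits)
    then have "(y, k + (n - k), x) \<in> K (2 * N)" using fN gN K_comp by blast
    then show "\<alpha> \<in> K (2 * N)" by (simp add: yx)
  qed
qed

lemma cop_comp: assumes f: "f \<in> Cc \<G>" and g: "g \<in> Cc \<G>" shows "cop f o\<^sub>L cop g = cop (convolution G f g)"
proof (rule complex_linear_eqI)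
  show "complex_linear (cop f o\<^sub>L cop g)" using f g cop(1) by (intro complex_linear_simps)
  show "complex_linear (cop (convolution G f g))" by (intro cop(1) Cc_convolution f g)
  fix \<alpha> \<beta> :: "'a \<times> int \<times> 'a"
  obtain y n x where \<alpha>: "\<alpha> = (y, n, x)" by (metis prod_cases3)
  obtain z m x' where \<beta>: "\<beta> = (z, m, x')" by (metis prod_cases3)
  obtain N where N: "\<And>\<alpha>. f \<alpha> \<noteq> 0 \<Longrightarrow> \<alpha> \<in> K N" using CcD(2)[OF f] by blast
  show "ell2_coord (blinfun_apply (cop f o\<^sub>L cop g) (ell2_delta \<beta>)) \<alpha> =
      ell2_coord (blinfun_apply (cop (convolution G f g)) (ell2_delta \<beta>)) \<alpha>"
  proof (cases "\<alpha> \<in> GA \<and> \<beta> \<in> GA \<and> x = x'")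
    case True
    then have tr: "(y, n, x) \<in> GA" "(z, m, x) \<in> GA" "x' = x" by (auto simp: \<alpha> \<beta>)
    have yz: "(y, n - m, z) \<in> GA" using arrow_comp[OF tr(1) arrow_inv[OF tr(2)]] by simp
    have "ell2_coord (blinfun_apply (cop f o\<^sub>L cop g) (ell2_delta \<beta>)) \<alpha> =
        (\<Sum>(k, w)\<in>Krow N y. f (y, k, w) * ell2_coord (blinfun_apply (cop g) (ell2_delta \<beta>)) (w, n - k, x))"
      unfolding \<alpha> blinfun_apply_blinfun_compose cop(2)[OF f]
      by (rule convolution_eq[OF N tr(1)])
    also have "\<dots> = (\<Sum>(k, w)\<in>Krow N y. f (y, k, w) * g (w, n - m - k, z))"
    proof (intro sum.cong refl, clarify)
      fix k w assume "(k, w) \<in> Krow N y"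
      then have "(y, k, w) \<in> GA" using K_subset[of N] by (auto simp: Krow_def)
      then have "(w, n - k, x) \<in> GA" using arrow_comp[OF arrow_inv tr(1)] by fastforce
      then show "f (y, k, w) * ell2_coord (blinfun_apply (cop g) (ell2_delta \<beta>)) (w, n - k, x) = f (y, k, w) * g (w, n - m - k, z)"
        using tr by (simp add: \<beta> cop_matrix[OF g] algebra_simps)
    qed
    also have "\<dots> = convolution G f g (y, n - m, z)" by (rule convolution_eq[OF N yz, symmetric])
    also have "\<dots> = ell2_coord (blinfun_apply (cop (convolution G f g)) (ell2_delta \<beta>)) \<alpha>"
      using tr by (simp add: \<alpha> \<beta> cop_matrix[OF Cc_convolution[OF f g]])
    finally show ?thesis .
  next
    case False
    have "ell2_coord (blinfun_apply (cop f o\<^sub>L cop g) (ell2_delta \<beta>)) \<alpha> = 0"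
    proof (cases "\<alpha> \<in> GA")
      case True
      then have "ell2_coord (blinfun_apply (cop f o\<^sub>L cop g) (ell2_delta \<beta>)) \<alpha> =
          (\<Sum>(k, w)\<in>Krow N y. f (y, k, w) * ell2_coord (blinfun_apply (cop g) (ell2_delta \<beta>)) (w, n - k, x))"
        unfolding \<alpha> blinfun_apply_blinfun_compose cop(2)[OF f] by (intro convolution_eq[OF N])
      also have "\<dots> = 0"
        using False True by (intro sum.neutral) (auto simp: \<beta> cop_matrix[OF g])
      finally show ?thesis .
    qed (simp add: cop(2)[OF f] convolution_outside)
    then show ?thesis using False by (auto simp: \<alpha> \<beta> cop_matrix[OF Cc_convolution[OF f g]])
  qed
qed

text \<open>\<open>Z i j\<close> is open, closed and compact, so truncating a continuous function to
  it costs no continuity. Both \<open>dsym\<close> and the indicators behind \<open>Zop\<close>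
  arise in this way.\<close>

lemma cutoff_in_Cc:
  assumes F: "continuous_map \<G> euclidean F"
  shows "(\<lambda>\<alpha>. if \<alpha> \<in> Z i j then F \<alpha> else 0) \<in> Cc \<G>"
proof (rule CcI[of _ "max i j"])
  show "continuous_map \<G> euclidean (\<lambda>\<alpha>. if \<alpha> \<in> Z i j then F \<alpha> else 0)"
    unfolding continuous_map_euclidean_iff
  proof (intro ballI allI impI)
    fix \<alpha> and e :: real assume a: "\<alpha> \<in> topspace \<G>" and e: "0 < e"
    obtain U where U: "openin \<G> U" "\<alpha> \<in> U" "\<forall>z\<in>U. dist (F z) (F \<alpha>) < e"
      using F a e unfolding continuous_map_euclidean_iff by blast
    have 1: "openin \<G> (topspace \<G> - Z i j)" using closedin_Z by blast
    show "\<exists>U. openin \<G> U \<and> \<alpha> \<in> U \<and>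
        (\<forall>z\<in>U. dist (if z \<in> Z i j then F z else 0) (if \<alpha> \<in> Z i j then F \<alpha> else 0) < e)"
    proof (cases "\<alpha> \<in> Z i j")
      case True
      then show ?thesis using U openin_Int[OF U(1) openin_Z[of i j]] by (intro exI[of _ "U \<inter> Z i j"]) simp
    next
      case False
      then show ?thesis using 1 a e by (intro exI[of _ "topspace \<G> - Z i j"]) simp
    qed
  qed
  show "\<alpha> \<in> K (max i j)" if "(if \<alpha> \<in> Z i j then F \<alpha> else 0) \<noteq> 0" for \<alpha>
    using that Z_subset_K[of i "max i j" j] by (auto split: if_splits)
qed

section \<open>The diagonal\<close>

text \<open>\<open>Z 0 0\<close> is the unit space, so this is a function on X transported to the
  units and extended by zero; the operator \<open>mul d\<close> multiplies a vector by the value of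
  d at the range.\<close>

definition dsym :: "('a \<Rightarrow> complex) \<Rightarrow> 'a \<times> int \<times> 'a \<Rightarrow> complex"
  where "dsym d = (\<lambda>\<alpha>. if \<alpha> \<in> Z 0 0 then d (fst \<alpha>) else 0)"

definition mul :: "('a \<Rightarrow> complex) \<Rightarrow> ('a \<times> int \<times> 'a) ell2_op" where "mul d = cop (dsym d)"

lemma dsym_Cc: assumes "continuous_map X euclidean d" shows "dsym d \<in> Cc \<G>"
  unfolding dsym_def by (rule cutoff_in_Cc) (use continuous_map_compose[OF rng_cont assms] in \<open>simp add: o_def\<close>)

lemma dsym_eq: "dsym d (y, n, x) = (if y \<in> S \<and> n = 0 \<and> y = x then d y else 0)"
  by (auto simp: dsym_def Z_iff)

lemma mul_coord:
  assumes d: "continuous_map X euclidean d"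
  shows "ell2_coord (blinfun_apply (mul d) \<xi>) \<alpha> = (if \<alpha> \<in> GA then d (fst \<alpha>) * ell2_coord \<xi> \<alpha> else 0)"
proof (cases "\<alpha> \<in> GA")
  case True
  obtain y n x where \<alpha>: "\<alpha> = (y, n, x)" by (metis prod_cases3)
  have y: "y \<in> S" using True by (simp add: \<alpha> arrows_iff)
  have N: "\<beta> \<in> K 0" if "dsym d \<beta> \<noteq> 0" for \<beta>
    using that Z_subset_K[of 0 0 0] by (auto simp: dsym_def split: if_splits)
  have "Krow 0 y = {(0, y)}" using y by (auto simp: Krow_def K_iff)
  then show ?thesis
    unfolding mul_def cop(2)[OF dsym_Cc[OF d]] using True y
    by (simp add: \<alpha> convolution_eq[OF N] dsym_eq)
qed (simp add: mul_def cop(2)[OF dsym_Cc[OF d]] convolution_outside)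

lemma unit_cont: "continuous_map X \<G> (\<lambda>x. (x, 0, x))"
  unfolding continuous_map_def
proof (intro conjI allI impI)
  show "(\<lambda>x. (x, 0, x)) \<in> S \<rightarrow> topspace \<G>" using arrow_unit by simp
  fix W assume W: "openin \<G> W"
  show "openin X {x \<in> S. (x, 0, x) \<in> W}"
  proof (subst openin_subopen, safe)
    fix x assume x: "x \<in> S" "(x, 0, x) \<in> W"
    obtain U V where *: "openin X U" "openin X V" "x \<in> U" "x \<in> V" "DR_basic T U 0 0 V \<subseteq> W"
      using nbhd_basis[OF W x(1) x(1), of 0 0] x(2) by auto
    then have "U \<inter> V \<subseteq> {x \<in> S. (x, 0, x) \<in> W}"
      using openin_subset[OF *(1)] by (auto simp: DR_basic_def)
    then show "\<exists>N. openin X N \<and> x \<in> N \<and> N \<subseteq> {x \<in> S. (x, 0, x) \<in> W}" using * by blast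
  qed
qed

text \<open>Compactness of X makes C0 of the unit space the algebra of all continuous functions,
  transported along x |-> (x, 0, x).\<close>

lemma diagonal_algebra_eq: "diagonal_algebra G = {mul d | d. continuous_map X euclidean d}"
proof -
  have u: "unit_space G \<subseteq> GA" using arrow_unit by (auto simp: unit_space_eq)
  then have tu: "topspace (unit_top G) = unit_space G" by (auto simp: unit_top_def)
  have ui: "continuous_map X (unit_top G) (\<lambda>x. (x, 0, x))"
    unfolding unit_top_def continuous_map_in_subtopology
  proof
    show "continuous_map X \<G> (\<lambda>x. (x, 0, x))" by (rule unit_cont)
    show "(\<lambda>x. (x, 0, x)) \<in> S \<rightarrow> unit_space G" by (auto simp: unit_space_eq)
  qed
  have uf: "continuous_map (unit_top G) X fst"
    unfolding unit_top_def by (rule continuous_map_from_subtopology[OF rng_cont])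
  have "C0 (unit_top G) = dsym ` {d. continuous_map X euclidean d}"
  proof
    show "C0 (unit_top G) \<subseteq> dsym ` {d. continuous_map X euclidean d}"
    proof
      fix f assume f: "f \<in> C0 (unit_top G)"
      have "continuous_map X euclidean (\<lambda>x. f (x, 0, x))"
        using continuous_map_compose[OF ui, of euclidean f] f by (simp add: C0_def o_def)
      moreover have "f = dsym (\<lambda>x. f (x, 0, x))"
      proof (rule ext)
        fix \<alpha> :: "'a \<times> int \<times> 'a"
        obtain y n x where \<alpha>: "\<alpha> = (y, n, x)" by (metis prod_cases3)
        have "f \<beta> = 0" if "\<beta> \<notin> unit_space G" for \<beta> using f that unfolding C0_def tu by blast
        then show "f \<alpha> = dsym (\<lambda>x. f (x, 0, x)) \<alpha>" by (auto simp: \<alpha> dsym_eq unit_space_eq)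
      qed
      ultimately show "f \<in> dsym ` {d. continuous_map X euclidean d}" by blast
    qed
    show "dsym ` {d. continuous_map X euclidean d} \<subseteq> C0 (unit_top G)"
    proof clarify
      fix d :: "'a \<Rightarrow> complex" assume d: "continuous_map X euclidean d"
      have c: "continuous_map (unit_top G) euclidean (dsym d)"
        using continuous_map_from_subtopology[OF CcD(1)[OF dsym_Cc[OF d]]] unfolding unit_top_def .
      have cu: "compact_space (unit_top G)"
      proof -
        have "compactin (unit_top G) ((\<lambda>x. (x, 0, x)) ` S)"
          using image_compactin[OF _ ui] compact_X unfolding compact_space_def .
        moreover have "(\<lambda>x. (x, 0, x)) ` S = topspace (unit_top G)" unfolding tu unit_space_eq by blast
        ultimately show ?thesis by (simp add: compact_space_def)
      qed
      have "compactin (unit_top G) {x \<in> topspace (unit_top G). \<epsilon> \<le> cmod (dsym d x)}" for \<epsilon>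
      proof (rule closedin_compact_space[OF cu])
        have "closedin (unit_top G) {x \<in> topspace (unit_top G). dsym d x \<in> {z. \<epsilon> \<le> cmod z}}"
          by (rule closedin_continuous_map_preimage[OF c]) (auto intro: closed_Collect_le continuous_intros)
        then show "closedin (unit_top G) {x \<in> topspace (unit_top G). \<epsilon> \<le> cmod (dsym d x)}" by simp
      qed
      moreover have "dsym d \<alpha> = 0" if "\<alpha> \<notin> topspace (unit_top G)" for \<alpha>
        using that unfolding tu unit_space_eq by (cases \<alpha>) (auto simp: dsym_eq)
      ultimately show "dsym d \<in> C0 (unit_top G)" using c unfolding C0_def by blast
    qed
  qed
  then show ?thesis
    unfolding diagonal_algebra_def using regular_operators_eq[of "C0 (unit_top G)"] dsym_Cc
    by (auto simp: mul_def image_image)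
qed

text \<open>The closure is handled one variable at a time: sums and products are extended first in
  the right argument with \<open>cop f\<close> on the left, then in the left argument.\<close>

lemma A_concrete_star_algebra: "concrete_star_algebra A (mul (\<lambda>_. 1))"
proof -
  have e: "(\<lambda>_. 1) = (\<lambda>_::'a. 1::complex)" "continuous_map X euclidean (\<lambda>_. 1::complex)" by auto
  have eA: "mul (\<lambda>_. 1) \<in> A" unfolding mul_def by (intro cop_in_A dsym_Cc e)
  have cl: "complex_linear a" if "a \<in> A" for a using A_equivariant[OF that] equivariantD(1) by blast
  have cont: "\<phi> ` A \<subseteq> A" if "continuous_on A \<phi>" "\<And>f. f \<in> Cc \<G> \<Longrightarrow> \<phi> (cop f) \<in> A" for \<phi>
  proof -
    have "\<phi> ` closure (cop ` Cc \<G>) \<subseteq> closure (\<phi> ` cop ` Cc \<G>)"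
      using that(1) unfolding A_eq by (rule image_closure_subset[OF _ closed_closure closure_subset])
    also have "\<dots> \<subseteq> A" using that(2) unfolding A_eq by (intro closure_minimal closed_closure) blast
    finally show ?thesis unfolding A_eq .
  qed
  have add1: "cop f + b \<in> A" if f: "f \<in> Cc \<G>" and b: "b \<in> A" for f b
  proof -
    have "(\<lambda>b. cop f + b) ` A \<subseteq> A"
    proof (rule cont)
      show "continuous_on A (\<lambda>b. cop f + b)" by (intro continuous_intros)
    qed (simp add: f cop_add Cc_add cop_in_A)
    then show ?thesis using b by blast
  qed
  have add: "a + b \<in> A" if a: "a \<in> A" and b: "b \<in> A" for a b
  proof -
    have "(\<lambda>a. a + b) ` A \<subseteq> A"
    proof (rule cont)
      show "continuous_on A (\<lambda>a. a + b)" by (intro continuous_intros)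
    qed (simp add: add1 b)
    then show ?thesis using a by blast
  qed
  have mult1: "cop f o\<^sub>L b \<in> A" if f: "f \<in> Cc \<G>" and b: "b \<in> A" for f b
  proof -
    have "(\<lambda>b. cop f o\<^sub>L b) ` A \<subseteq> A"
    proof (rule cont)
      show "continuous_on A (\<lambda>b. cop f o\<^sub>L b)"
        by (rule linear_continuous_on, rule bounded_bilinear.bounded_linear_right[OF bounded_bilinear_blinfun_compose])
    qed (simp add: f cop_comp Cc_convolution cop_in_A)
    then show ?thesis using b by blast
  qed
  have mult: "a o\<^sub>L b \<in> A" if a: "a \<in> A" and b: "b \<in> A" for a b
  proof -
    have "(\<lambda>a. a o\<^sub>L b) ` A \<subseteq> A"
    proof (rule cont)
      show "continuous_on A (\<lambda>a. a o\<^sub>L b)"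
        by (rule linear_continuous_on, rule bounded_bilinear.bounded_linear_left[OF bounded_bilinear_blinfun_compose])
    qed (simp add: mult1 b)
    then show ?thesis using a by blast
  qed
  have scl: "op_scaleC c a \<in> A" if a: "a \<in> A" for a c
  proof -
    have "bounded_linear (op_scaleC c :: ('a \<times> int \<times> 'a) ell2_op \<Rightarrow> _)"
    proof (rule bounded_linear_intro[of _ "cmod c"])
      show "norm (op_scaleC c x) \<le> norm x * cmod c" for x :: "('a \<times> int \<times> 'a) ell2_op"
      proof (rule norm_blinfun_bound)
        fix \<xi> show "norm (blinfun_apply (op_scaleC c x) \<xi>) \<le> norm x * cmod c * norm \<xi>"
          using mult_left_mono[OF norm_blinfun[of x \<xi>], of "cmod c"]
          by (simp add: op_scaleC_apply ell2_norm_scaleC mult_ac)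
      qed simp
    qed (auto intro!: blinfun_eqI ell2_eqI simp: op_scaleC_apply blinfun.add_left blinfun.scaleR_left ell2_coord_simps distrib_left)
    then show ?thesis
      using cont[of "op_scaleC c"] a Cc_cmult cop_scaleC cop_in_A by (auto intro: linear_continuous_on)
  qed
  have star: "op_star a \<in> A" if a: "a \<in> A" for a
  proof -
    have "continuous_on A op_star"
      unfolding continuous_on_iff
    proof (intro ballI allI impI)
      fix x and e :: real assume x: "x \<in> A" and e: "0 < e"
      have "dist (op_star y) (op_star x) \<le> dist y x" if "y \<in> A" for y
        using op_star_all(3)[of "y - x"] cl[OF that] cl[OF x] by (simp add: dist_norm op_star_diff complex_linear_simps)
      then show "\<exists>d>0. \<forall>x'\<in>A. dist x' x < d \<longrightarrow> dist (op_star x') (op_star x) < e"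
        using e by (meson order_le_less_trans)
    qed
    then show ?thesis using cont[of op_star] a Cc_star op_star_cop cop_in_A by auto
  qed
  \<comment> \<open>\<open>mul (\<lambda>_. 1)\<close> is the projection onto the vectors supported
    on arrows, and an equivariant matrix has no entries elsewhere.\<close>
  have unit: "mul (\<lambda>_. 1) o\<^sub>L a = a \<and> a o\<^sub>L mul (\<lambda>_. 1) = a" if a: "a \<in> A" for a
  proof
    note E = A_equivariant[OF a]
    show "mul (\<lambda>_. 1) o\<^sub>L a = a"
    proof (rule complex_linear_eqI)
      fix \<alpha> \<beta> :: "'a \<times> int \<times> 'a"
      show "ell2_coord (blinfun_apply (mul (\<lambda>_. 1) o\<^sub>L a) (ell2_delta \<beta>)) \<alpha> = ell2_coord (blinfun_apply a (ell2_delta \<beta>)) \<alpha>"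
        by (cases \<alpha>; cases \<beta>) (auto simp: mul_coord[OF e(2)] equivariantD(2)[OF E])
    qed (use cl[OF a] cl[OF eA] in auto)
    show "a o\<^sub>L mul (\<lambda>_. 1) = a"
    proof (rule complex_linear_eqI)
      fix \<alpha> \<beta> :: "'a \<times> int \<times> 'a"
      have "blinfun_apply (mul (\<lambda>_. 1)) (ell2_delta \<beta>) = (if \<beta> \<in> GA then ell2_delta \<beta> else 0)"
        by (rule ell2_eqI) (auto simp: mul_coord[OF e(2)] ell2_delta.rep_eq zero_ell2.rep_eq)
      then show "ell2_coord (blinfun_apply (a o\<^sub>L mul (\<lambda>_. 1)) (ell2_delta \<beta>)) \<alpha> = ell2_coord (blinfun_apply a (ell2_delta \<beta>)) \<alpha>"
        by (cases \<alpha>; cases \<beta>) (auto simp: equivariantD(2)[OF E] zero_ell2.rep_eq)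
    qed (use cl[OF a] cl[OF eA] in auto)
  qed
  have "op_star (mul (\<lambda>_. 1)) = mul (\<lambda>_. 1)"
  proof -
    have "(\<lambda>(y, n, x). cnj (dsym (\<lambda>_. 1) (x, - n, y))) = (dsym (\<lambda>_. 1) :: 'a \<times> int \<times> 'a \<Rightarrow> complex)"
      by (auto simp: dsym_eq fun_eq_iff)
    then show ?thesis unfolding mul_def by (simp add: op_star_cop[OF dsym_Cc[OF e(2)]])
  qed
  moreover have "closed A" unfolding A_eq by simp
  ultimately show ?thesis
    unfolding concrete_star_algebra_def by (intro conjI ballI allI eA cl star scl add mult) (simp_all only: unit)
qed

end

subsection \<open>Groups of automorphisms\<close>

lemma star_automorphisms_id:
  assumes "concrete_star_algebra A e" shows "(\<lambda>a\<in>A. a) \<in> star_automorphisms A"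
  using concrete_star_algebraD[OF assms] by (simp add: star_automorphisms_def id_Bij)

lemma star_automorphisms_compose:
  assumes A: "concrete_star_algebra A e" and "\<phi> \<in> star_automorphisms A" "\<psi> \<in> star_automorphisms A"
  shows "compose A \<phi> \<psi> \<in> star_automorphisms A"
  using concrete_star_algebraD[OF A] star_automorphismsD[OF assms(2)] star_automorphismsD[OF assms(3)]
  by (simp add: star_automorphisms_def compose_Bij compose_eq)

lemma Bij_inv_simps:
  assumes "f \<in> Bij A" "a \<in> A"
  shows "f a \<in> A" "restrict (inv_into A f) A a \<in> A" "f (restrict (inv_into A f) A a) = a"
    "restrict (inv_into A f) A (f a) = a" "inv_into A f a \<in> A" "f (inv_into A f a) = a" "inv_into A f (f a) = a"
  using assms by (auto simp: Bij_def bij_betw_def inv_into_into f_inv_into_f)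

lemma star_automorphisms_inv:
  assumes A: "concrete_star_algebra A e" and p: "\<phi> \<in> star_automorphisms A"
  shows "restrict (inv_into A \<phi>) A \<in> star_automorphisms A" (is "?\<psi> \<in> _")
proof -
  note D = concrete_star_algebraD[OF A] and P = star_automorphismsD[OF p]
  note I = Bij_inv_simps[OF P(1)]
  have eq: "?\<psi> a = b" if "b \<in> A" "\<phi> b = a" for a b using I(4)[OF that(1)] that(2) by simp
  have "?\<psi> (a + b) = ?\<psi> a + ?\<psi> b" "?\<psi> (a o\<^sub>L b) = ?\<psi> a o\<^sub>L ?\<psi> b" if "a \<in> A" "b \<in> A" for a b
    using that by (intro eq D I(2); simp only: P D I)+
  moreover have "?\<psi> (op_scaleC c a) = op_scaleC c (?\<psi> a)" "?\<psi> (op_star a) = op_star (?\<psi> a)" if "a \<in> A" for a c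
    using that by (intro eq D I(2); simp only: P D I)+
  ultimately show ?thesis
    unfolding star_automorphisms_def using restrict_inv_into_Bij[OF P(1)] by blast
qed

context compact_DR_system
begin

abbreviation "CX d \<equiv> continuous_map X euclidean (d :: 'a \<Rightarrow> complex)"
abbreviation "D \<equiv> diagonal_algebra (DR_groupoid X T)"

lemma A_complex_linear: "a \<in> A \<Longrightarrow> complex_linear a"
  using A_equivariant equivariantD(1) by blast

lemmas A_closed = concrete_star_algebraD[OF A_concrete_star_algebra]

lemma mul_in_A: "CX d \<Longrightarrow> mul d \<in> A"
  unfolding mul_def by (intro cop_in_A dsym_Cc)

lemma mul_in_D: "CX d \<Longrightarrow> mul d \<in> D"
  unfolding diagonal_algebra_eq by blast

lemma D_subset_A: "D \<subseteq> A"
  unfolding diagonal_algebra_eq using mul_in_A by blast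

lemma sym_mul: "CX d \<Longrightarrow> sym (mul d) = dsym d"
  unfolding mul_def by (intro sym_cop dsym_Cc)

lemma mul_cong: "(\<And>x. x \<in> S \<Longrightarrow> d x = d' x) \<Longrightarrow> mul d = mul d'"
proof -
  assume "\<And>x. x \<in> S \<Longrightarrow> d x = d' x"
  then have "dsym d = dsym d'" by (auto simp: dsym_def Z_iff fun_eq_iff)
  then show ?thesis by (simp add: mul_def)
qed

lemma mul_eqD: "mul d = mul d' \<Longrightarrow> CX d \<Longrightarrow> CX d' \<Longrightarrow> x \<in> S \<Longrightarrow> d x = d' x"
  using sym_mul[of d] sym_mul[of d'] by (metis dsym_eq)

lemma mul_add: "CX d \<Longrightarrow> CX d' \<Longrightarrow> mul d + mul d' = mul (\<lambda>x. d x + d' x)"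
  by (rule blinfun_eqI, rule ell2_eqI)
    (simp add: blinfun.add_left plus_ell2.rep_eq mul_coord continuous_map_add distrib_right)

lemma CX_mult: "CX d \<Longrightarrow> CX d' \<Longrightarrow> CX (\<lambda>x. d x * d' x)"
  unfolding continuous_map_atin by (auto intro: tendsto_mult)

lemma mul_comp: "CX d \<Longrightarrow> CX d' \<Longrightarrow> mul d o\<^sub>L mul d' = mul (\<lambda>x. d x * d' x)"
  by (rule blinfun_eqI, rule ell2_eqI) (simp add: mul_coord CX_mult)

lemma mul_scaleC: "CX d \<Longrightarrow> op_scaleC c (mul d) = mul (\<lambda>x. c * d x)"
  by (rule blinfun_eqI, rule ell2_eqI) (simp add: mul_coord CX_mult op_scaleC_apply ell2_scaleC.rep_eq)

lemma sym_mul_left: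
  assumes "CX d" "a \<in> A" shows "sym (mul d o\<^sub>L a) (y, n, x) = d y * sym a (y, n, x)"
proof (cases "(y, n, x) \<in> GA")
  case False
  have "mul d o\<^sub>L a \<in> A" by (intro A_closed mul_in_A assms)
  then show ?thesis using False sym_outside A_equivariant assms(2) by (metis mult_zero_right)
qed (simp add: sym_def mul_coord assms)

lemma mul_delta: "CX d \<Longrightarrow> x \<in> S \<Longrightarrow> blinfun_apply (mul d) (ell2_delta (x, 0, x)) = ell2_scaleC (d x) (ell2_delta (x, 0, x))"
  by (rule ell2_eqI) (auto simp: mul_coord ell2_delta.rep_eq ell2_scaleC.rep_eq arrow_unit)

lemma sym_mul_right:
  assumes "CX d" "a \<in> A" shows "sym (a o\<^sub>L mul d) (y, n, x) = sym a (y, n, x) * d x"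
proof (cases "(y, n, x) \<in> GA")
  case False
  have "a o\<^sub>L mul d \<in> A" by (intro A_closed mul_in_A assms)
  then show ?thesis using False sym_outside A_equivariant assms(2) by (metis mult_zero_left)
next
  case True
  then have "x \<in> S" by (simp add: arrows_iff)
  then show ?thesis
    by (simp add: sym_def mul_delta assms complex_linearD[OF A_complex_linear] ell2_scaleC.rep_eq mult.commute)
qed

text \<open>For general elements of \<open>A\<close> the convolution of symbols need not be a finite
  sum. Only the factorisation of the arrow is extracted, from a row of the matrix.\<close>

lemma sym_comp_nonzero:
  assumes a: "a \<in> A" and b: "b \<in> A" and nz: "sym (a o\<^sub>L b) (y, n, x) \<noteq> 0"
  obtains w m where "sym a (y, n - m, w) \<noteq> 0" "sym b (w, m, x) \<noteq> 0"
proof -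
  let ?v = "blinfun_apply b (ell2_delta (x, 0, x))"
  have "ell2_coord (blinfun_apply a ?v) (y, n, x) \<noteq> 0" using nz by (simp add: sym_def)
  then obtain \<beta> where \<beta>: "ell2_coord ?v \<beta> \<noteq> 0" "ell2_coord (blinfun_apply a (ell2_delta \<beta>)) (y, n, x) \<noteq> 0"
    using complex_linear_row_zero[OF A_complex_linear[OF a]] by blast
  obtain w m x' where b': "\<beta> = (w, m, x')" by (metis prod_cases3)
  have "sym b (w, m, x) \<noteq> 0" "x' = x"
    using \<beta>(1) unfolding b' equivariantD(2)[OF A_equivariant[OF b]] by (auto split: if_splits)
  moreover have "sym a (y, n - m, w) \<noteq> 0"
    using \<beta>(2) unfolding b' equivariantD(2)[OF A_equivariant[OF a]] by (auto split: if_splits)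
  ultimately show thesis using that by blast
qed

lemma diagonal_of_sym:
  assumes a: "a \<in> A" and u: "\<And>y n x. sym a (y, n, x) \<noteq> 0 \<Longrightarrow> n = 0 \<and> y = x"
  shows "CX (\<lambda>x. sym a (x, 0, x))" "a = mul (\<lambda>x. sym a (x, 0, x))"
proof -
  show c: "CX (\<lambda>x. sym a (x, 0, x))"
    using continuous_map_compose[OF unit_cont A_sym_continuous[OF a]] by (simp add: o_def)
  show "a = mul (\<lambda>x. sym a (x, 0, x))"
  proof (rule equivariant_eqI)
    show "sym a = sym (mul (\<lambda>x. sym a (x, 0, x)))"
    proof (rule ext)
      fix \<alpha> :: "'a \<times> int \<times> 'a"
      obtain y n x where \<alpha>: "\<alpha> = (y, n, x)" by (metis prod_cases3)
      have "sym a \<alpha> = 0" if "\<alpha> \<notin> GA" using that a A_equivariant sym_outside by blast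
      then show "sym a \<alpha> = sym (mul (\<lambda>x. sym a (x, 0, x))) \<alpha>"
        using u[of y n x] unfolding sym_mul[OF c] \<alpha> dsym_eq by (auto simp: arrows_iff)
    qed
  qed (use a c mul_in_A A_equivariant in blast)+
qed

lemma cutoff:
  assumes "openin X V" "x \<in> V"
  obtains e where "CX e" "e x = 1" "\<And>z. z \<in> S \<Longrightarrow> z \<notin> V \<Longrightarrow> e z = 0"
proof -
  have x: "x \<in> S" using assms openin_subset by blast
  have "normal_space X" using compact_X Hausdorff_X compact_Hausdorff_or_regular_imp_normal_space by blast
  moreover have "closedin X {x}" using x Hausdorff_X by (simp add: closedin_Hausdorff_sing_eq)
  moreover have "closedin X (S - V)" using assms(1) by blast
  moreover have "disjnt (S - V) {x}" using assms(2) by simp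
  ultimately obtain f where f: "continuous_map X euclideanreal f" "f ` (S - V) \<subseteq> {0}" "f ` {x} \<subseteq> {1}"
    using Urysohn_lemma_alt[of X "S - V" "{x}" 0 1] by metis
  show thesis
  proof (rule that[of "\<lambda>z. complex_of_real (f z)"])
    show "CX (\<lambda>z. complex_of_real (f z))"
      using f(1) unfolding continuous_map_atin by (auto intro: tendsto_of_real)
  qed (use f in auto)
qed

lemma separation:
  assumes "x \<in> S" "y \<in> S" "\<And>d. CX d \<Longrightarrow> d x = d y" shows "x = y"
proof (rule ccontr)
  assume "x \<noteq> y"
  have "openin X (S - {y})" using assms(2) Hausdorff_X by (simp add: closedin_Hausdorff_sing_eq openin_diff)
  moreover have "x \<in> S - {y}" using assms(1) \<open>x \<noteq> y\<close> by simp
  ultimately obtain e where e: "CX e" "e x = 1" "\<And>z. z \<in> S \<Longrightarrow> z \<notin> S - {y} \<Longrightarrow> e z = 0"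
    using cutoff[of "S - {y}" x] by blast
  have "e y = 0" using e(3)[OF assms(2)] by simp
  then show False using assms(3)[OF e(1)] e(2) by simp
qed

text \<open>Otherwise each point x has a function in the kernel of \<omega> that does not vanish at
  x. By compactness finitely many of them have no common zero, and the sum of their squared moduli
  is an invertible element of the kernel. The assumption \<open>cong\<close> reflects that functions
  matter only on X.\<close>

lemma character_is_evaluation:
  assumes add: "\<And>d d'. CX d \<Longrightarrow> CX d' \<Longrightarrow> \<omega> (\<lambda>x. d x + d' x) = \<omega> d + (\<omega> d' :: complex)"
    and mult: "\<And>d d'. CX d \<Longrightarrow> CX d' \<Longrightarrow> \<omega> (\<lambda>x. d x * d' x) = \<omega> d * \<omega> d'"
    and const: "\<And>c. \<omega> (\<lambda>_. c) = c"
    and cong: "\<And>d d'. (\<And>x. x \<in> S \<Longrightarrow> d x = d' x) \<Longrightarrow> \<omega> d = \<omega> d'"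
  shows "\<exists>x\<in>S. \<forall>d. CX d \<longrightarrow> \<omega> d = d x"
proof (rule ccontr)
  assume "\<not> ?thesis"
  then have "\<exists>d. CX d \<and> \<omega> d \<noteq> d x" if "x \<in> S" for x using that by blast
  then obtain d where d: "\<And>x. x \<in> S \<Longrightarrow> CX (d x) \<and> \<omega> (d x) \<noteq> d x x" by metis
  define f where "f x = (\<lambda>z. d x z + (- \<omega> (d x)))" for x
  have f: "CX (f x)" "\<omega> (f x) = 0" "f x x \<noteq> 0" if "x \<in> S" for x
  proof -
    show "CX (f x)" unfolding f_def using d[OF that] by (intro continuous_map_add) auto
    have "\<omega> (f x) = \<omega> (d x) + \<omega> (\<lambda>_. - \<omega> (d x))" unfolding f_def using d[OF that] by (intro add) auto
    then show "\<omega> (f x) = 0" by (simp add: const)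
    show "f x x \<noteq> 0" unfolding f_def using d[OF that] by auto
  qed
  define U where "U x = {z \<in> S. f x z \<in> - {0}}" for x
  have U: "openin X (U x)" "x \<in> U x" if "x \<in> S" for x
  proof -
    show "openin X (U x)" unfolding U_def by (rule openin_continuous_map_preimage[OF f(1)[OF that]]) auto
    show "x \<in> U x" unfolding U_def using f(3)[OF that] that by simp
  qed
  have "\<forall>V\<in>U ` S. openin X V" "S \<subseteq> \<Union>(U ` S)" using U by blast+
  then obtain F where F: "finite F" "F \<subseteq> U ` S" "S \<subseteq> \<Union>F"
    using compact_X unfolding compact_space_alt by metis
  then obtain I where I: "finite I" "I \<subseteq> S" "F = U ` I" by (meson finite_subset_image)
  define g where "g J = (\<lambda>z. \<Sum>x\<in>J. f x z * cnj (f x z))" for J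
  have cnjf: "CX (\<lambda>z. cnj (f x z))" if "x \<in> S" for x
    using f(1)[OF that] unfolding continuous_map_atin by (auto intro: tendsto_cnj)
  have g: "CX (g J) \<and> \<omega> (g J) = 0" if "J \<subseteq> S" "finite J" for J
    using that(2,1)
  proof (induction J)
    case empty then show ?case by (simp add: g_def const)
  next
    case (insert x J)
    have eq: "g (insert x J) = (\<lambda>z. f x z * cnj (f x z) + g J z)" unfolding g_def using insert by auto
    have c: "CX (\<lambda>z. f x z * cnj (f x z))" using insert f(1) cnjf by (intro CX_mult) auto
    have "\<omega> (\<lambda>z. f x z * cnj (f x z)) = 0" using mult[of "f x" "\<lambda>z. cnj (f x z)"] insert f cnjf by auto
    then show ?case unfolding eq using insert c add[OF c, of "g J"] by (auto intro: continuous_map_add)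
  qed
  have gn: "g I z \<noteq> 0" if "z \<in> S" for z
  proof -
    have "\<exists>x\<in>I. f x z \<noteq> 0" using F(3) I(3) that unfolding U_def by auto
    then obtain x where x: "x \<in> I" "f x z \<noteq> 0" by blast
    have "g I z = complex_of_real (\<Sum>x\<in>I. (cmod (f x z))\<^sup>2)"
      unfolding g_def by (simp only: of_real_sum complex_norm_square)
    moreover have "0 < (\<Sum>x\<in>I. (cmod (f x z))\<^sup>2)" using x I(1) by (intro sum_pos2[of I x]) auto
    ultimately show ?thesis by (simp only: of_real_eq_0_iff)
  qed
  have gI: "CX (g I)" "\<omega> (g I) = 0" using g I by auto
  have inv: "CX (\<lambda>z. inverse (g I z))"
    using gI(1) gn unfolding continuous_map_atin by (auto intro: tendsto_inverse)
  have "1 = \<omega> (\<lambda>z. g I z * inverse (g I z))" using gn const[of 1] cong[of "\<lambda>z. g I z * inverse (g I z)" "\<lambda>_. 1"] by simp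
  also have "\<dots> = 0" using mult[OF gI(1) inv] gI(2) by simp
  finally show False by simp
qed

text \<open>Functions are composed with the inverse of h, so that h moves supports forward and
  passing from \<phi> to h respects composition.\<close>

definition implements :: "(('a \<times> int \<times> 'a) ell2_op \<Rightarrow> ('a \<times> int \<times> 'a) ell2_op) \<Rightarrow> ('a \<Rightarrow> 'a) \<Rightarrow> bool"
  where "implements \<phi> h \<longleftrightarrow> h \<in> Bij S \<and> homeomorphic_map X X h \<and>
    (\<forall>d. CX d \<longrightarrow> \<phi> (mul d) = mul (\<lambda>x. d (inv_into S h x)))"

context
  fixes \<phi> assumes \<phi>: "\<phi> \<in> star_automorphisms A" and \<phi>D: "\<phi> ` D = D"
begin

text \<open>For fixed y, the value at y of the image of \<open>mul d\<close> is a unital character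
  in d, hence evaluation at a point g y. Continuity of g is tested with cutoff functions, whose
  images are continuous.\<close>

lemma diagonal_pullback: "\<exists>g. continuous_map X X g \<and> (\<forall>d. CX d \<longrightarrow> \<phi> (mul d) = mul (\<lambda>x. d (g x)))"
proof -
  note P = star_automorphismsD[OF \<phi>]
  have "\<exists>d'. CX d' \<and> \<phi> (mul d) = mul d'" if "CX d" for d
    using mul_in_D[OF that] \<phi>D unfolding diagonal_algebra_eq by blast
  then obtain F where F: "\<And>d. CX d \<Longrightarrow> CX (F d) \<and> \<phi> (mul d) = mul (F d)" by metis
  have ev: "sym (\<phi> (mul d)) (y, 0, y) = F d y" if "CX d" "y \<in> S" for d y
    using F[OF that(1)] that(2) by (simp add: sym_mul dsym_eq)
  have "\<exists>x\<in>S. \<forall>d. CX d \<longrightarrow> sym (\<phi> (mul d)) (y, 0, y) = d x" if y: "y \<in> S" for y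
  proof (rule character_is_evaluation)
    fix d d' assume d: "CX d" "CX d'"
    have "\<phi> (mul (\<lambda>x. d x + d' x)) = mul (F d) + mul (F d')"
      using d F P(3)[of "mul d" "mul d'"] by (simp add: mul_add mul_in_A)
    also have "\<dots> = mul (\<lambda>x. F d x + F d' x)" using F d by (simp add: mul_add)
    finally show "sym (\<phi> (mul (\<lambda>x. d x + d' x))) (y, 0, y) = sym (\<phi> (mul d)) (y, 0, y) + sym (\<phi> (mul d')) (y, 0, y)"
      using F d y by (simp add: sym_mul dsym_eq continuous_map_add)
    have "\<phi> (mul (\<lambda>x. d x * d' x)) = mul (F d) o\<^sub>L mul (F d')"
      using d F P(5)[of "mul d" "mul d'"] by (simp add: mul_comp mul_in_A)
    also have "\<dots> = mul (\<lambda>x. F d x * F d' x)" using F d by (simp add: mul_comp)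
    finally show "sym (\<phi> (mul (\<lambda>x. d x * d' x))) (y, 0, y) = sym (\<phi> (mul d)) (y, 0, y) * sym (\<phi> (mul d')) (y, 0, y)"
      using F d y by (simp add: sym_mul dsym_eq CX_mult)
  next
    fix c :: complex
    have "\<phi> (mul (\<lambda>_. 1)) = mul (\<lambda>_. 1)" by (rule star_automorphism_unit[OF A_concrete_star_algebra \<phi>])
    then have "\<phi> (mul (\<lambda>_. c)) = mul (\<lambda>_. c)"
      using P(4)[of "mul (\<lambda>_. 1)" c] mul_scaleC[of "\<lambda>_. 1" c] by (simp add: mul_in_A)
    then show "sym (\<phi> (mul (\<lambda>_. c))) (y, 0, y) = c" using y by (simp add: sym_mul dsym_eq)
  next
    fix d d' :: "'a \<Rightarrow> complex" assume "\<And>x. x \<in> S \<Longrightarrow> d x = d' x"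
    then show "sym (\<phi> (mul d)) (y, 0, y) = sym (\<phi> (mul d')) (y, 0, y)" using mul_cong by metis
  qed
  then obtain g where g: "\<And>y. y \<in> S \<Longrightarrow> g y \<in> S \<and> (\<forall>d. CX d \<longrightarrow> sym (\<phi> (mul d)) (y, 0, y) = d (g y))" by metis
  have Fg: "F d y = d (g y)" if "CX d" "y \<in> S" for d y using g[OF that(2)] ev[OF that] that(1) by simp
  have "continuous_map X X g"
    unfolding continuous_map_def
  proof (intro conjI allI impI)
    fix V assume V: "openin X V"
    show "openin X {x \<in> S. g x \<in> V}"
    proof (subst openin_subopen, safe)
      fix y assume y: "y \<in> S" "g y \<in> V"
      obtain e where e: "CX e" "e (g y) = 1" "\<And>z. z \<in> S \<Longrightarrow> z \<notin> V \<Longrightarrow> e z = 0" using cutoff[OF V y(2)] by blast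
      have "CX (F e)" using F[OF e(1)] by blast
      then have "openin X {z \<in> S. F e z \<in> - {0}}" by (rule openin_continuous_map_preimage) auto
      moreover have "{z \<in> S. F e z \<in> - {0}} \<subseteq> {x \<in> S. g x \<in> V}"
      proof
        fix z assume "z \<in> {z \<in> S. F e z \<in> - {0}}"
        then have z: "z \<in> S" "F e z \<noteq> 0" by auto
        then have "e (g z) \<noteq> 0" using Fg[OF e(1) z(1)] by simp
        then have "g z \<in> V" using e(3)[of "g z"] g[OF z(1)] by blast
        then show "z \<in> {x \<in> S. g x \<in> V}" using z(1) by simp
      qed
      moreover have "y \<in> {z \<in> S. F e z \<in> - {0}}" using y Fg[OF e(1) y(1)] e(2) by simp
      ultimately show "\<exists>W. openin X W \<and> y \<in> W \<and> W \<subseteq> {x \<in> S. g x \<in> V}" by blast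
    qed
  qed (use g in auto)
  moreover have "\<phi> (mul d) = mul (\<lambda>x. d (g x))" if "CX d" for d
    using F[OF that] mul_cong[of "F d" "\<lambda>x. d (g x)"] Fg[OF that] by simp
  ultimately show ?thesis by blast
qed

end

lemma CX_compose: "CX d \<Longrightarrow> continuous_map X X g \<Longrightarrow> CX (\<lambda>x. d (g x))"
  using continuous_map_compose[of X X g euclidean d] by (simp add: o_def)

lemma image_inv_Bij:
  assumes "\<phi> \<in> Bij A'" "\<phi> ` B' = B'" "B' \<subseteq> A'" shows "restrict (inv_into A' \<phi>) A' ` B' = B'"
proof -
  have "restrict (inv_into A' \<phi>) A' ` (\<phi> ` B') = (\<lambda>x. x) ` B'"
    unfolding image_image using Bij_inv_simps(4)[OF assms(1)] assms(3) by (intro image_cong refl) blast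
  then show ?thesis by (simp only: assms(2) image_ident)
qed

text \<open>The pullbacks g of \<phi> and k of its inverse are mutually inverse because continuous
  functions separate points. With the convention of \<open>implements\<close>, it is k that serves
  as h.\<close>

lemma implements_exists:
  assumes \<phi>: "\<phi> \<in> star_automorphisms A" and \<phi>D: "\<phi> ` D = D"
  shows "\<exists>h. implements \<phi> h"
proof -
  let ?\<psi> = "restrict (inv_into A \<phi>) A"
  have \<psi>: "?\<psi> \<in> star_automorphisms A" by (rule star_automorphisms_inv[OF A_concrete_star_algebra \<phi>])
  note B = star_automorphismsD(1)[OF \<phi>]
  have \<psi>D: "?\<psi> ` D = D" by (rule image_inv_Bij[OF B \<phi>D D_subset_A])
  obtain g where g: "continuous_map X X g" "\<And>d. CX d \<Longrightarrow> \<phi> (mul d) = mul (\<lambda>x. d (g x))"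
    using diagonal_pullback[OF \<phi> \<phi>D] by blast
  obtain k where k: "continuous_map X X k" "\<And>d. CX d \<Longrightarrow> ?\<psi> (mul d) = mul (\<lambda>x. d (k x))"
    using diagonal_pullback[OF \<psi> \<psi>D] by blast
  have gS: "g x \<in> S" "k x \<in> S" if "x \<in> S" for x
    using g(1) k(1) that by (auto simp: continuous_map_def)
  have gk: "g (k x) = x" if x: "x \<in> S" for x
  proof (rule separation)
    fix d assume d: "CX d"
    have "mul d = ?\<psi> (\<phi> (mul d))" using Bij_inv_simps(4)[OF B mul_in_A[OF d]] by simp
    also have "\<dots> = mul (\<lambda>x. d (g (k x)))" using g d k(2)[of "\<lambda>x. d (g x)"] CX_compose by simp
    finally show "d (g (k x)) = d x" by (intro mul_eqD[OF _ CX_compose[OF CX_compose[OF d g(1)] k(1)] d x]) simp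
  qed (use gS x in auto)
  have kg: "k (g x) = x" if x: "x \<in> S" for x
  proof (rule separation)
    fix d assume d: "CX d"
    have "mul d = \<phi> (?\<psi> (mul d))" using Bij_inv_simps(3)[OF B mul_in_A[OF d]] by simp
    also have "\<dots> = mul (\<lambda>x. d (k (g x)))" using k d g(2)[of "\<lambda>x. d (k x)"] CX_compose by simp
    finally show "d (k (g x)) = d x" by (intro mul_eqD[OF _ CX_compose[OF CX_compose[OF d k(1)] g(1)] d x]) simp
  qed (use gS x in auto)
  let ?h = "restrict k S"
  have hB: "?h \<in> Bij S"
    unfolding Bij_def using gS gk kg
    by (auto intro!: bij_betw_byWitness[of _ g] simp: extensional_def)
  have hi: "inv_into S ?h x = g x" if "x \<in> S" for x
  proof -
    have "inv_into S ?h (?h (g x)) = g x" using Bij_inv_simps(7)[OF hB] gS that by blast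
    then show ?thesis using kg gS that by simp
  qed
  have "homeomorphic_maps X X k g" using g(1) k(1) gk kg by (simp add: homeomorphic_maps_def)
  then have "homeomorphic_map X X k" using homeomorphic_maps_map by blast
  then have "homeomorphic_map X X ?h" by (rule homeomorphic_map_eq) simp
  moreover have "\<phi> (mul d) = mul (\<lambda>x. d (inv_into S ?h x))" if "CX d" for d
    unfolding g(2)[OF that] by (rule mul_cong) (simp only: hi)
  ultimately show ?thesis using hB unfolding implements_def by blast
qed

lemma homeo_inv_cont:
  assumes "homeomorphic_map X X h" shows "continuous_map X X (inv_into S h)"
proof -
  have "homeomorphic_map X X (restrict (inv_into S h) S)" by (rule homeomorphic_map_restrict_inv[OF assms])
  then have "continuous_map X X (restrict (inv_into S h) S)" using homeomorphic_imp_continuous_map by blast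
  then show ?thesis by (rule continuous_map_eq) simp
qed

lemma implements_unique:
  assumes "implements \<phi> h" "implements \<phi> h'" shows "h = h'"
proof -
  have B: "h \<in> Bij S" "h' \<in> Bij S" and c: "continuous_map X X (inv_into S h)" "continuous_map X X (inv_into S h')"
    using assms homeo_inv_cont unfolding implements_def by blast+
  have "inv_into S h x = inv_into S h' x" if x: "x \<in> S" for x
  proof (rule separation)
    fix d assume d: "CX d"
    have "mul (\<lambda>x. d (inv_into S h x)) = mul (\<lambda>x. d (inv_into S h' x))"
      using assms d unfolding implements_def by metis
    then show "d (inv_into S h x) = d (inv_into S h' x)" by (rule mul_eqD[OF _ CX_compose[OF d c(1)] CX_compose[OF d c(2)] x])
  qed (rule Bij_inv_simps(5)[OF B(1) x] Bij_inv_simps(5)[OF B(2) x])+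
  then have "h x = h' x" if "x \<in> S" for x using Bij_inv_simps B that by metis
  then show ?thesis using B by (intro extensionalityI[of _ S]) (auto simp: Bij_def)
qed

lemma implements_inv:
  assumes \<phi>: "\<phi> \<in> star_automorphisms A" and i: "implements \<phi> h"
  shows "implements (restrict (inv_into A \<phi>) A) (restrict (inv_into S h) S)"
proof -
  have B: "h \<in> Bij S" and hc: "homeomorphic_map X X h" and eq: "\<And>d. CX d \<Longrightarrow> \<phi> (mul d) = mul (\<lambda>x. d (inv_into S h x))"
    using i unfolding implements_def by auto
  let ?g = "restrict (inv_into S h) S"
  have gB: "?g \<in> Bij S" by (rule restrict_inv_into_Bij[OF B])
  have gi: "inv_into S ?g x = h x" if "x \<in> S" for x
  proof -
    have "inv_into S ?g (?g (h x)) = h x" using Bij_inv_simps(7)[OF gB] Bij_inv_simps(1)[OF B that] by blast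
    then show ?thesis using Bij_inv_simps(4)[OF B that] by simp
  qed
  have hcc: "continuous_map X X h" using hc homeomorphic_imp_continuous_map by blast
  have "restrict (inv_into A \<phi>) A (mul d) = mul (\<lambda>x. d (inv_into S ?g x))" if d: "CX d" for d
  proof -
    have "\<phi> (mul (\<lambda>x. d (h x))) = mul (\<lambda>x. d (h (inv_into S h x)))" using eq[OF CX_compose[OF d hcc]] .
    also have "\<dots> = mul d" by (rule mul_cong) (simp add: Bij_inv_simps(6)[OF B])
    finally have "restrict (inv_into A \<phi>) A (mul d) = mul (\<lambda>x. d (h x))"
      using Bij_inv_simps(4)[OF star_automorphismsD(1)[OF \<phi>] mul_in_A[OF CX_compose[OF d hcc]]] by simp
    also have "\<dots> = mul (\<lambda>x. d (inv_into S ?g x))" by (rule mul_cong) (simp only: gi)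
    finally show ?thesis .
  qed
  then show ?thesis using gB homeomorphic_map_restrict_inv[OF hc] unfolding implements_def by blast
qed

text \<open>Conjugation by \<open>h\<close> carries germs of arrows to germs of arrows, and germs of
  arrows in the kernel of the cocycle to such germs.\<close>

definition admissible :: "('a \<Rightarrow> 'a) \<Rightarrow> bool"
  where "admissible h \<longleftrightarrow> (\<forall>i j. \<forall>y\<in>S. \<forall>x\<in>S. (T ^^ i) y = (T ^^ j) x \<longrightarrow>
    (\<exists>k l V W. openin X V \<and> openin X W \<and> y \<in> V \<and> x \<in> W \<and> (i = j \<longrightarrow> k = l) \<and>
      (\<forall>y'\<in>V. \<forall>x'\<in>W. (T ^^ i) y' = (T ^^ j) x' \<longrightarrow> (T ^^ k) (h y') = (T ^^ l) (h x'))))"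

section \<open>Images of the indicators of \<open>Z i j\<close> under automorphisms\<close>

text \<open>These operators are globally defined and involve no choice of a bisection; bisections
  enter only through the cutoffs in \<open>image_Zop_nonzero\<close>.\<close>

definition Zop :: "nat \<Rightarrow> nat \<Rightarrow> ('a \<times> int \<times> 'a) ell2_op"
  where "Zop i j = cop (\<lambda>\<alpha>. if \<alpha> \<in> Z i j then 1 else 0)"

lemma Zop_Cc: "(\<lambda>\<alpha>. if \<alpha> \<in> Z i j then 1 else 0) \<in> Cc \<G>"
  by (rule cutoff_in_Cc) simp

lemma Zop_in_A: "Zop i j \<in> A" unfolding Zop_def by (rule cop_in_A[OF Zop_Cc])

lemma sym_Zop: "sym (Zop i j) \<alpha> = (if \<alpha> \<in> Z i j then 1 else 0)"
  unfolding Zop_def sym_cop[OF Zop_Cc] ..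

lemma Zop_in_B: "Zop j j \<in> B"
proof -
  have "(\<lambda>\<alpha>. if \<alpha> \<in> Z j j then 1 else 0) \<in> Cc (subtopology \<G> H)"
    using Zop_Cc arrowI[where i = j and j = j] by (auto simp: Cc_H_iff H_iff Z_iff)
  then show ?thesis unfolding B_eq Zop_def by (meson closure_subset imageI subsetD)
qed

context
  fixes \<phi> h
  assumes \<phi>: "\<phi> \<in> star_automorphisms A" and impl: "implements \<phi> h"
begin

abbreviation (input) "hinv \<equiv> inv_into S h"

lemma impl_inv_cont: "continuous_map X X hinv" and impl_cont: "continuous_map X X h"
  and impl_inv_left: "x \<in> S \<Longrightarrow> hinv (h x) = x" and impl_inv_right: "x \<in> S \<Longrightarrow> h (hinv x) = x"
  and impl_in: "x \<in> S \<Longrightarrow> h x \<in> S" and impl_inv_in: "x \<in> S \<Longrightarrow> hinv x \<in> S"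
  and impl_mul: "CX d \<Longrightarrow> \<phi> (mul d) = mul (\<lambda>x. d (hinv x))"
  using impl homeo_inv_cont homeomorphic_imp_continuous_map Bij_inv_simps[of h S x]
  unfolding implements_def by blast+

text \<open>The support condition yields (d o T^i) a = a (d o T^j) for all d in C(X). The
  automorphism carries it to the same relation with d o T^i o h^{-1} and d o T^j o h^{-1}. Where the
  symbol of the image is nonzero, every d must agree at the two points, so they coincide.\<close>

lemma image_commutation:
  assumes a: "a \<in> A" and s: "\<And>y n x. sym a (y, n, x) \<noteq> 0 \<Longrightarrow> (T ^^ i) y = (T ^^ j) x"
    and nz: "sym (\<phi> a) (y, n, x) \<noteq> 0"
  shows "(T ^^ i) (hinv y) = (T ^^ j) (hinv x)"
proof (rule separation)
  have \<phi>a: "\<phi> a \<in> A" using star_automorphismsD(2)[OF \<phi> a] .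
  have "(y, n, x) \<in> GA" using nz sym_outside[OF A_equivariant[OF \<phi>a]] by blast
  then have yx: "y \<in> S" "x \<in> S" by (auto simp: arrows_iff)
  then show "(T ^^ i) (hinv y) \<in> S" "(T ^^ j) (hinv x) \<in> S" using impl_inv_in Tn_in by auto
  fix d assume d: "CX d"
  have di: "CX (\<lambda>x. d ((T ^^ i) x))" "CX (\<lambda>x. d ((T ^^ j) x))" using CX_compose[OF d Tn_cont] by auto
  have "mul (\<lambda>x. d ((T ^^ i) x)) o\<^sub>L a = a o\<^sub>L mul (\<lambda>x. d ((T ^^ j) x))"
  proof (rule equivariant_eqI)
    show "equivariant (mul (\<lambda>x. d ((T ^^ i) x)) o\<^sub>L a)" "equivariant (a o\<^sub>L mul (\<lambda>x. d ((T ^^ j) x)))"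
      by (intro A_equivariant A_closed mul_in_A di a)+
    show "sym (mul (\<lambda>x. d ((T ^^ i) x)) o\<^sub>L a) = sym (a o\<^sub>L mul (\<lambda>x. d ((T ^^ j) x)))"
    proof (rule ext)
      fix \<alpha> :: "'a \<times> int \<times> 'a"
      obtain y n x where \<alpha>: "\<alpha> = (y, n, x)" by (metis prod_cases3)
      show "sym (mul (\<lambda>x. d ((T ^^ i) x)) o\<^sub>L a) \<alpha> = sym (a o\<^sub>L mul (\<lambda>x. d ((T ^^ j) x))) \<alpha>"
        unfolding \<alpha> sym_mul_left[OF di(1) a] sym_mul_right[OF di(2) a] using s[of y n x] by fastforce
    qed
  qed
  then have "\<phi> (mul (\<lambda>x. d ((T ^^ i) x))) o\<^sub>L \<phi> a = \<phi> a o\<^sub>L \<phi> (mul (\<lambda>x. d ((T ^^ j) x)))"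
    using star_automorphismsD(5)[OF \<phi>] a mul_in_A di by metis
  then have "sym (mul (\<lambda>x. d ((T ^^ i) (hinv x))) o\<^sub>L \<phi> a) (y, n, x) = sym (\<phi> a o\<^sub>L mul (\<lambda>x. d ((T ^^ j) (hinv x)))) (y, n, x)"
    by (simp add: impl_mul[OF di(1)] impl_mul[OF di(2)])
  then show "d ((T ^^ i) (hinv y)) = d ((T ^^ j) (hinv x))"
    using nz sym_mul_left[OF CX_compose[OF di(1) impl_inv_cont] \<phi>a] sym_mul_right[OF CX_compose[OF di(2) impl_inv_cont] \<phi>a] by simp
qed

lemma image_Zop_source: "sym (\<phi> (Zop i j)) (y, n, x) \<noteq> 0 \<Longrightarrow> (T ^^ i) (hinv y) = (T ^^ j) (hinv x)"
  by (rule image_commutation[OF Zop_in_A]) (auto simp: sym_Zop Z_iff split: if_splits)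

text \<open>Cutoffs reduce \<open>Zop i j\<close> to an element \<open>c\<close> living on a
  bisection, and \<open>c'\<close> lives on the inverse one. Their product is diagonal with value 1
  at y, so its image has a nonzero entry at h y and \<phi> c a nonzero entry in the row of h y. The
  transported relation and the cutoff near x leave only h x as its source.\<close>

lemma image_Zop_nonzero:
  assumes y: "y \<in> S" and x: "x \<in> S" and eq: "(T ^^ i) y = (T ^^ j) x"
  shows "\<exists>n. sym (\<phi> (Zop i j)) (h y, n, h x) \<noteq> 0"
proof -
  note P = star_automorphismsD[OF \<phi>]
  obtain V0 where V0: "openin X V0" "y \<in> V0" "inj_on (T ^^ i) V0" using Tn_locally_inj[OF y] by blast
  obtain W0 where W0: "openin X W0" "x \<in> W0" "inj_on (T ^^ j) W0" using Tn_locally_inj[OF x] by blast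
  obtain e1 where e1: "CX e1" "e1 y = 1" "\<And>z. z \<in> S \<Longrightarrow> z \<notin> V0 \<Longrightarrow> e1 z = 0" using cutoff[OF V0(1,2)] by blast
  obtain e2 where e2: "CX e2" "e2 x = 1" "\<And>z. z \<in> S \<Longrightarrow> z \<notin> W0 \<Longrightarrow> e2 z = 0" using cutoff[OF W0(1,2)] by blast
  define c where "c = (mul e1 o\<^sub>L Zop i j) o\<^sub>L mul e2"
  define c' where "c' = (mul e2 o\<^sub>L Zop j i) o\<^sub>L mul e1"
  have mA: "mul e1 o\<^sub>L Zop i j \<in> A" "mul e2 o\<^sub>L Zop j i \<in> A" by (intro A_closed mul_in_A Zop_in_A e1 e2)+
  have cA: "c \<in> A" "c' \<in> A" unfolding c_def c'_def by (intro A_closed mA mul_in_A e1 e2)+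
  have sc: "sym c (z, n, w) = e1 z * (if (z, n, w) \<in> Z i j then 1 else 0) * e2 w"
    and sc': "sym c' (z, n, w) = e2 z * (if (z, n, w) \<in> Z j i then 1 else 0) * e1 w" for z n w
    unfolding c_def c'_def by (simp_all add: sym_mul_right sym_mul_left e1 e2 mA Zop_in_A sym_Zop)
  have uniq: "n = 0 \<and> z = w" if nz: "sym (c o\<^sub>L c') (z, n, w) \<noteq> 0" for z n w
  proof -
    obtain v m where v: "sym c (z, n - m, v) \<noteq> 0" "sym c' (v, m, w) \<noteq> 0" using sym_comp_nonzero[OF cA nz] by blast
    have 1: "(z, n - m, v) \<in> Z i j" "e1 z \<noteq> 0" "e2 v \<noteq> 0" using v(1) unfolding sc by (auto split: if_splits)
    have 2: "(v, m, w) \<in> Z j i" "e1 w \<noteq> 0" using v(2) unfolding sc' by (auto split: if_splits)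
    have "z \<in> V0" "w \<in> V0" using 1 2 e1(3) unfolding Z_iff by blast+
    moreover have "(T ^^ i) z = (T ^^ i) w" using 1(1) 2(1) unfolding Z_iff by simp
    ultimately have "z = w" using V0(3) by (meson inj_onD)
    moreover have "n = 0" using 1(1) 2(1) unfolding Z_iff by simp
    ultimately show ?thesis by simp
  qed
  have ccA: "c o\<^sub>L c' \<in> A" by (intro A_closed cA)
  define q where "q = (\<lambda>x. sym (c o\<^sub>L c') (x, 0, x))"
  have q: "CX q" "c o\<^sub>L c' = mul q" unfolding q_def using diagonal_of_sym[OF ccA uniq] by blast+
  have "q y = 1"
  proof -
    have xy: "(x, int j - int i, y) \<in> GA" "(x, int j - int i, y) \<in> Z j i" "(y, int i - int j, x) \<in> Z i j"
      using x y eq by (auto intro: arrowI simp: Z_iff)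
    \<comment> \<open>Injectivity of T^j on \<open>W0\<close> leaves x as the only possible range:
      this column of \<open>c'\<close> has the inverse arrow as its single entry.\<close>
    have "blinfun_apply c' (ell2_delta (y, 0, y)) = ell2_delta (x, int j - int i, y)"
    proof (rule ell2_eqI)
      fix \<beta> :: "'a \<times> int \<times> 'a"
      obtain w m z where \<beta>: "\<beta> = (w, m, z)" by (metis prod_cases3)
      have "w = x \<and> m = int j - int i" if "sym c' (w, m, y) \<noteq> 0"
      proof -
        have 1: "(w, m, y) \<in> Z j i" "e2 w \<noteq> 0" using that unfolding sc' by (auto split: if_splits)
        then have "w \<in> W0" "(T ^^ j) w = (T ^^ j) x" using e2(3) eq unfolding Z_iff by auto
        then show ?thesis using 1(1) W0(2,3) unfolding Z_iff by (meson inj_onD)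
      qed
      moreover have "sym c' (x, int j - int i, y) = 1" unfolding sc' using xy e1 e2 by simp
      moreover have "ell2_coord (blinfun_apply c' (ell2_delta (y, 0, y))) \<beta> =
          (if (w, m, z) \<in> GA \<and> z = y then sym c' (w, m, y) else 0)"
        unfolding \<beta> equivariantD(2)[OF A_equivariant[OF cA(2)]] using arrow_unit[OF y] by auto
      ultimately show "ell2_coord (blinfun_apply c' (ell2_delta (y, 0, y))) \<beta> = ell2_coord (ell2_delta (x, int j - int i, y)) \<beta>"
        unfolding ell2_delta.rep_eq using xy(1) unfolding \<beta> prod.inject by (smt (verit, best))
    qed
    then have "q y = ell2_coord (blinfun_apply c (ell2_delta (x, int j - int i, y))) (y, 0, y)" by (simp add: q_def sym_def)
    also have "\<dots> = sym c (y, int i - int j, x)"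
      unfolding equivariantD(2)[OF A_equivariant[OF cA(1)]] using xy(1) arrow_unit[OF y] by simp
    also have "\<dots> = 1" unfolding sc using xy e1 e2 by simp
    finally show ?thesis .
  qed
  then have nz: "sym (\<phi> c o\<^sub>L \<phi> c') (h y, 0, h y) \<noteq> 0"
    unfolding P(5)[OF cA, symmetric] q(2) impl_mul[OF q(1)] sym_mul[OF CX_compose[OF q(1) impl_inv_cont]] dsym_eq
    using impl_in[OF y] impl_inv_left[OF y] by simp
  obtain w m where w: "sym (\<phi> c) (h y, 0 - m, w) \<noteq> 0" using sym_comp_nonzero[OF P(2)[OF cA(1)] P(2)[OF cA(2)] nz] by blast
  have "(h y, 0 - m, w) \<in> GA" using w sym_outside[OF A_equivariant[OF P(2)[OF cA(1)]]] by blast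
  then have wS: "w \<in> S" by (simp add: arrows_iff)
  have "\<phi> c = (mul (\<lambda>x. e1 (hinv x)) o\<^sub>L \<phi> (Zop i j)) o\<^sub>L mul (\<lambda>x. e2 (hinv x))"
    unfolding c_def P(5)[OF mA(1) mul_in_A[OF e2(1)]] P(5)[OF mul_in_A[OF e1(1)] Zop_in_A] by (simp add: impl_mul e1 e2)
  moreover have "mul (\<lambda>x. e1 (hinv x)) o\<^sub>L \<phi> (Zop i j) \<in> A"
    by (intro A_closed mul_in_A CX_compose[OF e1(1) impl_inv_cont] P(2) Zop_in_A)
  ultimately have "sym (\<phi> c) (h y, - m, w) = e1 (hinv (h y)) * sym (\<phi> (Zop i j)) (h y, - m, w) * e2 (hinv w)"
    by (simp add: sym_mul_right sym_mul_left CX_compose[OF e1(1) impl_inv_cont] CX_compose[OF e2(1) impl_inv_cont] P(2) Zop_in_A)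
  then have nz2: "sym (\<phi> (Zop i j)) (h y, - m, w) \<noteq> 0" "e2 (hinv w) \<noteq> 0" using w by auto
  then have "hinv w \<in> W0" using e2(3) impl_inv_in wS by blast
  moreover have "(T ^^ j) (hinv w) = (T ^^ j) x" using image_Zop_source[OF nz2(1)] impl_inv_left[OF y] eq by simp
  ultimately have "hinv w = x" using W0(2,3) by (meson inj_onD)
  then have "w = h x" using impl_inv_right[OF wS] by simp
  then show ?thesis using nz2(1) by blast
qed

text \<open>The symbol of the image stays nonzero near the arrow from h x to h y, and nonvanishing
  implies T^i y' = T^j x' for the originals. The implication thus runs from images to originals;
  injectivity of T^j near x reverses it.\<close>

lemma implements_admissible:
  assumes \<phi>B: "\<phi> ` B \<subseteq> B" shows "admissible h"
  unfolding admissible_def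
proof (intro allI ballI impI)
  fix i j y x assume y: "y \<in> S" and x: "x \<in> S" and eq: "(T ^^ i) y = (T ^^ j) x"
  let ?m = "\<phi> (Zop i j)"
  have mA: "?m \<in> A" by (rule star_automorphismsD(2)[OF \<phi> Zop_in_A])
  obtain n where n: "sym ?m (h y, n, h x) \<noteq> 0" using image_Zop_nonzero[OF y x eq] by blast
  then have "(h y, n, h x) \<in> GA" using sym_outside[OF A_equivariant[OF mA]] by blast
  then obtain k l where kl: "n = int k - int l" "(T ^^ k) (h y) = (T ^^ l) (h x)" by (auto simp: arrows_iff)
  have ij: "k = l" if "i = j"
  proof -
    have "?m \<in> B" using \<phi>B Zop_in_B that by blast
    then have "(h y, n, h x) \<in> H" using B_sym n by blast
    then show ?thesis using kl(1) by (simp add: H_iff)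
  qed
  have nn: "0 < cmod (sym ?m (h y, int k - int l, h x))" using n kl(1) by simp
  obtain U V where UV: "openin X U" "openin X V" "h y \<in> U" "h x \<in> V"
    "\<And>y' x'. y' \<in> U \<Longrightarrow> x' \<in> V \<Longrightarrow> (T ^^ k) y' = (T ^^ l) x' \<Longrightarrow>
      dist (sym ?m (y', int k - int l, x')) (sym ?m (h y, int k - int l, h x)) < cmod (sym ?m (h y, int k - int l, h x))"
    using G_continuousD[OF A_sym_continuous[OF mA] impl_in[OF y] impl_in[OF x] kl(2) nn] by blast
  obtain W0 where W0: "openin X W0" "x \<in> W0" "inj_on (T ^^ j) W0" using Tn_locally_inj[OF x] by blast
  define V2 where "V2 = V \<inter> {w \<in> S. hinv w \<in> W0}"
  have V2: "openin X V2" "h x \<in> V2" unfolding V2_def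
    using UV(2,4) openin_continuous_map_preimage[OF impl_inv_cont W0(1)] impl_in[OF x] impl_inv_left[OF x] W0(2) by auto
  \<comment> \<open>The second condition guarantees a partner w near h x with T^k (h y') = T^l w. It
    is an open condition since T^l is an open map.\<close>
  define V' where "V' = {y' \<in> S. h y' \<in> U} \<inter> {y' \<in> S. h y' \<in> {z \<in> S. (T ^^ k) z \<in> (T ^^ l) ` V2}}"
  have V': "openin X V'" unfolding V'_def
    by (intro openin_Int openin_continuous_map_preimage[OF impl_cont] UV(1) Tn_preimage_open Tn_open V2(1))
  moreover have "y \<in> V'" unfolding V'_def using y UV(3) impl_in[OF y] kl(2) V2(2) by auto
  moreover have "(T ^^ k) (h y') = (T ^^ l) (h x')"
    if y': "y' \<in> V'" and x': "x' \<in> W0" and e: "(T ^^ i) y' = (T ^^ j) x'" for y' x'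
  proof -
    have yS: "y' \<in> S" "h y' \<in> U" using y' unfolding V'_def by auto
    obtain w where w: "w \<in> V2" "(T ^^ k) (h y') = (T ^^ l) w" using y' unfolding V'_def by blast
    then have wV: "w \<in> V" "w \<in> S" "hinv w \<in> W0" unfolding V2_def by auto
    have "sym ?m (h y', int k - int l, w) \<noteq> 0" using UV(5)[OF yS(2) wV(1) w(2)] by (auto simp: dist_norm)
    then have "(T ^^ i) y' = (T ^^ j) (hinv w)" using image_Zop_source impl_inv_left[OF yS(1)] by metis
    then have "x' = hinv w" using e x' wV(3) W0(3) by (metis inj_onD)
    then show ?thesis using w(2) impl_inv_right[OF wV(2)] by simp
  qed
  ultimately show "\<exists>k l V W. openin X V \<and> openin X W \<and> y \<in> V \<and> x \<in> W \<and> (i = j \<longrightarrow> k = l) \<and>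
      (\<forall>y'\<in>V. \<forall>x'\<in>W. (T ^^ i) y' = (T ^^ j) x' \<longrightarrow> (T ^^ k) (h y') = (T ^^ l) (h x'))"
    using W0(1,2) ij by blast
qed

end

end

subsection \<open>Eventual conjugacies\<close>

locale transitive_DR_system = compact_DR_system +
  assumes free: "topologically_free X T"
    and transitive: "topologically_transitive (subgroupoid_of (DR_groupoid X T) (DR_kernel X T))"
    and global_section: "\<exists>U. openin X U \<and> compactin X U \<and> U \<subset> topspace X \<and> T ` U = topspace X \<and> inj_on T U"
begin

section \<open>Density hypotheses read on points of X\<close>

lemma openin_units:
  assumes "openin X U" shows "openin (subtopology \<G> (unit_space G)) {(x, 0, x) | x. x \<in> U}"
proof -
  have "openin (subtopology \<G> (unit_space G)) {u \<in> topspace (subtopology \<G> (unit_space G)). fst u \<in> U}"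
    by (rule openin_continuous_map_preimage[OF continuous_map_from_subtopology[OF rng_cont] assms])
  moreover have "{u \<in> topspace (subtopology \<G> (unit_space G)). fst u \<in> U} = {(x, 0, x) | x. x \<in> U}"
    using openin_subset[OF assms] arrow_unit by (auto simp: unit_space_eq)
  ultimately show ?thesis by simp
qed

lemma topspace_units: "topspace (subtopology \<G> (unit_space G)) = unit_space G"
  using arrow_unit by (auto simp: unit_space_eq)

lemma free_point:
  assumes "openin X W" "W \<noteq> {}"
  obtains x where "x \<in> W" "\<And>n. (x, n, x) \<in> GA \<Longrightarrow> n = 0"
proof -
  let ?P = "{u \<in> unit_space G. {\<alpha> \<in> GA. gdom G \<alpha> = u \<and> grng G \<alpha> = u} = {u}}"
  have "subtopology \<G> (unit_space G) closure_of ?P = topspace (subtopology \<G> (unit_space G))"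
    using free unfolding topspace_units topologically_free_def topologically_principal_def unit_top_def .
  then have "?P \<inter> {(x, 0, x) | x. x \<in> W} \<noteq> {}"
    using openin_units[OF assms(1)] assms(2) unfolding dense_intersects_open by blast
  then obtain x where x: "x \<in> W" "{\<alpha> \<in> GA. gdom G \<alpha> = (x, 0, x) \<and> grng G \<alpha> = (x, 0, x)} = {(x, 0, x)}" by blast
  have "n = 0" if "(x, n, x) \<in> GA" for n
  proof -
    have "(x, n, x) \<in> {\<alpha> \<in> GA. gdom G \<alpha> = (x, 0, x) \<and> grng G \<alpha> = (x, 0, x)}" using that by simp
    then show ?thesis unfolding x(2) by simp
  qed
  then show thesis using that x(1) by blast
qed

lemma transitive_point:
  assumes "openin X U" "U \<noteq> {}" "openin X V" "V \<noteq> {}"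
  obtains y x j where "y \<in> V" "x \<in> U" "(T ^^ j) y = (T ^^ j) x"
proof -
  let ?K = "subgroupoid_of G H"
  have aK: "arrows ?K = H"
    unfolding arrows_def[of ?K] using H_subset by (simp add: subgroupoid_of_def Int_absorb1)
  have gK: "gdom ?K = gdom G" "grng ?K = grng G" by (auto simp: subgroupoid_of_def)
  have uH: "unit_space G \<subseteq> H" using arrow_unit by (auto simp: unit_space_eq H_iff)
  have uK: "unit_space ?K = unit_space G"
  proof
    show "unit_space ?K \<subseteq> unit_space G"
      unfolding unit_space_def[of ?K] aK gK using H_subset unfolding unit_space_def by blast
    show "unit_space G \<subseteq> unit_space ?K"
    proof
      fix u assume u: "u \<in> unit_space G"
      then have "gdom G u = u" by (auto simp: unit_space_eq)
      then show "u \<in> unit_space ?K" unfolding unit_space_def[of ?K] aK gK using u uH by (metis imageI subsetD)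
    qed
  qed
  have tK: "unit_top ?K = subtopology \<G> (unit_space G)"
    unfolding unit_top_def uK using uH
    by (simp add: subgroupoid_of_def subtopology_subtopology Int_absorb1)
  have "openin (unit_top ?K) {(x, 0, x) | x. x \<in> U}" "{(x, 0::int, x) | x. x \<in> U} \<noteq> {}"
    unfolding tK using openin_units[OF assms(1)] assms(2) by auto
  then have "unit_top ?K closure_of (grng ?K ` {\<alpha> \<in> arrows ?K. gdom ?K \<alpha> \<in> {(x, 0, x) | x. x \<in> U}}) = unit_space ?K"
    using transitive unfolding topologically_transitive_def by blast
  then have c: "subtopology \<G> (unit_space G) closure_of (grng G ` {\<alpha> \<in> H. gdom G \<alpha> \<in> {(x, 0, x) | x. x \<in> U}})
      = topspace (subtopology \<G> (unit_space G))"
    unfolding tK uK aK gK topspace_units .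
  have ne: "{(x, 0 :: int, x) | x. x \<in> V} \<noteq> {}" using assms(4) by auto
  have "grng G ` {\<alpha> \<in> H. gdom G \<alpha> \<in> {(x, 0, x) | x. x \<in> U}} \<inter> {(x, 0, x) | x. x \<in> V} \<noteq> {}"
    by (rule dense_intersects_open[THEN iffD1, rule_format, OF c conjI[OF openin_units[OF assms(3)] ne]])
  then obtain \<alpha> where \<alpha>: "\<alpha> \<in> H" "gdom G \<alpha> \<in> {(x, 0, x) | x. x \<in> U}" "grng G \<alpha> \<in> {(x, 0, x) | x. x \<in> V}" by blast
  obtain y n x where yx: "\<alpha> = (y, n, x)" by (metis prod_cases3)
  have "x \<in> U" "y \<in> V" "(y, 0, x) \<in> GA" using \<alpha> unfolding yx H_iff by auto
  moreover then obtain j where "(T ^^ j) y = (T ^^ j) x" by (auto simp: arrows_iff)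
  ultimately show thesis using that by blast
qed

lemma S_nonempty: "S \<noteq> {}" using global_section by blast

lemma T_surj: "T ` S = S" using global_section T_in by blast

section \<open>The cocycle value attached to a homeomorphism\<close>

text \<open>The integer p is a cocycle value of an arrow from h (T x) to h x. One exponent b for all
  x is demanded because property (P), the case p = 1, is uniform in this sense.\<close>

definition lag :: "('a \<Rightarrow> 'a) \<Rightarrow> int \<Rightarrow> bool"
  where "lag h p \<longleftrightarrow> (\<exists>b. 0 \<le> int b + p \<and> (\<forall>x\<in>S. (T ^^ nat (int b + p)) (h x) = (T ^^ b) (h (T x))))"

text \<open>Every arrow is composed of arrows (x, 1, T x) and their inverses, so h scales cocycle
  values by p.\<close>

lemma lag_arrow:
  assumes h: "h \<in> S \<rightarrow> S" and l: "lag h p" and a: "(y, n, x) \<in> GA"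
  shows "(h y, p * n, h x) \<in> GA"
proof -
  have hS: "x \<in> S \<Longrightarrow> h x \<in> S" for x using h by blast
  obtain b where b: "0 \<le> int b + p" "\<And>x. x \<in> S \<Longrightarrow> (T ^^ nat (int b + p)) (h x) = (T ^^ b) (h (T x))"
    using l unfolding lag_def by blast
  have 1: "(h x, p, h (T x)) \<in> GA" if "x \<in> S" for x
    using arrowI[OF hS[OF that] hS[OF T_in[OF that]] b(2)[OF that]] b(1) by simp
  have n: "(h x, p * int i, h ((T ^^ i) x)) \<in> GA" if "x \<in> S" for x i
  proof (induction i)
    case 0 then show ?case using arrow_unit hS that by simp
  next
    case (Suc i)
    show ?case using arrow_comp[OF Suc 1[OF Tn_in[OF that]]] by (simp add: algebra_simps)
  qed
  obtain i j where ij: "y \<in> S" "x \<in> S" "n = int i - int j" "(T ^^ i) y = (T ^^ j) x" using a by (auto simp: arrows_iff)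
  show ?thesis using arrow_comp[OF n[OF ij(1), of i] arrow_inv[OF n[OF ij(2), of j, folded ij(4)]]]
    by (simp add: ij(3) algebra_simps)
qed

lemma property_P_lag: "property_P X T h \<longleftrightarrow> lag h 1"
  unfolding property_P_def lag_def by (intro iff_exI) (simp add: nat_add_distrib)

lemma property_P_arrow:
  "h \<in> S \<rightarrow> S \<Longrightarrow> property_P X T h \<Longrightarrow> (y, n, x) \<in> GA \<Longrightarrow> (h y, n, h x) \<in> GA"
  using lag_arrow[of h 1 y n x] by (simp add: property_P_lag)

text \<open>Two cocycle values between the same endpoints differ by isotropy at the range h z. As z
  runs through \<open>W\<close>, these ranges fill an open set, which contains a point with trivial
  isotropy.\<close>

lemma lag_unique:
  assumes h: "homeomorphic_map X X h" and W: "openin X W" "x \<in> W"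
    and a: "\<And>z. z \<in> W \<Longrightarrow> (h z, p, v z) \<in> GA" "\<And>z. z \<in> W \<Longrightarrow> (h z, q, v z) \<in> GA"
  shows "p = q"
proof -
  have "openin X (h ` W)" using homeomorphic_imp_open_map[OF h] W(1) unfolding open_map_def by blast
  then obtain w where w: "w \<in> h ` W" "\<And>n. (w, n, w) \<in> GA \<Longrightarrow> n = 0"
    using free_point[of "h ` W"] W(2) by blast
  then obtain z where z: "z \<in> W" "w = h z" by blast
  have "(w, p + - q, w) \<in> GA" unfolding z(2) by (rule arrow_comp[OF a(1)[OF z(1)] arrow_inv[OF a(2)[OF z(1)]]])
  then show ?thesis using w(2) by fastforce
qed

context
  fixes h assumes h: "homeomorphic_map X X h" and adm: "admissible h"
begin

definition local_lag :: "'a \<Rightarrow> int \<Rightarrow> bool"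
  where "local_lag x p \<longleftrightarrow> (\<exists>k l W. openin X W \<and> x \<in> W \<and> p = int k - int l \<and>
    (\<forall>z\<in>W. (T ^^ k) (h z) = (T ^^ l) (h (T z))))"

lemma map_in: "x \<in> S \<Longrightarrow> h x \<in> S"
  using homeomorphic_imp_surjective_map[OF h] by blast

lemma admissibleD:
  assumes "y \<in> S" "x \<in> S" "(T ^^ i) y = (T ^^ j) x"
  obtains k l V W where "openin X V" "openin X W" "y \<in> V" "x \<in> W" "i = j \<Longrightarrow> k = l"
    "\<And>y' x'. y' \<in> V \<Longrightarrow> x' \<in> W \<Longrightarrow> (T ^^ i) y' = (T ^^ j) x' \<Longrightarrow> (T ^^ k) (h y') = (T ^^ l) (h x')"
proof -
  have "\<exists>k l V W. openin X V \<and> openin X W \<and> y \<in> V \<and> x \<in> W \<and> (i = j \<longrightarrow> k = l) \<and>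
      (\<forall>y'\<in>V. \<forall>x'\<in>W. (T ^^ i) y' = (T ^^ j) x' \<longrightarrow> (T ^^ k) (h y') = (T ^^ l) (h x'))"
    using adm[unfolded admissible_def, rule_format, OF assms] .
  then show thesis using that by (elim exE conjE) blast
qed

lemma local_lag_exists: assumes x: "x \<in> S" shows "\<exists>p. local_lag x p"
proof -
  have "(T ^^ 1) x = (T ^^ 0) (T x)" by simp
  then obtain k l V W where *: "openin X V" "openin X W" "x \<in> V" "T x \<in> W"
    "\<And>y' x'. y' \<in> V \<Longrightarrow> x' \<in> W \<Longrightarrow> (T ^^ 1) y' = (T ^^ 0) x' \<Longrightarrow> (T ^^ k) (h y') = (T ^^ l) (h x')"
    using admissibleD[OF x T_in[OF x]] by metis
  have "openin X (V \<inter> {z \<in> S. T z \<in> W})"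
    using *(1) openin_continuous_map_preimage[OF T_cont *(2)] by (rule openin_Int)
  moreover have "x \<in> V \<inter> {z \<in> S. T z \<in> W}" using * x by simp
  moreover have "\<forall>z\<in>V \<inter> {z \<in> S. T z \<in> W}. (T ^^ k) (h z) = (T ^^ l) (h (T z))" using *(5) by simp
  ultimately show ?thesis unfolding local_lag_def by blast
qed

text \<open>As \<open>admissible\<close> respects the kernel, h y and h x are joined by an arrow of
  value 0, and so are h (T y) and h (T x); hence both lags occur between the same endpoints. For
  \<open>lag_unique\<close> this is arranged for all z near x, each with its own partner near
  y.\<close>

lemma local_lag_invariant:
  assumes x: "x \<in> S" "local_lag x p" and y: "y \<in> S" "local_lag y q" and eq: "(T ^^ j) y = (T ^^ j) x"
  shows "p = q"
proof -
  obtain k l W1 where 1: "openin X W1" "x \<in> W1" "p = int k - int l" "\<forall>z\<in>W1. (T ^^ k) (h z) = (T ^^ l) (h (T z))"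
    using x(2) unfolding local_lag_def by blast
  obtain k' l' W2 where 2: "openin X W2" "y \<in> W2" "q = int k' - int l'" "\<forall>z\<in>W2. (T ^^ k') (h z) = (T ^^ l') (h (T z))"
    using y(2) unfolding local_lag_def by blast
  obtain a a' V W where 3: "openin X V" "openin X W" "y \<in> V" "x \<in> W" "j = j \<Longrightarrow> a = a'"
    "\<And>y' x'. y' \<in> V \<Longrightarrow> x' \<in> W \<Longrightarrow> (T ^^ j) y' = (T ^^ j) x' \<Longrightarrow> (T ^^ a) (h y') = (T ^^ a') (h x')"
    by (rule admissibleD[OF y(1) x(1) eq]) (rule that)
  have eqT: "(T ^^ j) (T y) = (T ^^ j) (T x)" using eq by (simp add: funpow_swap1[symmetric])
  obtain b b' V' W' where 4: "openin X V'" "openin X W'" "T y \<in> V'" "T x \<in> W'" "j = j \<Longrightarrow> b = b'"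
    "\<And>y' x'. y' \<in> V' \<Longrightarrow> x' \<in> W' \<Longrightarrow> (T ^^ j) y' = (T ^^ j) x' \<Longrightarrow> (T ^^ b) (h y') = (T ^^ b') (h x')"
    by (rule admissibleD[OF T_in[OF y(1)] T_in[OF x(1)] eqT]) (rule that)
  define N where "N = W2 \<inter> V \<inter> {z \<in> S. T z \<in> V'}"
  have N: "openin X N" "y \<in> N" unfolding N_def
    using 2 3 4 y(1) openin_continuous_map_preimage[OF T_cont 4(1)] by auto
  \<comment> \<open>The last factor supplies the partner w in \<open>N\<close> with T^j w = T^j z;
    it is open because T^j is an open map.\<close>
  define Q where "Q = W1 \<inter> W \<inter> {z \<in> S. T z \<in> W'} \<inter> {z \<in> S. (T ^^ j) z \<in> (T ^^ j) ` N}"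
  have Q: "openin X Q" "x \<in> Q"
  proof -
    show "openin X Q" unfolding Q_def
      by (intro openin_Int 1(1) 3(2) openin_continuous_map_preimage[OF T_cont 4(2)] Tn_preimage_open Tn_open N(1))
    have "(T ^^ j) x \<in> (T ^^ j) ` N" using N(2) eq by (metis imageI)
    then show "x \<in> Q" unfolding Q_def using 1 3 4 x(1) by simp
  qed
  show ?thesis
  proof (rule lag_unique[OF h Q])
    fix z assume z: "z \<in> Q"
    then have zS: "z \<in> S" "z \<in> W1" "z \<in> W" "T z \<in> W'" unfolding Q_def by auto
    show "(h z, p, h (T z)) \<in> GA" using zS 1(3,4) map_in T_in by (auto intro!: arrowI)
    have "(T ^^ j) z \<in> (T ^^ j) ` N" using z unfolding Q_def by blast
    then obtain w where w: "w \<in> N" "(T ^^ j) w = (T ^^ j) z" by force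
    then have wS: "w \<in> S" "w \<in> W2" "w \<in> V" "T w \<in> V'" unfolding N_def by auto
    have Tw: "(T ^^ j) (T w) = (T ^^ j) (T z)" using w(2) by (simp add: funpow_swap1[symmetric])
    have "(h w, 0, h z) \<in> GA" using arrowI[OF map_in[OF wS(1)] map_in[OF zS(1)] 3(6)[OF wS(3) zS(3) w(2)]] 3(5) by simp
    moreover have "(h (T w), 0, h (T z)) \<in> GA"
      using arrowI[OF map_in[OF T_in[OF wS(1)]] map_in[OF T_in[OF zS(1)]] 4(6)[OF wS(4) zS(4) Tw]] 4(5) by simp
    moreover have "(h w, q, h (T w)) \<in> GA" using wS 2(3,4) map_in T_in by (auto intro!: arrowI)
    ultimately have "(h z, - 0 + q + 0, h (T z)) \<in> GA" by (intro arrow_comp[OF arrow_comp[OF arrow_inv]])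
    then show "(h z, q, h (T z)) \<in> GA" by simp
  qed
qed

text \<open>Any two nonempty open sets are linked by points with T^j z = T^j w, so invariance makes
  all local lags equal. Compactness then turns the local exponents into a common one.\<close>

lemma lag_exists: "\<exists>p. lag h p"
proof -
  obtain x0 where x0: "x0 \<in> S" using S_nonempty by blast
  then obtain p where p: "local_lag x0 p" using local_lag_exists by blast
  have all: "local_lag x p" if x: "x \<in> S" for x
  proof -
    obtain q where q: "local_lag x q" using local_lag_exists[OF x] by blast
    obtain k l W1 where 1: "openin X W1" "x0 \<in> W1" "p = int k - int l" "\<forall>z\<in>W1. (T ^^ k) (h z) = (T ^^ l) (h (T z))"
      using p unfolding local_lag_def by blast
    obtain k' l' W2 where 2: "openin X W2" "x \<in> W2" "q = int k' - int l'" "\<forall>z\<in>W2. (T ^^ k') (h z) = (T ^^ l') (h (T z))"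
      using q unfolding local_lag_def by blast
    obtain z w j where zw: "z \<in> W2" "w \<in> W1" "(T ^^ j) z = (T ^^ j) w"
      using transitive_point[of W1 W2] 1 2 by blast
    have S: "z \<in> S" "w \<in> S" using zw 1(1) 2(1) openin_subset by blast+
    have "local_lag w p" "local_lag z q" using 1 2 zw unfolding local_lag_def by blast+
    then have "p = q" using local_lag_invariant S zw(3) by blast
    then show ?thesis using q by simp
  qed
  let ?Q = "\<lambda>L z. (T ^^ nat (int L + p)) (h z) = (T ^^ L) (h (T z))"
  let ?C = "{W. openin X W \<and> (\<exists>L0. 0 \<le> int L0 + p \<and> (\<forall>L\<ge>L0. \<forall>z\<in>W. ?Q L z))}"
  have "S \<subseteq> \<Union>?C"
  proof
    fix x assume "x \<in> S"
    then obtain k l W where *: "openin X W" "x \<in> W" "p = int k - int l" "\<forall>z\<in>W. (T ^^ k) (h z) = (T ^^ l) (h (T z))"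
      using all unfolding local_lag_def by blast
    have "?Q L z" if "l \<le> L" "z \<in> W" for L z
    proof (rule funpow_eq_mono)
      show "(T ^^ k) (h z) = (T ^^ l) (h (T z))" using *(4) that(2) by blast
      show "k \<le> nat (int L + p)" "int (nat (int L + p)) - int L = int k - int l" using *(3) that(1) by auto
    qed
    then have "W \<in> ?C" using *(1,3) by (intro CollectI conjI exI[of _ l]) auto
    then show "x \<in> \<Union>?C" using *(2) by blast
  qed
  moreover have "\<forall>W\<in>?C. openin X W" by blast
  ultimately obtain F where F: "finite F" "F \<subseteq> ?C" "S \<subseteq> \<Union>F"
    using compact_X unfolding compact_space_alt by meson
  have "\<exists>L0. \<forall>L\<ge>L0. \<forall>z\<in>W. ?Q L z" if "W \<in> F" for W using F(2) that by blast
  then obtain L0 where L0: "\<And>W L z. W \<in> F \<Longrightarrow> L0 W \<le> L \<Longrightarrow> z \<in> W \<Longrightarrow> ?Q L z" by metis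
  \<comment> \<open>The sum of the thresholds dominates each of them, and \<open>nat (- p)\<close>
    keeps the exponent L + p nonnegative.\<close>
  define L where "L = sum L0 F + nat (- p)"
  have "L0 W \<le> L" if "W \<in> F" for W
    using member_le_sum[of W F L0] that F(1) unfolding L_def by simp
  then have "?Q L z" if "z \<in> S" for z using L0 F(3) that by blast
  moreover have "nat (- p) \<le> L" unfolding L_def by simp
  then have "0 \<le> int L + p" by linarith
  ultimately show ?thesis unfolding lag_def by blast
qed

end

text \<open>The section of \<open>T\<close> over \<open>U\<close> yields an injective \<open>s\<close> with
  \<open>T\<^sup>l \<circ> s = T\<^sup>l\<^sup>+\<^sup>1\<close>. Then no fibre of \<open>T\<^sup>l\<^sup>+\<^sup>1\<close> is larger than the
  corresponding fibre of \<open>T\<^sup>l\<close>, which forces \<open>T\<close> to be injective.\<close>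

lemma lag_minus_one_False:
  assumes h: "h \<in> Bij S" "lag h (- 1)" shows False
proof -
  obtain b where b: "0 \<le> int b + (- 1)" "\<And>x. x \<in> S \<Longrightarrow> (T ^^ nat (int b + (- 1))) (h x) = (T ^^ b) (h (T x))"
    using h(2) unfolding lag_def by blast
  define l where "l = b - 1"
  have bl: "b = Suc l" "nat (int b + (- 1)) = l" using b(1) unfolding l_def by auto
  obtain U where U: "U \<subset> S" "T ` U = S" "inj_on T U" using global_section by blast
  \<comment> \<open>\<open>s\<close> takes the preimage of y under h, lifts it into U along T and
    applies h; it is injective because all three maps are.\<close>
  define s where "s = (\<lambda>y. h (inv_into U T (inv_into S h y)))"
  note I = Bij_inv_simps[OF h(1)]
  have iU: "inv_into U T x \<in> U" "T (inv_into U T x) = x" if "x \<in> S" for x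
    using that U(2) by (auto intro: inv_into_into f_inv_into_f)
  have US: "x \<in> U \<Longrightarrow> x \<in> S" for x using U(1) by blast
  have s: "s y \<in> S" "(T ^^ l) (s y) = (T ^^ Suc l) y" if y: "y \<in> S" for y
  proof -
    let ?x = "inv_into U T (inv_into S h y)"
    have x: "?x \<in> S" "T ?x = inv_into S h y" using iU[OF I(5)[OF y]] US by auto
    show "s y \<in> S" unfolding s_def by (rule I(1)[OF x(1)])
    have "(T ^^ l) (h ?x) = (T ^^ b) (h (T ?x))" using b(2)[OF x(1)] unfolding bl(2) .
    also have "\<dots> = (T ^^ Suc l) (h (T ?x))" by (simp only: bl(1))
    also have "h (T ?x) = y" unfolding x(2) by (rule I(6)[OF y])
    finally show "(T ^^ l) (s y) = (T ^^ Suc l) y" unfolding s_def .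
  qed
  have s_inj: "inj_on s S"
  proof (rule inj_onI)
    fix y z assume yz: "y \<in> S" "z \<in> S" "s y = s z"
    have iS: "inv_into U T (inv_into S h y) \<in> S" "inv_into U T (inv_into S h z) \<in> S"
      using US iU(1)[OF I(5)] yz by blast+
    have "inv_into U T (inv_into S h y) = inv_into U T (inv_into S h z)"
      using yz(3) unfolding s_def by (metis I(7)[OF iS(1)] I(7)[OF iS(2)])
    then have "inv_into S h y = inv_into S h z" by (metis iU(2)[OF I(5)[OF yz(1)]] iU(2)[OF I(5)[OF yz(2)]])
    then show "y = z" by (metis I(6)[OF yz(1)] I(6)[OF yz(2)])
  qed
  let ?F = "\<lambda>n v. {z \<in> S. (T ^^ n) z = v}"
  obtain u where u: "u \<in> S" "u \<notin> U" using U(1) by blast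
  define v where "v = (T ^^ Suc l) u"
  have "card (?F (Suc l) v) \<le> card (?F l v)"
    using s s_inj by (intro card_inj_on_le[of s] finite_fibre) (auto simp: inj_on_def)
  \<comment> \<open>T maps the fibre of T^(l+1) onto the fibre of T^l over the same point, while
    \<open>s\<close> injects the former into the latter. Finite cardinalities then force T to be
    injective on it.\<close>
  moreover have "T ` ?F (Suc l) v = ?F l v"
  proof
    show "T ` ?F (Suc l) v \<subseteq> ?F l v" using T_in by (auto simp: funpow_swap1)
    show "?F l v \<subseteq> T ` ?F (Suc l) v"
    proof
      fix z assume z: "z \<in> ?F l v"
      then have "z \<in> T ` S" by (simp only: T_surj mem_Collect_eq)
      then obtain w where "w \<in> S" "T w = z" by blast
      then show "z \<in> T ` ?F (Suc l) v" using z by (intro image_eqI[of _ _ w]) (auto simp: funpow_swap1)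
    qed
  qed
  ultimately have "card (T ` ?F (Suc l) v) = card (?F (Suc l) v)"
    using card_image_le[OF finite_fibre, of T "Suc l" v] by simp
  then have inj: "inj_on T (?F (Suc l) v)" using finite_fibre by (intro eq_card_imp_inj_on)
  \<comment> \<open>The point u lies outside U, but T u also has a preimage inside U; both belong to
    the fibre over \<open>v\<close>.\<close>
  let ?w = "inv_into U T (T u)"
  have w: "?w \<in> U" "T ?w = T u" using iU[OF T_in[OF u(1)]] by auto
  have "?w \<in> ?F (Suc l) v" "u \<in> ?F (Suc l) v" using w u US unfolding v_def by (auto simp: funpow_swap1)
  then have "?w = u" using inj w(2) by (meson inj_onD)
  then show False using w(1) u(2) by simp
qed

theorem admissible_property_P:
  assumes B: "h \<in> Bij S" and hh: "homeomorphic_map X X h"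
    and adm: "admissible h" "admissible (restrict (inv_into S h) S)"
  shows "property_P X T h"
proof -
  let ?g = "restrict (inv_into S h) S"
  note I = Bij_inv_simps[OF B]
  obtain p where p: "lag h p" using lag_exists[OF hh adm(1)] by blast
  obtain q where q: "lag ?g q" using lag_exists[OF homeomorphic_map_restrict_inv[OF hh] adm(2)] by blast
  \<comment> \<open>A single point with trivial isotropy suffices: h composed with its inverse is
    the identity and multiplies cocycle values by p q.\<close>
  obtain x where x: "x \<in> S" "\<And>n. (x, n, x) \<in> GA \<Longrightarrow> n = 0" using free_point[of S] S_nonempty by auto
  have "(x, 1, T x) \<in> GA" using arrow_T[OF x(1), of 1] by simp
  then have "(h (?g x), p * (q * 1), h (?g (T x))) \<in> GA"
    by (intro lag_arrow[OF _ p] lag_arrow[OF _ q]) (use I in auto)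
  then have "(x, p * q, T x) \<in> GA" using I(3)[OF x(1)] I(3)[OF T_in[OF x(1)]] by simp
  then have "(x, p * q + - 1, x) \<in> GA" using \<open>(x, 1, T x) \<in> GA\<close> arrow_comp arrow_inv by blast
  then have "p * q = 1" using x(2) by fastforce
  then have "p = 1 \<or> p = - 1" by (simp add: zmult_eq_1_iff) blast
  moreover have "p \<noteq> - 1" using lag_minus_one_False[OF B] p by blast
  ultimately show ?thesis using p by (simp add: property_P_lag)
qed

subsection \<open>Groupoid automorphisms\<close>

definition hom_of :: "('a \<times> int \<times> 'a \<Rightarrow> 'a \<times> int \<times> 'a) \<Rightarrow> 'a \<Rightarrow> 'a"
  where "hom_of \<Phi> = (\<lambda>x\<in>S. fst (\<Phi> (x, 0, x)))"

lemma automorphismD: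
  assumes "\<Phi> \<in> groupoid_automorphisms G"
  shows "\<Phi> \<in> Bij GA" "homeomorphic_map \<G> \<G> \<Phi>"
    "\<alpha> \<in> GA \<Longrightarrow> gdom G (\<Phi> \<alpha>) = \<Phi> (gdom G \<alpha>)" "\<alpha> \<in> GA \<Longrightarrow> grng G (\<Phi> \<alpha>) = \<Phi> (grng G \<alpha>)"
    "\<alpha> \<in> GA \<Longrightarrow> \<beta> \<in> GA \<Longrightarrow> gdom G \<alpha> = grng G \<beta> \<Longrightarrow> \<Phi> (gmul G \<alpha> \<beta>) = gmul G (\<Phi> \<alpha>) (\<Phi> \<beta>)"
    "\<alpha> \<in> GA \<Longrightarrow> \<Phi> \<alpha> \<in> GA"
  using assms unfolding groupoid_automorphisms_def by (auto simp: Bij_def bij_betw_def)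

lemma automorphism_unit:
  assumes \<Phi>: "\<Phi> \<in> groupoid_automorphisms G" and x: "x \<in> S"
  shows "\<Phi> (x, 0, x) = (hom_of \<Phi> x, 0, hom_of \<Phi> x)" "hom_of \<Phi> x \<in> S"
proof -
  obtain y n z where yz: "\<Phi> (x, 0, x) = (y, n, z)" by (metis prod_cases3)
  have "gdom G (\<Phi> (x, 0, x)) = \<Phi> (x, 0, x)" using automorphismD(3)[OF \<Phi> arrow_unit[OF x]] by simp
  then have "y = z" "n = 0" unfolding yz by auto
  then show "\<Phi> (x, 0, x) = (hom_of \<Phi> x, 0, hom_of \<Phi> x)" using x yz by (simp add: hom_of_def)
  then show "hom_of \<Phi> x \<in> S" using automorphismD(6)[OF \<Phi> arrow_unit[OF x]] by (simp add: arrows_iff)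
qed

lemma automorphism_arrow:
  assumes \<Phi>: "\<Phi> \<in> groupoid_automorphisms G" and a: "(y, n, x) \<in> GA"
  obtains p where "\<Phi> (y, n, x) = (hom_of \<Phi> y, p, hom_of \<Phi> x)" "(hom_of \<Phi> y, p, hom_of \<Phi> x) \<in> GA"
proof -
  obtain y' p x' where e: "\<Phi> (y, n, x) = (y', p, x')" by (metis prod_cases3)
  have yx: "y \<in> S" "x \<in> S" using a by (auto simp: arrows_iff)
  have "x' = hom_of \<Phi> x" using automorphismD(3)[OF \<Phi> a] automorphism_unit(1)[OF \<Phi> yx(2)] unfolding e by simp
  moreover have "y' = hom_of \<Phi> y" using automorphismD(4)[OF \<Phi> a] automorphism_unit(1)[OF \<Phi> yx(1)] unfolding e by simp
  ultimately show thesis using that e automorphismD(6)[OF \<Phi> a] by metis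
qed

lemma automorphism_inverse:
  assumes \<Phi>: "\<Phi> \<in> groupoid_automorphisms G" "\<Phi> ` H = H"
  obtains \<Psi> where "\<Psi> \<in> groupoid_automorphisms G" "\<Psi> ` H = H"
    "\<And>\<alpha>. \<alpha> \<in> GA \<Longrightarrow> \<Phi> (\<Psi> \<alpha>) = \<alpha>" "\<And>\<alpha>. \<alpha> \<in> GA \<Longrightarrow> \<Psi> (\<Phi> \<alpha>) = \<alpha>"
proof -
  let ?R = "Aut_groupoid_rel G H"
  interpret group ?R by (rule group_Aut_groupoid_rel_DR[OF H_subset])
  have c: "carrier ?R = {\<Phi> \<in> groupoid_automorphisms G. \<Phi> ` H = H}" by (simp add: Aut_groupoid_rel_def)
  then have \<Phi>c: "\<Phi> \<in> carrier ?R" using \<Phi> by simp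
  let ?\<Psi> = "inv\<^bsub>?R\<^esub> \<Phi>"
  have \<Psi>c: "?\<Psi> \<in> carrier ?R" using \<Phi>c by (rule inv_closed)
  have B: "\<Phi> \<in> Bij GA" "?\<Psi> \<in> Bij GA" using \<Phi>c \<Psi>c automorphismD(1) unfolding c by blast+
  have e: "compose GA \<Phi> ?\<Psi> = (\<lambda>x\<in>GA. x)" "compose GA ?\<Psi> \<Phi> = (\<lambda>x\<in>GA. x)"
    using r_inv[OF \<Phi>c] l_inv[OF \<Phi>c] B by (simp_all add: Aut_groupoid_rel_def BijGroup_def)
  have "\<Phi> (?\<Psi> \<alpha>) = \<alpha>" "?\<Psi> (\<Phi> \<alpha>) = \<alpha>" if "\<alpha> \<in> GA" for \<alpha>
    using fun_cong[OF e(1), of \<alpha>] fun_cong[OF e(2), of \<alpha>] that by (simp_all add: compose_def)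
  then show thesis using that \<Psi>c unfolding c by blast
qed

lemma hom_of_cont:
  assumes "\<Phi> \<in> groupoid_automorphisms G" shows "continuous_map X X (hom_of \<Phi>)"
proof -
  have "continuous_map X X (fst \<circ> (\<Phi> \<circ> (\<lambda>x. (x, 0, x))))"
    by (intro continuous_map_compose[OF _ rng_cont] continuous_map_compose[OF unit_cont]
        homeomorphic_imp_continuous_map automorphismD(2) assms)
  then show ?thesis by (rule continuous_map_eq) (simp add: hom_of_def)
qed

text \<open>Beyond admissibility, k and l record the value of \<Phi> on the given arrow, and
  \<open>hom_of_all\<close> relies on this link. The neighbourhoods come from the preimage of the
  open set \<open>Z k l\<close> under \<Phi>.\<close>

lemma hom_of_admissible:
  assumes \<Phi>: "\<Phi> \<in> groupoid_automorphisms G" "\<Phi> ` H = H"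
    and yx: "y \<in> S" "x \<in> S" "(T ^^ i) y = (T ^^ j) x"
  obtains k l V W where "openin X V" "openin X W" "y \<in> V" "x \<in> W" "i = j \<Longrightarrow> k = l"
    "\<Phi> (y, int i - int j, x) = (hom_of \<Phi> y, int k - int l, hom_of \<Phi> x)"
    "\<And>y' x'. y' \<in> V \<Longrightarrow> x' \<in> W \<Longrightarrow> (T ^^ i) y' = (T ^^ j) x' \<Longrightarrow> (T ^^ k) (hom_of \<Phi> y') = (T ^^ l) (hom_of \<Phi> x')"
proof -
  have a: "(y, int i - int j, x) \<in> GA" by (rule arrowI[OF yx])
  obtain p where p: "\<Phi> (y, int i - int j, x) = (hom_of \<Phi> y, p, hom_of \<Phi> x)" "(hom_of \<Phi> y, p, hom_of \<Phi> x) \<in> GA"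
    by (rule automorphism_arrow[OF \<Phi>(1) a])
  obtain k l where kl: "p = int k - int l" "(T ^^ k) (hom_of \<Phi> y) = (T ^^ l) (hom_of \<Phi> x)"
    using p(2) by (auto simp: arrows_iff)
  have ij: "k = l" if "i = j"
  proof -
    have "(y, int i - int j, x) \<in> H" using a that by (simp add: H_iff)
    then have "\<Phi> (y, int i - int j, x) \<in> H" using \<Phi>(2) by blast
    then show ?thesis unfolding p(1) kl(1) by (simp add: H_iff)
  qed
  have "openin \<G> {\<alpha> \<in> topspace \<G>. \<Phi> \<alpha> \<in> Z k l}"
    by (rule openin_continuous_map_preimage[OF homeomorphic_imp_continuous_map[OF automorphismD(2)[OF \<Phi>(1)]] openin_Z])
  moreover have "(y, int i - int j, x) \<in> {\<alpha> \<in> topspace \<G>. \<Phi> \<alpha> \<in> Z k l}"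
    using a p kl automorphism_unit(2)[OF \<Phi>(1)] yx by (simp add: Z_iff)
  ultimately obtain V W where VW: "openin X V" "openin X W" "y \<in> V" "x \<in> W"
    "DR_basic T V i j W \<subseteq> {\<alpha> \<in> topspace \<G>. \<Phi> \<alpha> \<in> Z k l}"
    using nbhd_basis[OF _ yx] by blast
  have "(T ^^ k) (hom_of \<Phi> y') = (T ^^ l) (hom_of \<Phi> x')" if "y' \<in> V" "x' \<in> W" "(T ^^ i) y' = (T ^^ j) x'" for y' x'
  proof -
    have "(y', int i - int j, x') \<in> DR_basic T V i j W" using that by (simp add: DR_basic_iff)
    then have b: "(y', int i - int j, x') \<in> GA" "\<Phi> (y', int i - int j, x') \<in> Z k l" using VW(5) by auto
    obtain q where "\<Phi> (y', int i - int j, x') = (hom_of \<Phi> y', q, hom_of \<Phi> x')"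
      using automorphism_arrow[OF \<Phi>(1) b(1)] by blast
    then show ?thesis using b(2) by (simp add: Z_iff)
  qed
  then show thesis using that VW(1-4) ij p(1) unfolding kl(1) by blast
qed

text \<open>Property (P) makes (h x, 1, h (T x)) an arrow with the same endpoints as the image of
  (x, 1, T x), and \<open>lag_unique\<close>, applied to a neighbourhood of x, fixes the cocycle
  value of that image to be 1. Multiplicativity extends this to all arrows.\<close>

lemma hom_of_all:
  assumes \<Phi>: "\<Phi> \<in> groupoid_automorphisms G" "\<Phi> ` H = H"
  shows "hom_of \<Phi> \<in> Bij S" "homeomorphic_map X X (hom_of \<Phi>)"
    "property_P X T (hom_of \<Phi>)" "property_P X T (inv_into S (hom_of \<Phi>))"
    "(y, n, x) \<in> GA \<Longrightarrow> \<Phi> (y, n, x) = (hom_of \<Phi> y, n, hom_of \<Phi> x)"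
proof -
  obtain \<Psi> where \<Psi>: "\<Psi> \<in> groupoid_automorphisms G" "\<Psi> ` H = H"
    "\<And>\<alpha>. \<alpha> \<in> GA \<Longrightarrow> \<Phi> (\<Psi> \<alpha>) = \<alpha>" "\<And>\<alpha>. \<alpha> \<in> GA \<Longrightarrow> \<Psi> (\<Phi> \<alpha>) = \<alpha>"
    using automorphism_inverse[OF \<Phi>] by blast
  let ?h = "hom_of \<Phi>" and ?g = "hom_of \<Psi>"
  have hg: "?h (?g x) = x" if "x \<in> S" for x
    using \<Psi>(3)[OF arrow_unit[OF that]] automorphism_unit[OF \<Psi>(1) that] automorphism_unit(1)[OF \<Phi>(1)] by simp
  have gh: "?g (?h x) = x" if "x \<in> S" for x
    using \<Psi>(4)[OF arrow_unit[OF that]] automorphism_unit[OF \<Phi>(1) that] automorphism_unit(1)[OF \<Psi>(1)] by simp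
  have S: "?h x \<in> S" "?g x \<in> S" if "x \<in> S" for x
    using automorphism_unit(2) \<Phi>(1) \<Psi>(1) that by auto
  show B: "?h \<in> Bij S"
    unfolding Bij_def using S hg gh by (auto intro!: bij_betw_byWitness[of _ ?g] simp: extensional_def hom_of_def)
  have "homeomorphic_maps X X ?h ?g"
    using hom_of_cont \<Phi>(1) \<Psi>(1) hg gh by (simp add: homeomorphic_maps_def)
  then show hm: "homeomorphic_map X X ?h" using homeomorphic_maps_map by blast
  have "restrict (inv_into S ?h) S = ?g"
  proof (rule extensionalityI[of _ S])
    fix x assume x: "x \<in> S"
    have "inv_into S ?h (?h (?g x)) = ?g x" by (rule Bij_inv_simps(7)[OF B S(2)[OF x]])
    then show "restrict (inv_into S ?h) S x = ?g x" using hg x by simp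
  qed (auto simp: hom_of_def)
  moreover have adm: "admissible (hom_of \<Theta>)" if "\<Theta> \<in> groupoid_automorphisms G" "\<Theta> ` H = H" for \<Theta>
    unfolding admissible_def
  proof (intro allI ballI impI)
    fix i j y x assume "y \<in> S" "x \<in> S" "(T ^^ i) y = (T ^^ j) x"
    then show "\<exists>k l V W. openin X V \<and> openin X W \<and> y \<in> V \<and> x \<in> W \<and> (i = j \<longrightarrow> k = l) \<and>
      (\<forall>y'\<in>V. \<forall>x'\<in>W. (T ^^ i) y' = (T ^^ j) x' \<longrightarrow> (T ^^ k) (hom_of \<Theta> y') = (T ^^ l) (hom_of \<Theta> x'))"
      by (rule hom_of_admissible[OF that]) blast
  qed
  ultimately have gi: "restrict (inv_into S ?h) S = ?g" and ad: "admissible ?h" "admissible ?g"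
    using \<Phi> \<Psi> by auto
  show P: "property_P X T ?h"
    by (rule admissible_property_P[OF B hm ad(1)]) (simp only: gi ad)
  have gB: "?g \<in> Bij S" using restrict_inv_into_Bij[OF B] unfolding gi .
  have gm: "homeomorphic_map X X ?g" using homeomorphic_map_restrict_inv[OF hm] unfolding gi .
  have "inv_into S ?g x = ?h x" if x: "x \<in> S" for x
  proof -
    have "inv_into S ?g (?g (?h x)) = ?h x" by (rule Bij_inv_simps(7)[OF gB S(1)[OF x]])
    then show ?thesis using gh x by simp
  qed
  then have "restrict (inv_into S ?g) S = ?h"
    by (intro extensionalityI[of _ S]) (auto simp: hom_of_def)
  then have "property_P X T ?g"
    by (intro admissible_property_P[OF gB gm ad(2)]) (simp only: ad)
  then show "property_P X T (inv_into S ?h)"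
    unfolding gi[symmetric] by (rule property_P_cong[THEN iffD1, rotated -1]) (use T_in in auto)
  have one: "\<Phi> (x, 1, T x) = (?h x, 1, ?h (T x))" if x: "x \<in> S" for x
  proof -
    have e: "(T ^^ 1) x = (T ^^ 0) (T x)" by simp
    obtain k l V W where *: "openin X V" "openin X W" "x \<in> V" "T x \<in> W"
      "\<Phi> (x, int 1 - int 0, T x) = (?h x, int k - int l, ?h (T x))"
      "\<And>y' x'. y' \<in> V \<Longrightarrow> x' \<in> W \<Longrightarrow> (T ^^ 1) y' = (T ^^ 0) x' \<Longrightarrow> (T ^^ k) (?h y') = (T ^^ l) (?h x')"
      using hom_of_admissible[OF \<Phi> x T_in[OF x] e] by metis
    have "int k - int l = 1"
    proof (rule lag_unique[OF hm, of "V \<inter> {z \<in> S. T z \<in> W}" x])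
      show "openin X (V \<inter> {z \<in> S. T z \<in> W})"
        using *(1) openin_continuous_map_preimage[OF T_cont *(2)] by (rule openin_Int)
      fix z assume "z \<in> V \<inter> {z \<in> S. T z \<in> W}"
      then have z: "z \<in> S" "z \<in> V" "T z \<in> W" by auto
      show "(?h z, int k - int l, ?h (T z)) \<in> GA"
        using *(6)[OF z(2,3)] by (intro arrowI S T_in z(1)) simp
      show "(?h z, 1, ?h (T z)) \<in> GA"
        using property_P_arrow[OF _ P arrow_T[OF z(1), of 1]] S by simp
    qed (use * x in auto)
    then show ?thesis using *(5) by simp
  qed
  have ni: "\<Phi> (x, int i, (T ^^ i) x) = (?h x, int i, ?h ((T ^^ i) x))" if x: "x \<in> S" for x i
  proof (induction i)
    case 0 then show ?case using automorphism_unit(1)[OF \<Phi>(1) x] by simp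
  next
    case (Suc i)
    have b: "((T ^^ i) x, 1, T ((T ^^ i) x)) \<in> GA" using arrow_T[OF Tn_in[OF x, of i], of 1] by simp
    have "\<Phi> (gmul G (x, int i, (T ^^ i) x) ((T ^^ i) x, 1, T ((T ^^ i) x))) =
        gmul G (\<Phi> (x, int i, (T ^^ i) x)) (\<Phi> ((T ^^ i) x, 1, T ((T ^^ i) x)))"
      by (rule automorphismD(5)[OF \<Phi>(1) arrow_T[OF x] b]) simp
    then show ?case using Suc one[OF Tn_in[OF x]] by (simp add: add.commute)
  qed
  show "\<Phi> (y, n, x) = (?h y, n, ?h x)" if a: "(y, n, x) \<in> GA"
  proof -
    obtain i j where ij: "y \<in> S" "x \<in> S" "n = int i - int j" "(T ^^ i) y = (T ^^ j) x" using a by (auto simp: arrows_iff)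
    obtain p where p: "\<Phi> (y, n, x) = (?h y, p, ?h x)" using automorphism_arrow[OF \<Phi>(1) a] by blast
    \<comment> \<open>The product of (y, n, x) and (x, j, T^j x) is (y, i, T^i y), whose image is
      known already, so p + j = i.\<close>
    have "\<Phi> (gmul G (y, n, x) (x, int j, (T ^^ j) x)) = gmul G (\<Phi> (y, n, x)) (\<Phi> (x, int j, (T ^^ j) x))"
      by (rule automorphismD(5)[OF \<Phi>(1) a arrow_T[OF ij(2)]]) simp
    then have "\<Phi> (y, int i, (T ^^ i) y) = (?h y, p + int j, ?h ((T ^^ j) x))"
      using ni[OF ij(2), of j] p ij(3,4) by simp
    then have "p = n" using ni[OF ij(1), of i] ij(3) by simp
    then show ?thesis using p by simp
  qed
qed

end

context compact_DR_system
begin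

subsection \<open>Automorphisms induced by eventual conjugacies\<close>

definition arrow_map :: "('a \<Rightarrow> 'a) \<Rightarrow> 'a \<times> int \<times> 'a \<Rightarrow> 'a \<times> int \<times> 'a"
  where "arrow_map h = (\<lambda>(y, n, x). (h y, n, h x))"

definition pull :: "('a \<Rightarrow> 'a) \<Rightarrow> ('a \<times> int \<times> 'a \<Rightarrow> complex) \<Rightarrow> 'a \<times> int \<times> 'a \<Rightarrow> complex"
  where "pull g \<xi> = (\<lambda>\<alpha>. if \<alpha> \<in> GA then \<xi> (arrow_map g \<alpha>) else 0)"

lemma eventual_power:
  assumes "property_P X T h"
  shows "\<exists>m. \<forall>k. \<forall>x\<in>S. (T ^^ (m + k)) (h x) = (T ^^ m) (h ((T ^^ k) x))"
proof -
  obtain m where m: "\<And>x. x \<in> S \<Longrightarrow> (T ^^ (m + 1)) (h x) = (T ^^ m) (h (T x))"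
    using assms unfolding property_P_def by blast
  have "T \<in> S \<rightarrow> S" using T_in by blast
  then show ?thesis using property_P_funpow[of T X m h] m by blast
qed

text \<open>One exponent m serves all arrows: the equation with exponents (i, j) is carried to the
  one with (m + i, m + j), and so are the corresponding basic sets.\<close>

lemma arrow_map_continuous:
  assumes hc: "continuous_map X X h" and P: "property_P X T h"
  shows "continuous_map \<G> \<G> (arrow_map h)"
proof -
  obtain m where m: "\<And>k x. x \<in> S \<Longrightarrow> (T ^^ (m + k)) (h x) = (T ^^ m) (h ((T ^^ k) x))"
    using eventual_power[OF P] by blast
  have hS: "x \<in> S \<Longrightarrow> h x \<in> S" for x using hc by (auto simp: continuous_map_def)
  have eq: "(T ^^ (m + i)) (h y) = (T ^^ (m + j)) (h x)" if "y \<in> S" "x \<in> S" "(T ^^ i) y = (T ^^ j) x" for y x i j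
    unfolding m[OF that(1)] m[OF that(2)] that(3) ..
  have hA: "(h y, n, h x) \<in> GA" if a: "(y, n, x) \<in> GA" for y n x
  proof -
    obtain i j where ij: "y \<in> S" "x \<in> S" "n = int i - int j" "(T ^^ i) y = (T ^^ j) x" using a by (auto simp: arrows_iff)
    show ?thesis using arrowI[OF hS[OF ij(1)] hS[OF ij(2)] eq[OF ij(1,2,4)]] by (simp add: ij(3))
  qed
  show ?thesis
    unfolding continuous_map_def
  proof (intro conjI allI impI)
    show "arrow_map h \<in> topspace \<G> \<rightarrow> topspace \<G>" using hA by (auto simp: arrow_map_def)
    fix W assume W: "openin \<G> W"
    show "openin \<G> {\<alpha> \<in> topspace \<G>. arrow_map h \<alpha> \<in> W}"
    proof (subst openin_subopen, intro ballI)
      fix \<alpha> assume \<alpha>: "\<alpha> \<in> {\<alpha> \<in> topspace \<G>. arrow_map h \<alpha> \<in> W}"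
      obtain y n x where yx: "\<alpha> = (y, n, x)" by (metis prod_cases3)
      then obtain i j where ij: "y \<in> S" "x \<in> S" "n = int i - int j" "(T ^^ i) y = (T ^^ j) x" using \<alpha> by (auto simp: arrows_iff)
      have "(h y, int (m + i) - int (m + j), h x) \<in> W" using \<alpha> by (simp add: yx arrow_map_def ij(3))
      then obtain U V where UV: "openin X U" "openin X V" "h y \<in> U" "h x \<in> V" "DR_basic T U (m + i) (m + j) V \<subseteq> W"
        using nbhd_basis[OF W hS[OF ij(1)] hS[OF ij(2)] eq[OF ij(1,2,4)]] by blast
      let ?N = "DR_basic T {z \<in> S. h z \<in> U} i j {z \<in> S. h z \<in> V}"
      have "openin \<G> ?N"
        by (intro basic_open openin_continuous_map_preimage[OF hc] UV)
      moreover have "\<alpha> \<in> ?N" unfolding yx DR_basic_iff using UV ij by simp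
      moreover have "\<beta> \<in> {\<alpha> \<in> topspace \<G>. arrow_map h \<alpha> \<in> W}" if b: "\<beta> \<in> ?N" for \<beta>
      proof -
        obtain y' k x' where \<beta>: "\<beta> = (y', k, x')" by (metis prod_cases3)
        have *: "y' \<in> S" "h y' \<in> U" "x' \<in> S" "h x' \<in> V" "k = int i - int j" "(T ^^ i) y' = (T ^^ j) x'"
          using b unfolding \<beta> DR_basic_iff by auto
        have "(h y', k, h x') \<in> DR_basic T U (m + i) (m + j) V"
          unfolding DR_basic_iff using * eq[OF *(1,3,6)] by simp
        moreover have "(y', k, x') \<in> GA" unfolding *(5) by (rule arrowI[OF *(1,3,6)])
        ultimately show ?thesis unfolding \<beta> arrow_map_def using UV(5) by auto
      qed
      ultimately show "\<exists>N. openin \<G> N \<and> \<alpha> \<in> N \<and> N \<subseteq> {\<alpha> \<in> topspace \<G>. arrow_map h \<alpha> \<in> W}" by blast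
    qed
  qed
qed

context
  fixes h g :: "'a \<Rightarrow> 'a"
  assumes hc: "continuous_map X X h" and gc: "continuous_map X X g"
    and hg: "\<And>x. x \<in> S \<Longrightarrow> h (g x) = x" and gh: "\<And>x. x \<in> S \<Longrightarrow> g (h x) = x"
    and Ph: "property_P X T h" and Pg: "property_P X T g"
begin

lemma arrow_map_arrows: "\<alpha> \<in> GA \<Longrightarrow> arrow_map h \<alpha> \<in> GA" "\<alpha> \<in> GA \<Longrightarrow> arrow_map g \<alpha> \<in> GA"
  using funcset_mem[OF continuous_map_funspace[OF arrow_map_continuous[OF hc Ph]], unfolded topspace_G]
    funcset_mem[OF continuous_map_funspace[OF arrow_map_continuous[OF gc Pg]], unfolded topspace_G] by blast+

lemma arrow_map_inverse:
  "\<alpha> \<in> GA \<Longrightarrow> arrow_map h (arrow_map g \<alpha>) = \<alpha>" "\<alpha> \<in> GA \<Longrightarrow> arrow_map g (arrow_map h \<alpha>) = \<alpha>"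
  by (cases \<alpha>; simp add: arrow_map_def arrows_iff hg gh)+

lemma pull_Cc: assumes f: "f \<in> Cc \<G>" shows "pull g f \<in> Cc \<G>"
proof -
  obtain N where N: "\<And>\<alpha>. f \<alpha> \<noteq> 0 \<Longrightarrow> \<alpha> \<in> K N" using CcD(2)[OF f] by blast
  have "compactin \<G> (arrow_map h ` K N)"
    by (rule image_compactin[OF compactin_K arrow_map_continuous[OF hc Ph]])
  then obtain N' where N': "arrow_map h ` K N \<subseteq> K N'" using compactin_subset_K by blast
  show ?thesis
  proof (rule CcI[of _ N'])
    have "continuous_map \<G> euclidean (f \<circ> arrow_map g)"
      by (rule continuous_map_compose[OF arrow_map_continuous[OF gc Pg] CcD(1)[OF f]])
    then show "continuous_map \<G> euclidean (pull g f)"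
      by (rule continuous_map_eq) (simp add: pull_def)
    fix \<alpha> assume "pull g f \<alpha> \<noteq> 0"
    then have a: "\<alpha> \<in> GA" "arrow_map g \<alpha> \<in> K N" using N unfolding pull_def by (metis (full_types))+
    then have "arrow_map h (arrow_map g \<alpha>) \<in> K N'" using N' by blast
    then show "\<alpha> \<in> K N'" using arrow_map_inverse(1)[OF a(1)] by simp
  qed
qed

lemma pull_Cc_H: assumes f: "f \<in> Cc (subtopology \<G> H)" shows "pull g f \<in> Cc (subtopology \<G> H)"
proof -
  have "pull g f \<in> Cc \<G>" using f pull_Cc by (simp add: Cc_H_iff)
  moreover have "\<alpha> \<in> H" if nz: "pull g f \<alpha> \<noteq> 0" for \<alpha>
  proof -
    obtain y n x where \<alpha>: "\<alpha> = (y, n, x)" by (metis prod_cases3)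
    have "\<alpha> \<in> GA" "f (arrow_map g \<alpha>) \<noteq> 0" using nz unfolding pull_def by (auto split: if_splits)
    moreover then have "arrow_map g \<alpha> \<in> H" using f Cc_H_iff by blast
    ultimately show ?thesis by (simp add: \<alpha> arrow_map_def H_iff)
  qed
  ultimately show ?thesis by (simp add: Cc_H_iff)
qed

lemma pull_dsym: "pull g (dsym d) = dsym (\<lambda>x. d (g x))"
proof (rule ext)
  fix \<alpha> :: "'a \<times> int \<times> 'a"
  obtain y n x where \<alpha>: "\<alpha> = (y, n, x)" by (metis prod_cases3)
  have "g y = g x \<longleftrightarrow> y = x" if "y \<in> S" "x \<in> S" using hg[OF that(1)] hg[OF that(2)] by metis
  moreover have "g y \<in> S" if "y \<in> S" using gc that by (auto simp: continuous_map_def)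
  ultimately show "pull g (dsym d) \<alpha> = dsym (\<lambda>x. d (g x)) \<alpha>"
    using arrow_unit[of y] by (auto simp: \<alpha> pull_def arrow_map_def dsym_eq arrows_iff)
qed

text \<open>The map of arrows is injective, so composition with it cannot increase finite sums of
  squares.\<close>

lemma pull_operator:
  obtains U where "complex_linear U" "\<And>\<xi>. ell2_coord (blinfun_apply U \<xi>) = pull g (ell2_coord \<xi>)"
proof -
  have "\<exists>\<eta>. ell2_coord \<eta> = pull g (ell2_coord \<xi>) \<and> norm \<eta> \<le> norm \<xi>" for \<xi>
  proof -
    have "(\<Sum>\<alpha>\<in>F. (cmod (pull g (ell2_coord \<xi>) \<alpha>))\<^sup>2) \<le> (norm \<xi>)\<^sup>2" if F: "finite F" for F
    proof -
      have "inj_on (arrow_map g) GA" using arrow_map_inverse(1) by (metis inj_onI)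
      then have inj: "inj_on (arrow_map g) (F \<inter> GA)" by (rule inj_on_subset) blast
      have "(\<Sum>\<alpha>\<in>F. (cmod (pull g (ell2_coord \<xi>) \<alpha>))\<^sup>2) = (\<Sum>\<alpha>\<in>F \<inter> GA. (cmod (ell2_coord \<xi> (arrow_map g \<alpha>)))\<^sup>2)"
        using F by (intro sum.mono_neutral_cong_right) (auto simp: pull_def)
      also have "\<dots> = (\<Sum>\<beta>\<in>arrow_map g ` (F \<inter> GA). (cmod (ell2_coord \<xi> \<beta>))\<^sup>2)"
        using sum.reindex[OF inj, of "\<lambda>\<beta>. (cmod (ell2_coord \<xi> \<beta>))\<^sup>2"] by (simp add: o_def)
      also have "\<dots> \<le> (norm \<xi>)\<^sup>2" using F by (intro ell2_sum_le_norm) simp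
      finally show ?thesis .
    qed
    then show ?thesis by (rule ell2_of_bounded_sums) auto
  qed
  then obtain u where u: "\<And>\<xi>. ell2_coord (u \<xi>) = pull g (ell2_coord \<xi>)" "\<And>\<xi>. norm (u \<xi>) \<le> norm \<xi>" by metis
  have scl: "u (ell2_scaleC c x) = ell2_scaleC c (u x)" for c x
    by (rule ell2_eqI) (simp add: u ell2_coord_simps pull_def)
  have bl: "bounded_linear u"
  proof (rule bounded_linear_intro[of _ 1])
    show "u (x + y) = u x + u y" for x y by (rule ell2_eqI) (simp add: u ell2_coord_simps pull_def)
    show "u (r *\<^sub>R x) = r *\<^sub>R u x" for r x using scl by (simp flip: ell2_scaleC_of_real)
  qed (use u in simp)
  show thesis
    by (rule that[of "Blinfun u"]) (simp_all add: complex_linear_def bounded_linear_Blinfun_apply[OF bl] scl u)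
qed

end

definition U_op :: "('a \<Rightarrow> 'a) \<Rightarrow> ('a \<times> int \<times> 'a) ell2_op"
  where "U_op g = (SOME U. complex_linear U \<and> (\<forall>\<xi>. ell2_coord (blinfun_apply U \<xi>) = pull g (ell2_coord \<xi>)))"

text \<open>\<open>U_op h\<close> inverts \<open>U_op g\<close> on vectors supported on the arrows,
  so this is a spatial conjugation. Writing \<open>U_op h\<close> for the inverse keeps the formula
  symmetric in the pair.\<close>

definition conj_by :: "('a \<Rightarrow> 'a) \<Rightarrow> ('a \<Rightarrow> 'a) \<Rightarrow> ('a \<times> int \<times> 'a) ell2_op \<Rightarrow> ('a \<times> int \<times> 'a) ell2_op"
  where "conj_by h g a = (U_op g o\<^sub>L a) o\<^sub>L U_op h"

text \<open>The inverse is carried along explicitly, so every statement about (h, g) applies to (g,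
  h) as well; in particular \<open>conj_by g h\<close> inverts \<open>conj_by h g\<close> on
  \<open>A\<close>.\<close>

definition eventual_pair :: "('a \<Rightarrow> 'a) \<Rightarrow> ('a \<Rightarrow> 'a) \<Rightarrow> bool"
  where "eventual_pair h g \<longleftrightarrow> continuous_map X X h \<and> continuous_map X X g \<and>
    (\<forall>x\<in>S. h (g x) = x) \<and> (\<forall>x\<in>S. g (h x) = x) \<and> property_P X T h \<and> property_P X T g"

lemma eventual_pair_sym: "eventual_pair h g \<Longrightarrow> eventual_pair g h"
  by (auto simp: eventual_pair_def)

lemma eventual_pairD:
  assumes "eventual_pair h g"
  shows "continuous_map X X h" "continuous_map X X g" "x \<in> S \<Longrightarrow> h (g x) = x" "x \<in> S \<Longrightarrow> g (h x) = x"
    "property_P X T h" "property_P X T g"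
  using assms by (auto simp: eventual_pair_def)

lemma U_op:
  assumes "eventual_pair h g"
  shows "complex_linear (U_op g)" "ell2_coord (blinfun_apply (U_op g) \<xi>) = pull g (ell2_coord \<xi>)"
proof -
  obtain U where "complex_linear U" "\<And>\<xi>. ell2_coord (blinfun_apply U \<xi>) = pull g (ell2_coord \<xi>)"
    by (rule pull_operator[of h g]) (use eventual_pairD[OF assms] in auto)
  then have "complex_linear U \<and> (\<forall>\<xi>. ell2_coord (blinfun_apply U \<xi>) = pull g (ell2_coord \<xi>))" by blast
  then have "complex_linear (U_op g) \<and> (\<forall>\<xi>. ell2_coord (blinfun_apply (U_op g) \<xi>) = pull g (ell2_coord \<xi>))"
    unfolding U_op_def by (rule someI)
  then show "complex_linear (U_op g)" "ell2_coord (blinfun_apply (U_op g) \<xi>) = pull g (ell2_coord \<xi>)" by auto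
qed

context
  fixes h g assumes hg: "eventual_pair h g"
begin

lemmas pair_sym = eventual_pair_sym[OF hg]

lemma arrow_map_in: "\<alpha> \<in> GA \<Longrightarrow> arrow_map h \<alpha> \<in> GA" "\<alpha> \<in> GA \<Longrightarrow> arrow_map g \<alpha> \<in> GA"
  using arrow_map_arrows[of h g] eventual_pairD[OF hg] by blast+

lemma arrow_map_inv:
  "\<alpha> \<in> GA \<Longrightarrow> arrow_map h (arrow_map g \<alpha>) = \<alpha>" "\<alpha> \<in> GA \<Longrightarrow> arrow_map g (arrow_map h \<alpha>) = \<alpha>"
  using arrow_map_inverse[of h g] eventual_pairD[OF hg] by blast+

lemma U_op_comp: "U_op h o\<^sub>L U_op g = mul (\<lambda>_. 1)"
proof (rule blinfun_eqI, rule ell2_eqI)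
  fix \<xi> \<alpha>
  show "ell2_coord (blinfun_apply (U_op h o\<^sub>L U_op g) \<xi>) \<alpha> = ell2_coord (blinfun_apply (mul (\<lambda>_. 1)) \<xi>) \<alpha>"
    using arrow_map_in(1)[of \<alpha>] arrow_map_inv(2)[of \<alpha>] by (simp add: U_op[OF hg] U_op[OF pair_sym] mul_coord pull_def)
qed

lemma U_op_delta: "blinfun_apply (U_op h) (ell2_delta \<beta>) = (if \<beta> \<in> GA then ell2_delta (arrow_map g \<beta>) else 0)"
proof (rule ell2_eqI)
  fix \<alpha>
  have "arrow_map h \<alpha> = \<beta> \<longleftrightarrow> \<alpha> = arrow_map g \<beta>" if "\<alpha> \<in> GA" "\<beta> \<in> GA"
    using arrow_map_inv(1)[OF that(2)] arrow_map_inv(2)[OF that(1)] by auto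
  then show "ell2_coord (blinfun_apply (U_op h) (ell2_delta \<beta>)) \<alpha> =
      ell2_coord (if \<beta> \<in> GA then ell2_delta (arrow_map g \<beta>) else 0) \<alpha>"
    using arrow_map_in(1)[of \<alpha>] arrow_map_in(2)[of \<beta>] by (auto simp: U_op[OF pair_sym] pull_def ell2_delta.rep_eq zero_ell2.rep_eq)
qed

lemma conj_by_matrix:
  assumes a: "complex_linear a"
  shows "ell2_coord (blinfun_apply (conj_by h g a) (ell2_delta \<beta>)) \<alpha> =
    (if \<alpha> \<in> GA \<and> \<beta> \<in> GA then ell2_coord (blinfun_apply a (ell2_delta (arrow_map g \<beta>))) (arrow_map g \<alpha>) else 0)"
  by (auto simp: conj_by_def U_op[OF hg] U_op_delta pull_def zero_ell2.rep_eq)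

lemma conj_by_complex_linear: "complex_linear a \<Longrightarrow> complex_linear (conj_by h g a)"
  unfolding conj_by_def by (intro complex_linear_simps U_op[OF hg] U_op[OF pair_sym])

lemma conj_by_cop: assumes f: "f \<in> Cc \<G>" shows "conj_by h g (cop f) = cop (pull g f)"
proof (rule complex_linear_eqI)
  have pf: "pull g f \<in> Cc \<G>" by (rule pull_Cc[OF eventual_pairD[OF hg] f])
  show "complex_linear (cop (pull g f))" by (rule cop(1)[OF pf])
  fix \<alpha> \<beta> :: "'a \<times> int \<times> 'a"
  obtain y n x where \<alpha>: "\<alpha> = (y, n, x)" by (metis prod_cases3)
  obtain z m x' where \<beta>: "\<beta> = (z, m, x')" by (metis prod_cases3)
  have yz: "(y, n - m, z) \<in> GA" if "(y, n, x) \<in> GA" "(z, m, x) \<in> GA"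
    using arrow_comp[OF that(1) arrow_inv[OF that(2)]] by simp
  have gx: "g x = g x' \<longleftrightarrow> x = x'" if "(y, n, x) \<in> GA" "(z, m, x') \<in> GA"
  proof -
    have "x \<in> S" "x' \<in> S" using that unfolding arrows_iff by blast+
    then show ?thesis using eventual_pairD(3)[OF hg] by metis
  qed
  show "ell2_coord (blinfun_apply (conj_by h g (cop f)) (ell2_delta \<beta>)) \<alpha> = ell2_coord (blinfun_apply (cop (pull g f)) (ell2_delta \<beta>)) \<alpha>"
  proof (cases "\<alpha> \<in> GA \<and> \<beta> \<in> GA")
    case True
    have ag: "arrow_map g \<alpha> = (g y, n, g x)" "arrow_map g \<beta> = (g z, m, g x')" by (simp_all add: arrow_map_def \<alpha> \<beta>)
    have "ell2_coord (blinfun_apply (conj_by h g (cop f)) (ell2_delta \<beta>)) \<alpha> = (if g x = g x' then f (g y, n - m, g z) else 0)"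
      using True arrow_map_in(2)[of \<alpha>] arrow_map_in(2)[of \<beta>]
      unfolding conj_by_matrix[OF cop(1)[OF f]] ag cop_matrix[OF f] by simp
    also have "\<dots> = (if x = x' then pull g f (y, n - m, z) else 0)"
      using True gx yz unfolding \<alpha> \<beta> by (auto simp: pull_def arrow_map_def)
    also have "\<dots> = ell2_coord (blinfun_apply (cop (pull g f)) (ell2_delta \<beta>)) \<alpha>"
      using True unfolding \<alpha> \<beta> cop_matrix[OF pf] by simp
    finally show ?thesis .
  next
    case False
    then show ?thesis unfolding conj_by_matrix[OF cop(1)[OF f]] by (auto simp: \<alpha> \<beta> cop_matrix[OF pf])
  qed
qed (rule conj_by_complex_linear[OF cop(1)[OF f]])

lemma conj_by_bounded_linear: "bounded_linear (conj_by h g)"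
  unfolding conj_by_def
  by (intro bounded_linear_compose[OF bounded_bilinear.bounded_linear_left[OF bounded_bilinear_blinfun_compose]]
      bounded_bilinear.bounded_linear_right[OF bounded_bilinear_blinfun_compose])

lemma conj_by_closure:
  assumes "\<And>f. f \<in> F \<Longrightarrow> f \<in> Cc \<G> \<and> pull g f \<in> F"
  shows "conj_by h g ` closure (cop ` F) \<subseteq> closure (cop ` F)"
proof (rule image_closure_subset)
  show "continuous_on (closure (cop ` F)) (conj_by h g)"
    by (rule linear_continuous_on[OF conj_by_bounded_linear])
  have "conj_by h g ` (cop ` F) \<subseteq> cop ` F" using assms conj_by_cop by auto
  then show "conj_by h g ` (cop ` F) \<subseteq> closure (cop ` F)" using closure_subset by blast
qed simp

lemma conj_by_A: "a \<in> A \<Longrightarrow> conj_by h g a \<in> A"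
  using conj_by_closure[of "Cc \<G>"] pull_Cc[OF eventual_pairD[OF hg]] unfolding A_eq by blast

lemma conj_by_B: "a \<in> B \<Longrightarrow> conj_by h g a \<in> B"
  using conj_by_closure[of "Cc (subtopology \<G> H)"] pull_Cc_H[OF eventual_pairD[OF hg]] Cc_H_subset unfolding B_eq by blast

lemma conj_by_mul: "CX d \<Longrightarrow> conj_by h g (mul d) = mul (\<lambda>x. d (g x))"
  unfolding mul_def by (simp add: conj_by_cop dsym_Cc pull_dsym[OF eventual_pairD[OF hg]])

lemma conj_by_D: "a \<in> D \<Longrightarrow> conj_by h g a \<in> D"
  unfolding diagonal_algebra_eq using conj_by_mul CX_compose eventual_pairD(2)[OF hg] by blast

lemma conj_by_inverse: "a \<in> A \<Longrightarrow> conj_by g h (conj_by h g a) = a"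
proof -
  assume a: "a \<in> A"
  have "conj_by g h (conj_by h g a) = (U_op h o\<^sub>L U_op g) o\<^sub>L (a o\<^sub>L (U_op h o\<^sub>L U_op g))"
    unfolding conj_by_def by (rule blinfun_eqI) simp
  then show ?thesis unfolding U_op_comp using A_closed(10,11)[OF a] by simp
qed

lemma conj_by_mult: "a \<in> A \<Longrightarrow> b \<in> A \<Longrightarrow> conj_by h g (a o\<^sub>L b) = conj_by h g a o\<^sub>L conj_by h g b"
proof -
  assume a: "a \<in> A" "b \<in> A"
  have "conj_by h g a o\<^sub>L conj_by h g b = (U_op g o\<^sub>L ((a o\<^sub>L (U_op h o\<^sub>L U_op g)) o\<^sub>L b)) o\<^sub>L U_op h"
    unfolding conj_by_def by (rule blinfun_eqI) simp
  also have "\<dots> = conj_by h g (a o\<^sub>L b)" unfolding U_op_comp A_closed(11)[OF a(1)] conj_by_def ..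
  finally show ?thesis by simp
qed

lemma conj_by_star: "a \<in> A \<Longrightarrow> conj_by h g (op_star a) = op_star (conj_by h g a)"
proof (rule complex_linear_eqI)
  assume "a \<in> A"
  then have a: "complex_linear a" by (rule A_complex_linear)
  show "complex_linear (conj_by h g (op_star a))" "complex_linear (op_star (conj_by h g a))"
    by (intro conj_by_complex_linear op_star_all(1) a)+
  show "ell2_coord (blinfun_apply (conj_by h g (op_star a)) (ell2_delta \<beta>)) \<alpha> =
      ell2_coord (blinfun_apply (op_star (conj_by h g a)) (ell2_delta \<beta>)) \<alpha>" for \<alpha> \<beta>
    by (simp add: conj_by_matrix[OF op_star_all(1)[OF a]] op_star_matrix[OF conj_by_complex_linear[OF a]]
        op_star_matrix[OF a] conj_by_matrix[OF a])
qed

lemma conj_by_linear: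
  "conj_by h g (a + b) = conj_by h g a + conj_by h g b"
  "conj_by h g (op_scaleC c a) = op_scaleC c (conj_by h g a)"
proof -
  show "conj_by h g (a + b) = conj_by h g a + conj_by h g b"
    using conj_by_bounded_linear by (rule bounded_linear.axioms(1)[THEN linear_add])
  show "conj_by h g (op_scaleC c a) = op_scaleC c (conj_by h g a)"
    unfolding conj_by_def by (rule blinfun_eqI) (simp add: op_scaleC_apply complex_linearD[OF U_op(1)[OF hg]])
qed

end

text \<open>Invariance under \<open>conj_by h g\<close> and under its inverse upgrades inclusion to
  equality, for \<open>A\<close>, \<open>B\<close> and \<open>D\<close> alike.\<close>

lemma conj_by_automorphism:
  assumes hg: "eventual_pair h g"
  shows "restrict (conj_by h g) A \<in> star_automorphisms A" "restrict (conj_by h g) A ` B = B"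
    "restrict (conj_by h g) A ` D = D"
proof -
  note gh = eventual_pair_sym[OF hg]
  have img: "restrict (conj_by h g) A ` Q = Q"
    if Q: "Q \<subseteq> A" "\<And>a. a \<in> Q \<Longrightarrow> conj_by h g a \<in> Q" "\<And>a. a \<in> Q \<Longrightarrow> conj_by g h a \<in> Q" for Q
  proof
    show "restrict (conj_by h g) A ` Q \<subseteq> Q" using Q by (auto simp: subset_iff)
    show "Q \<subseteq> restrict (conj_by h g) A ` Q"
    proof
      fix a assume a: "a \<in> Q"
      have "restrict (conj_by h g) A (conj_by g h a) = a"
        using Q(1,3) a conj_by_inverse[OF gh] by (simp add: subset_iff)
      then show "a \<in> restrict (conj_by h g) A ` Q" using Q(3)[OF a] by (metis imageI)
    qed
  qed
  show "restrict (conj_by h g) A ` B = B" by (intro img B_subset_A conj_by_B hg gh)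
  show "restrict (conj_by h g) A ` D = D" by (intro img D_subset_A conj_by_D hg gh)
  have "restrict (conj_by h g) A ` A = A" by (intro img order_refl conj_by_A hg gh)
  moreover have "inj_on (restrict (conj_by h g) A) A"
  proof (rule inj_onI)
    fix a b assume ab: "a \<in> A" "b \<in> A" "restrict (conj_by h g) A a = restrict (conj_by h g) A b"
    then have "conj_by g h (conj_by h g a) = conj_by g h (conj_by h g b)" by simp
    then show "a = b" by (simp only: conj_by_inverse[OF hg] ab(1,2))
  qed
  ultimately have "restrict (conj_by h g) A \<in> Bij A" by (simp add: Bij_def bij_betw_def)
  then show "restrict (conj_by h g) A \<in> star_automorphisms A"
    by (simp add: star_automorphisms_def A_closed conj_by_linear[OF hg] conj_by_mult[OF hg] conj_by_star[OF hg])
qed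

lemma eventual_pair_inv:
  assumes "h \<in> carrier (eventual_automorphism_group X T)"
  shows "eventual_pair h (inv_into S h)"
proof -
  have h: "h \<in> Bij S" "homeomorphic_map X X h" "property_P X T h" "property_P X T (inv_into S h)"
    using assms by (auto simp: eventual_automorphism_group_def)
  then show ?thesis
    unfolding eventual_pair_def using homeo_inv_cont homeomorphic_imp_continuous_map Bij_inv_simps(6,7)[OF h(1)] by blast
qed

lemma conj_by_implements:
  assumes h: "h \<in> carrier (eventual_automorphism_group X T)"
  shows "implements (restrict (conj_by h (inv_into S h)) A) h"
proof -
  note p = eventual_pair_inv[OF h]
  have "restrict (conj_by h (inv_into S h)) A (mul d) = mul (\<lambda>x. d (inv_into S h x))" if "CX d" for d
    using conj_by_mul[OF p that] mul_in_A[OF that] by simp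
  then show ?thesis using h by (simp add: implements_def eventual_automorphism_group_def)
qed

end

context transitive_DR_system
begin

abbreviation "EA \<equiv> eventual_automorphism_group X T"
abbreviation "RWA \<equiv> RW_ambient (DR_groupoid X T) (DR_kernel X T)"
abbreviation "AutH \<equiv> Aut_groupoid_rel (DR_groupoid X T) (DR_kernel X T)"

lemma group_EA: "group EA"
  by (rule group_eventual_automorphism_group) (use T_in in blast)

lemma EA_carrier: "h \<in> carrier EA \<longleftrightarrow>
    h \<in> Bij S \<and> homeomorphic_map X X h \<and> property_P X T h \<and> property_P X T (inv_into S h)"
  by (simp add: eventual_automorphism_group_def)

lemma AutH_carrier: "carrier AutH = {\<Phi> \<in> groupoid_automorphisms G. \<Phi> ` H = H}"
  by (simp add: Aut_groupoid_rel_def)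

lemma cocycle_preserving_image:
  assumes "\<Phi> \<in> Bij GA" "\<And>\<alpha>. \<alpha> \<in> GA \<Longrightarrow> DR_cocycle (\<Phi> \<alpha>) = DR_cocycle \<alpha>"
  shows "\<Phi> ` H = H"
proof
  show "\<Phi> ` H \<subseteq> H"
  proof
    fix \<beta> assume "\<beta> \<in> \<Phi> ` H"
    then obtain \<alpha> where "\<alpha> \<in> H" "\<beta> = \<Phi> \<alpha>" by blast
    then show "\<beta> \<in> H" using assms(2)[of \<alpha>] Bij_inv_simps(1)[OF assms(1), of \<alpha>] by (simp add: DR_kernel_def)
  qed
  show "H \<subseteq> \<Phi> ` H"
  proof
    fix \<alpha> assume \<alpha>: "\<alpha> \<in> H"
    then have GA: "\<alpha> \<in> GA" using H_subset by blast
    let ?\<beta> = "inv_into GA \<Phi> \<alpha>"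
    note I = Bij_inv_simps(5,6)[OF assms(1) GA]
    have "DR_cocycle ?\<beta> = 0" using assms(2)[OF I(1)] I(2) \<alpha> by (simp add: DR_kernel_def)
    then have "?\<beta> \<in> H" using I(1) by (simp add: DR_kernel_def)
    then show "\<alpha> \<in> \<Phi> ` H" using I(2) by (metis imageI)
  qed
qed

theorem AutH_cocycle: "carrier AutH =
    {\<Phi> \<in> carrier (Aut_groupoid G). \<forall>\<alpha>\<in>GA. DR_cocycle (\<Phi> \<alpha>) = DR_cocycle \<alpha>}"
proof -
  have "carrier (Aut_groupoid G) = groupoid_automorphisms G" by (simp add: Aut_groupoid_def)
  moreover have "DR_cocycle (\<Phi> \<alpha>) = DR_cocycle \<alpha>"
    if \<Phi>: "\<Phi> \<in> groupoid_automorphisms G" "\<Phi> ` H = H" and a: "\<alpha> \<in> GA" for \<Phi> \<alpha>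
  proof -
    obtain y n x where \<alpha>: "\<alpha> = (y, n, x)" by (metis prod_cases3)
    show ?thesis using hom_of_all(5)[OF \<Phi>, of y n x] a by (simp add: \<alpha> DR_cocycle_def)
  qed
  moreover have "\<Phi> ` H = H"
    if "\<Phi> \<in> groupoid_automorphisms G" "\<forall>\<alpha>\<in>GA. DR_cocycle (\<Phi> \<alpha>) = DR_cocycle \<alpha>" for \<Phi>
    using cocycle_preserving_image automorphismD(1) that by blast
  ultimately show ?thesis unfolding AutH_carrier by blast
qed

lemma arrow_map_automorphism:
  assumes h: "h \<in> carrier EA"
  shows "restrict (arrow_map h) GA \<in> carrier AutH" "hom_of (restrict (arrow_map h) GA) = h"
proof -
  let ?g = "inv_into S h" and ?\<Phi> = "restrict (arrow_map h) GA"
  have p: "eventual_pair h ?g" by (rule eventual_pair_inv[OF h])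
  note E = eventual_pairD[OF p] and I = arrow_map_inv[OF p] and M = arrow_map_in[OF p]
  have "homeomorphic_maps \<G> \<G> (arrow_map h) (arrow_map ?g)"
    unfolding homeomorphic_maps_def topspace_G
    using arrow_map_continuous[OF E(1,5)] arrow_map_continuous[OF E(2,6)] I by blast
  then have "homeomorphic_map \<G> \<G> (arrow_map h)" using homeomorphic_maps_map by blast
  then have hm: "homeomorphic_map \<G> \<G> ?\<Phi>" by (rule homeomorphic_map_eq) simp
  have B: "?\<Phi> \<in> Bij GA"
    unfolding Bij_def using I M by (auto simp del: split_paired_All intro!: bij_betw_byWitness[of _ "arrow_map ?g"])
  have "gdom G (?\<Phi> \<alpha>) = ?\<Phi> (gdom G \<alpha>) \<and> grng G (?\<Phi> \<alpha>) = ?\<Phi> (grng G \<alpha>)" if a: "\<alpha> \<in> GA" for \<alpha>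
  proof -
    obtain y n x where \<alpha>: "\<alpha> = (y, n, x)" by (metis prod_cases3)
    have "(y, 0, y) \<in> GA" "(x, 0, x) \<in> GA" using a arrow_unit unfolding \<alpha> arrows_iff[of y n x] by auto
    then show ?thesis using a by (simp add: \<alpha> arrow_map_def)
  qed
  moreover have "?\<Phi> (gmul G \<alpha> \<beta>) = gmul G (?\<Phi> \<alpha>) (?\<Phi> \<beta>)"
    if a: "\<alpha> \<in> GA" "\<beta> \<in> GA" "gdom G \<alpha> = grng G \<beta>" for \<alpha> \<beta>
  proof -
    obtain z n y where \<alpha>: "\<alpha> = (z, n, y)" by (metis prod_cases3)
    obtain y' m x where \<beta>: "\<beta> = (y', m, x)" by (metis prod_cases3)
    have "y' = y" using a(3) by (simp add: \<alpha> \<beta>)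
    moreover have "(z, n + m, x) \<in> GA" using arrow_comp a calculation unfolding \<alpha> \<beta> by blast
    ultimately show ?thesis using a by (simp add: \<alpha> \<beta> arrow_map_def)
  qed
  ultimately have \<Phi>: "?\<Phi> \<in> groupoid_automorphisms G"
    unfolding groupoid_automorphisms_def using B hm by blast
  moreover have "?\<Phi> ` H = H"
    by (rule cocycle_preserving_image[OF B]) (simp add: DR_cocycle_def arrow_map_def split: prod.splits)
  ultimately show "?\<Phi> \<in> carrier AutH" unfolding AutH_carrier by blast
  show "hom_of ?\<Phi> = h"
  proof (rule extensionalityI[of _ S])
    show "h \<in> extensional S" using h by (simp add: EA_carrier Bij_def)
    show "hom_of ?\<Phi> x = h x" if "x \<in> S" for x
      using arrow_unit[OF that] that by (simp add: hom_of_def arrow_map_def)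
  qed (simp add: hom_of_def)
qed

text \<open>\<Phi> is recovered from its action on units by \<open>hom_of_all\<close>, which gives
  injectivity; \<open>arrow_map\<close> provides preimages.\<close>

theorem AutH_iso_EA: "AutH \<cong> EA"
proof (rule is_isoI)
  have mem: "hom_of \<Phi> \<in> carrier EA" if "\<Phi> \<in> carrier AutH" for \<Phi>
    using that hom_of_all unfolding AutH_carrier EA_carrier by blast
  show "hom_of \<in> iso AutH EA"
    unfolding iso_iff
  proof (intro conjI)
    show "hom_of \<in> hom AutH EA"
    proof (rule homI)
      show "hom_of \<Phi> \<in> carrier EA" if "\<Phi> \<in> carrier AutH" for \<Phi> by (rule mem[OF that])
      fix \<Phi> \<Psi> assume c: "\<Phi> \<in> carrier AutH" "\<Psi> \<in> carrier AutH"
      then have a: "\<Phi> \<in> groupoid_automorphisms G" "\<Psi> \<in> groupoid_automorphisms G" unfolding AutH_carrier by auto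
      have "\<Phi> \<otimes>\<^bsub>AutH\<^esub> \<Psi> = compose GA \<Phi> \<Psi>"
        using automorphismD(1) a by (simp add: Aut_groupoid_rel_def BijGroup_def)
      moreover have "hom_of \<Phi> \<otimes>\<^bsub>EA\<^esub> hom_of \<Psi> = compose S (hom_of \<Phi>) (hom_of \<Psi>)"
        using mem[OF c(1)] mem[OF c(2)] unfolding EA_carrier
        by (simp add: eventual_automorphism_group_def BijGroup_def)
      moreover have "hom_of (compose GA \<Phi> \<Psi>) = compose S (hom_of \<Phi>) (hom_of \<Psi>)"
      proof (rule extensionalityI[of _ S])
        fix x assume x: "x \<in> S"
        show "hom_of (compose GA \<Phi> \<Psi>) x = compose S (hom_of \<Phi>) (hom_of \<Psi>) x"
          using x arrow_unit[OF x] automorphism_unit[OF a(2) x]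
            automorphism_unit(1)[OF a(1) automorphism_unit(2)[OF a(2) x]]
          by (simp add: compose_eq) (simp add: hom_of_def compose_eq)
      qed (auto simp: hom_of_def compose_def)
      ultimately show "hom_of (\<Phi> \<otimes>\<^bsub>AutH\<^esub> \<Psi>) = hom_of \<Phi> \<otimes>\<^bsub>EA\<^esub> hom_of \<Psi>" by simp
    qed
    show "hom_of ` carrier AutH = carrier EA"
    proof
      show "hom_of ` carrier AutH \<subseteq> carrier EA" using mem by blast
      show "carrier EA \<subseteq> hom_of ` carrier AutH"
      proof
        fix h assume "h \<in> carrier EA"
        from arrow_map_automorphism[OF this] show "h \<in> hom_of ` carrier AutH" by (metis imageI)
      qed
    qed
    show "inj_on hom_of (carrier AutH)"
    proof (rule inj_onI)
      fix \<Phi> \<Psi> assume c: "\<Phi> \<in> carrier AutH" "\<Psi> \<in> carrier AutH" and e: "hom_of \<Phi> = hom_of \<Psi>"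
      have a: "\<Phi> \<in> groupoid_automorphisms G" "\<Phi> ` H = H" "\<Psi> \<in> groupoid_automorphisms G" "\<Psi> ` H = H"
        using c unfolding AutH_carrier by auto
      show "\<Phi> = \<Psi>"
      proof (rule extensionalityI[of _ GA])
        show "\<Phi> \<in> extensional GA" "\<Psi> \<in> extensional GA" using automorphismD(1) a by (auto simp: Bij_def)
        fix \<alpha> assume "\<alpha> \<in> GA"
        then show "\<Phi> \<alpha> = \<Psi> \<alpha>"
          using hom_of_all(5)[OF a(1,2)] hom_of_all(5)[OF a(3,4)] e by (metis prod_cases3)
      qed
    qed
  qed
qed

subsection \<open>The relative Weyl group\<close>

lemma RWA_carrier: "carrier RWA = {\<phi> \<in> star_automorphisms A. \<phi> ` B = B \<and> \<phi> ` D = D}"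
  by (simp add: RW_ambient_def Aut_preserving_def)

lemma compose_image: "C \<subseteq> A' \<Longrightarrow> compose A' f k ` C = f ` (k ` C)"
  unfolding image_image by (intro image_cong) (auto simp: compose_def)

lemma group_RWA: "group RWA"
  unfolding RW_ambient_def Aut_preserving_def
proof (rule group_BijGroup_subset)
  let ?C = "{\<phi> \<in> star_automorphisms A. \<phi> ` B = B \<and> \<phi> ` D = D}"
  show "?C \<subseteq> Bij A" using star_automorphismsD(1) by blast
  have "restrict (\<lambda>a. a) A ` C = (\<lambda>a. a) ` C" if "C \<subseteq> A" for C
    using that by (intro image_cong) auto
  then have "restrict (\<lambda>a. a) A ` C = C" if "C \<subseteq> A" for C using that by simp
  then show "(\<lambda>x\<in>A. x) \<in> ?C"
    using star_automorphisms_id[OF A_concrete_star_algebra] B_subset_A D_subset_A by blast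
  show "compose A \<phi> \<psi> \<in> ?C" if "\<phi> \<in> ?C" "\<psi> \<in> ?C" for \<phi> \<psi>
    using that star_automorphisms_compose[OF A_concrete_star_algebra]
    by (simp add: compose_image[OF B_subset_A] compose_image[OF D_subset_A])
  show "restrict (inv_into A \<phi>) A \<in> ?C" if "\<phi> \<in> ?C" for \<phi>
  proof -
    have \<phi>: "\<phi> \<in> star_automorphisms A" "\<phi> ` B = B" "\<phi> ` D = D" using that by auto
    note P = star_automorphismsD(1)[OF \<phi>(1)]
    show ?thesis
      using star_automorphisms_inv[OF A_concrete_star_algebra \<phi>(1)]
        image_inv_Bij[OF P \<phi>(2) B_subset_A] image_inv_Bij[OF P \<phi>(3) D_subset_A] by simp
  qed
qed

definition homeo_of :: "(('a \<times> int \<times> 'a) ell2_op \<Rightarrow> ('a \<times> int \<times> 'a) ell2_op) \<Rightarrow> 'a \<Rightarrow> 'a"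
  where "homeo_of \<phi> = (THE h. implements \<phi> h)"

lemma homeo_of_eq: "implements \<phi> h \<Longrightarrow> homeo_of \<phi> = h"
  unfolding homeo_of_def using implements_unique by blast

text \<open>The argument runs for \<phi> and for its inverse at once:
  \<open>admissible_property_P\<close> asks for admissibility of h and of its inverse, and the
  latter is implemented by the inverse automorphism.\<close>

lemma homeo_of:
  assumes "\<phi> \<in> carrier RWA" shows "implements \<phi> (homeo_of \<phi>)" "homeo_of \<phi> \<in> carrier EA"
proof -
  have \<phi>: "\<phi> \<in> star_automorphisms A" "\<phi> ` B = B" "\<phi> ` D = D" using assms unfolding RWA_carrier by auto
  let ?h = "homeo_of \<phi>" and ?\<psi> = "restrict (inv_into A \<phi>) A"
  obtain h where "implements \<phi> h" using implements_exists[OF \<phi>(1,3)] by blast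
  then show i: "implements \<phi> ?h" using homeo_of_eq by simp
  let ?k = "restrict (inv_into S ?h) S"
  have j: "implements ?\<psi> ?k" by (rule implements_inv[OF \<phi>(1) i])
  have \<psi>: "?\<psi> \<in> star_automorphisms A" "?\<psi> ` B = B"
    using star_automorphisms_inv[OF A_concrete_star_algebra \<phi>(1)]
      image_inv_Bij[OF star_automorphismsD(1)[OF \<phi>(1)] \<phi>(2) B_subset_A] by auto
  have ad: "admissible ?h" "admissible ?k"
    using implements_admissible[OF \<phi>(1) i] implements_admissible[OF \<psi>(1) j] \<phi>(2) \<psi>(2) by auto
  have h: "?h \<in> Bij S" "homeomorphic_map X X ?h" and k: "?k \<in> Bij S" "homeomorphic_map X X ?k"
    using i j unfolding implements_def by auto
  have "restrict (inv_into S ?k) S = ?h"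
  proof (rule extensionalityI[of _ S])
    fix x assume x: "x \<in> S"
    have "inv_into S ?k (?k (?h x)) = ?h x" by (rule Bij_inv_simps(7)[OF k(1) Bij_inv_simps(1)[OF h(1) x]])
    then show "restrict (inv_into S ?k) S x = ?h x" using Bij_inv_simps(4)[OF h(1) x] x by simp
  qed (use h(1) in \<open>auto simp: Bij_def\<close>)
  then have "property_P X T ?k" by (intro admissible_property_P[OF k ad(2)]) (simp only: ad)
  then have "property_P X T (inv_into S ?h)"
    by (rule property_P_cong[THEN iffD1, rotated -1]) (use T_in in auto)
  then show "?h \<in> carrier EA" unfolding EA_carrier using h admissible_property_P[OF h ad] by blast
qed

lemma implements_compose:
  assumes p: "implements \<phi> h" and q: "implements \<psi> k"
  shows "implements (compose A \<phi> \<psi>) (compose S h k)"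
proof -
  have h: "h \<in> Bij S" "homeomorphic_map X X h" "\<And>d. CX d \<Longrightarrow> \<phi> (mul d) = mul (\<lambda>x. d (inv_into S h x))"
    and k: "k \<in> Bij S" "homeomorphic_map X X k" "\<And>d. CX d \<Longrightarrow> \<psi> (mul d) = mul (\<lambda>x. d (inv_into S k x))"
    using p q unfolding implements_def by auto
  have B: "compose S h k \<in> Bij S" by (rule compose_Bij[OF h(1) k(1)])
  have i: "inv_into S (compose S h k) x = inv_into S k (inv_into S h x)" if x: "x \<in> S" for x
  proof -
    note * = Bij_inv_simps(5)[OF h(1) x] Bij_inv_simps(5)[OF k(1) Bij_inv_simps(5)[OF h(1) x]]
    have "compose S h k (inv_into S k (inv_into S h x)) = x"
      using * Bij_inv_simps(6)[OF h(1) x] Bij_inv_simps(6)[OF k(1) *(1)] by (simp add: compose_eq)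
    then show ?thesis using Bij_inv_simps(7)[OF B *(2)] by simp
  qed
  have "compose A \<phi> \<psi> (mul d) = mul (\<lambda>x. d (inv_into S (compose S h k) x))" if d: "CX d" for d
  proof -
    have "compose A \<phi> \<psi> (mul d) = \<phi> (mul (\<lambda>x. d (inv_into S k x)))"
      using mul_in_A[OF d] k(3)[OF d] by (simp add: compose_eq)
    also have "\<dots> = mul (\<lambda>x. d (inv_into S k (inv_into S h x)))"
      by (rule h(3)[OF CX_compose[OF d homeo_inv_cont[OF k(2)]]])
    also have "\<dots> = mul (\<lambda>x. d (inv_into S (compose S h k) x))" by (rule mul_cong) (simp only: i)
    finally show ?thesis .
  qed
  then show ?thesis using B homeomorphic_map_compose_restrict[OF h(2) k(2)] unfolding implements_def by blast
qed

text \<open>An automorphism that fixes the diagonal cannot enlarge the relation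
  \<open>T\<^sup>N y = T\<^sup>N x\<close> on which a symbol lives, and at points with trivial isotropy
  this relation forces the cocycle to vanish.\<close>

lemma fixing_preserves_B:
  assumes \<phi>: "\<phi> \<in> star_automorphisms A" and fix_D: "\<And>d. CX d \<Longrightarrow> \<phi> (mul d) = mul d"
  shows "\<phi> ` B \<subseteq> B"
proof -
  have inv_id: "inv_into S (\<lambda>x\<in>S. x) x = x" if "x \<in> S" for x
    using Bij_inv_simps(7)[OF id_Bij that] that by simp
  have impl: "implements \<phi> (\<lambda>x\<in>S. x)"
    unfolding implements_def
  proof (intro conjI allI impI id_Bij homeomorphic_map_id_restrict)
    fix d assume d: "CX d"
    have "mul d = mul (\<lambda>x. d (inv_into S (\<lambda>x\<in>S. x) x))" by (rule mul_cong) (simp only: inv_id)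
    then show "\<phi> (mul d) = mul (\<lambda>x. d (inv_into S (\<lambda>x\<in>S. x) x))" using fix_D[OF d] by simp
  qed
  have cop: "\<phi> (cop f) \<in> B" if f: "f \<in> Cc (subtopology \<G> H)" for f
  proof -
    have fG: "f \<in> Cc \<G>" and fH: "\<And>\<alpha>. f \<alpha> \<noteq> 0 \<Longrightarrow> \<alpha> \<in> H" using f Cc_H_iff by blast+
    obtain N where N: "\<And>\<alpha>. f \<alpha> \<noteq> 0 \<Longrightarrow> \<alpha> \<in> K N" using CcD(2)[OF fG] by blast
    \<comment> \<open>At cocycle value 0, membership in \<open>K N\<close> reads T^N y = T^N x, a
      relation that \<open>image_commutation\<close> can transport.\<close>
    have s: "(T ^^ N) y = (T ^^ N) x" if nz: "sym (cop f) (y, n, x) \<noteq> 0" for y n x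
    proof -
      have f0: "f (y, n, x) \<noteq> 0" using nz by (simp add: sym_cop[OF fG])
      have "n = 0" using fH[OF f0] by (simp add: H_iff)
      then show ?thesis using N[OF f0] by (simp add: K_iff)
    qed
    let ?b = "\<phi> (cop f)"
    have bA: "?b \<in> A" by (rule star_automorphismsD(2)[OF \<phi> cop_in_A[OF fG]])
    have bGA: "\<alpha> \<in> GA" if "sym ?b \<alpha> \<noteq> 0" for \<alpha> using sym_outside[OF A_equivariant[OF bA]] that by blast
    have bN: "(T ^^ N) y = (T ^^ N) x" if nz: "sym ?b (y, n, x) \<noteq> 0" for y n x
    proof -
      have "y \<in> S" "x \<in> S" using bGA[OF nz] by (auto simp: arrows_iff)
      then show ?thesis
        using image_commutation[OF \<phi> impl cop_in_A[OF fG] s nz] by (simp only: inv_id)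
    qed
    have bH: "n = 0" if nz: "sym ?b (y, n, x) \<noteq> 0" for y n x
    proof -
      obtain i j where ij: "y \<in> S" "x \<in> S" "n = int i - int j" "(T ^^ i) y = (T ^^ j) x"
        using bGA[OF nz] by (auto simp: arrows_iff)
      have e: "0 < cmod (sym ?b (y, int i - int j, x))" using nz ij(3) by simp
      obtain U V where UV: "openin X U" "openin X V" "y \<in> U" "x \<in> V"
        "\<And>y' x'. y' \<in> U \<Longrightarrow> x' \<in> V \<Longrightarrow> (T ^^ i) y' = (T ^^ j) x' \<Longrightarrow>
          dist (sym ?b (y', int i - int j, x')) (sym ?b (y, int i - int j, x)) < cmod (sym ?b (y, int i - int j, x))"
        using G_continuousD[OF A_sym_continuous[OF bA] ij(1,2,4) e] by blast
      \<comment> \<open>Sources near x that admit a range point y' near y. Some x' among them has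
        trivial isotropy, and the symbol is still nonzero at (y', n, x'). The relation on the
        support gives an arrow of value 0 between x' and y', so n is an isotropy value at
        x'.\<close>
      let ?V = "V \<inter> {z \<in> S. (T ^^ j) z \<in> (T ^^ i) ` U}"
      have "openin X ?V" by (intro openin_Int UV(2) Tn_preimage_open Tn_open UV(1))
      moreover have "x \<in> ?V" using UV(3,4) ij(2) ij(4)[symmetric] by simp
      ultimately obtain x' where x': "x' \<in> ?V" "\<And>n. (x', n, x') \<in> GA \<Longrightarrow> n = 0" using free_point[of ?V] by blast
      then obtain y' where y': "y' \<in> U" "(T ^^ i) y' = (T ^^ j) x'" by force
      have nz': "sym ?b (y', n, x') \<noteq> 0" using UV(5)[OF y'(1) _ y'(2)] x'(1) ij(3) by (auto simp: dist_norm)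
      have S: "y' \<in> S" "x' \<in> S" using bGA[OF nz'] by (auto simp: arrows_iff)
      have "(x', 0, y') \<in> GA" using arrowI[OF S(2,1) bN[OF nz', symmetric]] by simp
      then have "(x', 0 + n, x') \<in> GA" using arrow_comp bGA[OF nz'] by blast
      then show ?thesis using x'(2) by fastforce
    qed
    \<comment> \<open>The support remains in the compact set \<open>K N\<close>, so the image of a
      convolution operator is again one, with a symbol supported in \<open>H\<close>.\<close>
    have sC: "sym ?b \<in> Cc \<G>"
    proof (rule CcI[OF A_sym_continuous[OF bA]])
      fix \<alpha> assume nz: "sym ?b \<alpha> \<noteq> 0"
      obtain y n x where \<alpha>: "\<alpha> = (y, n, x)" by (metis prod_cases3)
      have nz': "sym ?b (y, n, x) \<noteq> 0" using nz \<alpha> by simp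
      have "y \<in> S" "x \<in> S" using bGA[OF nz'] by (auto simp: arrows_iff)
      then show "\<alpha> \<in> K N" using bH[OF nz'] bN[OF nz'] by (simp add: \<alpha> K_iff)
    qed
    have "\<alpha> \<in> H" if nz: "sym ?b \<alpha> \<noteq> 0" for \<alpha>
    proof -
      obtain y n x where \<alpha>: "\<alpha> = (y, n, x)" by (metis prod_cases3)
      then show ?thesis using bH[of y n x] bGA[OF nz] nz by (simp add: H_iff)
    qed
    then have "sym ?b \<in> Cc (subtopology \<G> H)" using sC by (simp add: Cc_H_iff)
    then have "cop (sym ?b) \<in> B" unfolding B_eq by (meson closure_subset imageI subsetD)
    then show ?thesis using A_eq_cop[OF bA sC] by simp
  qed
  \<comment> \<open>Contractivity carries the inclusion from convolution operators over to the
    closure \<open>B\<close>.\<close>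
  have "continuous_on A \<phi>"
    unfolding continuous_on_iff
  proof (intro ballI allI impI)
    fix a and e :: real assume a: "a \<in> A" and e: "0 < e"
    have "dist (\<phi> b) (\<phi> a) \<le> dist b a" if "b \<in> A" for b
      using star_automorphism_contractive[OF A_concrete_star_algebra \<phi> A_closed(9)[OF that a]]
        star_automorphism_diff[OF A_concrete_star_algebra \<phi> that a] by (simp add: dist_norm)
    then show "\<exists>d>0. \<forall>b\<in>A. dist b a < d \<longrightarrow> dist (\<phi> b) (\<phi> a) < e"
      using e by (meson order_le_less_trans)
  qed
  then have "continuous_on B \<phi>" using B_subset_A continuous_on_subset by blast
  then have "\<phi> ` closure (cop ` Cc (subtopology \<G> H)) \<subseteq> B"
    unfolding B_eq by (rule image_closure_subset) (use cop B_eq in auto)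
  then show ?thesis unfolding B_eq .
qed

text \<open>\<open>RW_kernel\<close> is defined without reference to \<open>B\<close>. That its
  members belong to the ambient group follows from \<open>fixing_preserves_B\<close>, applied to
  \<phi> and to its inverse so as to obtain equality.\<close>

lemma RW_kernel_eq: "RW_kernel G = {\<phi> \<in> carrier RWA. homeo_of \<phi> = (\<lambda>x\<in>S. x)}"
proof -
  have inv_id: "inv_into S (\<lambda>x\<in>S. x) x = x" if "x \<in> S" for x
    using Bij_inv_simps(7)[OF id_Bij that] that by simp
  have mul_id: "mul (\<lambda>x. d (inv_into S (\<lambda>x\<in>S. x) x)) = mul d" for d
    by (rule mul_cong) (simp only: inv_id)
  have fix_iff: "(\<forall>b\<in>D. \<phi> b = b) \<longleftrightarrow> (\<forall>d. CX d \<longrightarrow> \<phi> (mul d) = mul d)" for \<phi>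
    unfolding diagonal_algebra_eq by blast
  have K: "\<phi> \<in> RW_kernel G \<longleftrightarrow> \<phi> \<in> star_automorphisms A \<and> (\<forall>d. CX d \<longrightarrow> \<phi> (mul d) = mul d)" for \<phi>
    unfolding RW_kernel_def Aut_fixing_def fix_iff by simp
  have sub: "\<phi> \<in> carrier RWA" if \<phi>: "\<phi> \<in> RW_kernel G" for \<phi>
  proof -
    have f: "\<phi> \<in> star_automorphisms A" "\<And>d. CX d \<Longrightarrow> \<phi> (mul d) = mul d" using \<phi> K by auto
    let ?\<psi> = "restrict (inv_into A \<phi>) A"
    note P = star_automorphismsD(1)[OF f(1)]
    have \<psi>: "?\<psi> \<in> star_automorphisms A" by (rule star_automorphisms_inv[OF A_concrete_star_algebra f(1)])
    have "?\<psi> (mul d) = mul d" if "CX d" for d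
      using Bij_inv_simps(4)[OF P mul_in_A[OF that]] f(2)[OF that] by simp
    then have \<psi>B: "?\<psi> ` B \<subseteq> B" by (rule fixing_preserves_B[OF \<psi>])
    have "B \<subseteq> \<phi> ` B"
    proof
      fix b assume b: "b \<in> B"
      then have "\<phi> (?\<psi> b) = b" using Bij_inv_simps(3)[OF P] B_subset_A by blast
      moreover have "?\<psi> b \<in> B" using \<psi>B b by blast
      ultimately show "b \<in> \<phi> ` B" by (metis imageI)
    qed
    then have "\<phi> ` B = B" using fixing_preserves_B[OF f] by blast
    moreover have "\<phi> ` D = D"
    proof -
      have "\<phi> ` D = (\<lambda>b. b) ` D" using \<phi> unfolding RW_kernel_def Aut_fixing_def by (intro image_cong) auto
      then show ?thesis by simp
    qed
    ultimately show ?thesis unfolding RWA_carrier using f(1) by blast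
  qed
  have one_iff: "homeo_of \<phi> = (\<lambda>x\<in>S. x) \<longleftrightarrow> (\<forall>d. CX d \<longrightarrow> \<phi> (mul d) = mul d)" if "\<phi> \<in> carrier RWA" for \<phi>
  proof
    assume "homeo_of \<phi> = (\<lambda>x\<in>S. x)"
    then show "\<forall>d. CX d \<longrightarrow> \<phi> (mul d) = mul d"
      using homeo_of(1)[OF that] mul_id unfolding implements_def by simp
  next
    assume "\<forall>d. CX d \<longrightarrow> \<phi> (mul d) = mul d"
    then have "implements \<phi> (\<lambda>x\<in>S. x)"
      unfolding implements_def mul_id using id_Bij homeomorphic_map_id_restrict by blast
    then show "homeo_of \<phi> = (\<lambda>x\<in>S. x)" by (rule homeo_of_eq)
  qed
  show ?thesis
  proof (rule Set.set_eqI)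
    fix \<phi>
    have "\<phi> \<in> star_automorphisms A" if "\<phi> \<in> carrier RWA" using that unfolding RWA_carrier by simp
    then show "\<phi> \<in> RW_kernel G \<longleftrightarrow> \<phi> \<in> {\<phi> \<in> carrier RWA. homeo_of \<phi> = (\<lambda>x\<in>S. x)}"
      using sub[of \<phi>] K[of \<phi>] one_iff[of \<phi>] by auto
  qed
qed

text \<open>First isomorphism theorem for \<open>homeo_of\<close>, with the conjugations
  \<open>conj_by\<close> as preimages.\<close>

theorem RW_EA: "RW_kernel G \<lhd> RWA" "RW G H \<cong> EA"
proof -
  interpret R: group RWA by (rule group_RWA)
  interpret E: group EA by (rule group_EA)
  have "homeo_of \<in> hom RWA EA"
  proof (rule homI)
    show "homeo_of \<phi> \<in> carrier EA" if "\<phi> \<in> carrier RWA" for \<phi> by (rule homeo_of(2)[OF that])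
    fix \<phi> \<psi> assume c: "\<phi> \<in> carrier RWA" "\<psi> \<in> carrier RWA"
    then have "\<phi> \<in> Bij A" "\<psi> \<in> Bij A"
      using star_automorphismsD(1)[of \<phi> A] star_automorphismsD(1)[of \<psi> A] unfolding RWA_carrier by simp_all
    then have "\<phi> \<otimes>\<^bsub>RWA\<^esub> \<psi> = compose A \<phi> \<psi>"
      by (simp add: RW_ambient_def Aut_preserving_def BijGroup_def)
    moreover have "homeo_of \<phi> \<otimes>\<^bsub>EA\<^esub> homeo_of \<psi> = compose S (homeo_of \<phi>) (homeo_of \<psi>)"
      using homeo_of(2)[OF c(1)] homeo_of(2)[OF c(2)] unfolding EA_carrier
      by (simp add: eventual_automorphism_group_def BijGroup_def)
    moreover have "homeo_of (compose A \<phi> \<psi>) = compose S (homeo_of \<phi>) (homeo_of \<psi>)"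
      by (intro homeo_of_eq implements_compose homeo_of(1) c)
    ultimately show "homeo_of (\<phi> \<otimes>\<^bsub>RWA\<^esub> \<psi>) = homeo_of \<phi> \<otimes>\<^bsub>EA\<^esub> homeo_of \<psi>" by simp
  qed
  then interpret h: group_hom RWA EA homeo_of by unfold_locales
  have "\<one>\<^bsub>EA\<^esub> = (\<lambda>x\<in>S. x)" by (simp add: eventual_automorphism_group_def BijGroup_def)
  then have k: "kernel RWA EA homeo_of = RW_kernel G" unfolding kernel_def RW_kernel_eq by simp
  show "RW_kernel G \<lhd> RWA" using h.normal_kernel unfolding k .
  have "homeo_of ` carrier RWA = carrier EA"
  proof
    show "homeo_of ` carrier RWA \<subseteq> carrier EA" using homeo_of(2) by blast
    show "carrier EA \<subseteq> homeo_of ` carrier RWA"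
    proof
      fix f assume f: "f \<in> carrier EA"
      let ?\<phi> = "restrict (conj_by f (inv_into S f)) A"
      have "?\<phi> \<in> carrier RWA"
        unfolding RWA_carrier using conj_by_automorphism[OF eventual_pair_inv[OF f]] by blast
      moreover have "homeo_of ?\<phi> = f" by (rule homeo_of_eq[OF conj_by_implements[OF f]])
      ultimately show "f \<in> homeo_of ` carrier RWA" by (metis imageI)
    qed
  qed
  from h.FactGroup_iso[OF this] show "RW G H \<cong> EA" unfolding k RW_def .
qed

theorem RW_AutH: "RW G H \<cong> AutH"
proof -
  have "group AutH" by (rule group_Aut_groupoid_rel_DR[OF H_subset])
  then have "EA \<cong> AutH" using AutH_iso_EA by (rule group.iso_sym)
  with RW_EA(2) show ?thesis by (rule iso_trans)
qed

end

theorem corollary5p4p7: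
  fixes X :: "'a topology" and T :: "'a \<Rightarrow> 'a"
  assumes "Deaconu_Renault_system X T"
    and "topologically_free X T"
    and "topologically_transitive (subgroupoid_of (DR_groupoid X T) (DR_kernel X T))"
    and "\<exists>U. openin X U \<and> compactin X U \<and> U \<subset> topspace X \<and> T ` U = topspace X \<and> inj_on T U"
  shows "compact_space X \<and> proper_map X X T
    \<and> carrier (Aut_groupoid_rel (DR_groupoid X T) (DR_kernel X T)) =
        {\<Phi> \<in> carrier (Aut_groupoid (DR_groupoid X T)).
          \<forall>\<alpha>\<in>arrows (DR_groupoid X T). DR_cocycle (\<Phi> \<alpha>) = DR_cocycle \<alpha>}
    \<and> RW_kernel (DR_groupoid X T) \<lhd> RW_ambient (DR_groupoid X T) (DR_kernel X T)
    \<and> RW (DR_groupoid X T) (DR_kernel X T) \<cong> Aut_groupoid_rel (DR_groupoid X T) (DR_kernel X T)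
    \<and> Aut_groupoid_rel (DR_groupoid X T) (DR_kernel X T) \<cong> eventual_automorphism_group X T
    \<and> RW (DR_groupoid X T) (DR_kernel X T) \<cong> eventual_automorphism_group X T"
proof -
  interpret DR: DR_system X T by unfold_locales (rule assms(1))
  obtain U where "compactin X U" "T ` U = topspace X" using assms(4) by blast
  \<comment> \<open>X is the image of the compact set U under the continuous map T.\<close>
  then have compact: "compact_space X"
    using image_compactin[OF _ DR.T_cont] unfolding compact_space_def by metis
  interpret transitive_DR_system X T by unfold_locales (rule compact assms)+
  have "proper_map X X T"
    using compact Hausdorff_imp_kc_space[OF DR.Hausdorff_X] DR.T_cont by (rule continuous_imp_proper_map)
  then show ?thesis
    using compact AutH_cocycle RW_EA RW_AutH AutH_iso_EA by (intro conjI)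
qed

end
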